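(* Let $H\in(0,d_w-d_h)$ and let $$X(x)=\int_KG_s(x,z)\,W_K(dz),\qquad x\in K,\qquad s=\frac{d_h+2H}{2d_w},$$ be the fractional Brownian field with parameter $H$ on the Sierpiński gasket $K$. Let $\sigma_1,\sigma_2,\sigma_3$ be the three reflection symmetries of $K$. Then for every $i=1,2,3$ the random fields $(X(\sigma_i(x)))_{x\in K}$ and $(X(x))_{x\in K}$ are equal in distribution.
   Context: Gasket and Laplacian. Let $q_0=0$, $q_1=1$, $q_2=e^{i\pi/3}$ in $\mathbb{C}\simeq\mathbb{R}^2$ and $F_i(z)=\frac12(z-q_{i-1})+q_{i-1}$ for $i=1,2,3$. The Sierpiński gasket $K$ is the unique non-empty compact set with $K=\bigcup_{i=1}^3F_i(K)$, and $\mu$ is the Borel measure on $K$ with $\mu(F_{i_1}\circ\cdots\circ F_{i_n}(K))=3^{-n}$ for all $i_1,\dots,i_n\in\{1,2,3\}$. $d_h=\frac{\ln3}{\ln2}$ and $d_w=\frac{\ln5}{\ln2}$. Put $V_0=\{q_0,q_1,q_2\}$, $V_n=\bigcup_{i_1,\dots,i_n}F_{i_1}\circ\cdots\circ F_{i_n}(V_0)$, $V_*=\bigcup_{n\ge0}V_n$, and $$\mathcal{E}_n(f,f)=\frac12\Big(\frac53\Big)^n\sum_{i_1,\dots,i_n}\sum_{x,y\in V_0}\big(f(F_{i_1}\circ\cdots\circ F_{i_n}(x))-f(F_{i_1}\circ\cdots\circ F_{i_n}(y))\big)^2 .$$ Functions $f:V_*\to\mathbb{R}$ with $\mathcal{E}(f,f):=\lim_n\mathcal{E}_n(f,f)<\infty$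 extend uniquely to continuous functions on $K$; $\mathcal{F}$ is the set of these extensions. $(\mathcal{E},\mathcal{F})$ is a local regular Dirichlet form on $L^2(K,\mu)$ with generator $\Delta$ (so $\mathcal{E}(f,g)=-\int_K(\Delta f)g\,d\mu$). Its semigroup $P_t=e^{t\Delta}$ satisfies $P_t1=1$ and has a jointly continuous heat kernel $p_t(x,y)$ with respect to $\mu$. $L^2_0(K,\mu)=\{f\in L^2(K,\mu):\int_K f\,d\mu=0\}$. Symmetries. $\sigma_1,\sigma_2,\sigma_3$ are the reflections about the three lines dividing the triangle with vertices $q_0,q_1,q_2$ into two equal parts (its axes of symmetry); they map $K$ onto itself. Riesz kernel. For $s>0$ and $x\ne y$ in $K$, $G_s(x,y)=\frac1{\Gamma(s)}\int_0^{+\infty}t^{s-1}(p_t(x,y)-1)\,dt$. For $s>\frac{d_h}{2d_w}$ and every $x\in K$, $G_s(x,\cdot)\in L_0^2(K,\mu)$. White noise. $W_K$ is a white noise on $L_0^2(K,\mu)$ with intensity $\mu$: a linear map $f\mapsto\int_Kf\,dW_K$ from $L_0^2(K,\mu)$ into centered jointly Gaussian real random variables with $\mathbb{E}\left(\int_Kf\,dW_K\int_Kg\,dW_K\right)=\int_Kfg\,d\mu$. *)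

theory Defs
  imports "HOL-Probability.Probability"
begin

section \<open>The gasket and its self-similar measure\<close>

definition corner :: "nat \<Rightarrow> complex" where
  "corner j = (if j = 0 then 0 else if j = 1 then 1 else cis (pi / 3))"

definition contraction :: "nat \<Rightarrow> complex \<Rightarrow> complex" where
  "contraction i z = (z - corner (i - 1)) / 2 + corner (i - 1)"

fun word_map :: "nat list \<Rightarrow> complex \<Rightarrow> complex" where
  "word_map [] = id"
| "word_map (i # w) = contraction i \<circ> word_map w"

definition words :: "nat \<Rightarrow> nat list set" where
  "words n = {w. length w = n \<and> set w \<subseteq> {1, 2, 3}}"

definition corners :: "complex set" where
  "corners = {corner 0, corner 1, corner 2}"

definition self_similar :: "complex set \<Rightarrow> bool" where
  "self_similar K \<longleftrightarrow> compact K \<and> K \<noteq> {} \<and> K = (\<Union>i\<in>{1, 2, 3}. contraction i ` K)"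

definition gasket :: "complex set" where
  "gasket = (THE K. self_similar K)"

lemma dist_contraction: "dist (contraction i x) (contraction i y) = dist x y / 2"
proof -
  have "contraction i x - contraction i y = (x - y) / 2"
    by (simp add: contraction_def diff_divide_distrib)
  then show ?thesis
    unfolding dist_norm by (metis norm_divide norm_numeral)
qed

lemma self_similar_subset:
  assumes "self_similar A" "self_similar B"
  shows "A \<subseteq> B"
proof -
  have A: "compact A" "A \<noteq> {}" "A = (\<Union>i\<in>{1, 2, 3}. contraction i ` A)"
    and B: "compact B" "B \<noteq> {}" "B = (\<Union>i\<in>{1, 2, 3}. contraction i ` B)"
    using assms by (auto simp: self_similar_def)
  obtain a where a: "a \<in> A" "\<And>x. x \<in> A \<Longrightarrow> infdist x B \<le> infdist a B"
    using continuous_attains_sup[OF A(1,2), of "\<lambda>x. infdist x B"]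
    using continuous_on_infdist[OF continuous_on_id, of A B] by blast
  obtain i a' where i: "i \<in> {1, 2, 3}" "a' \<in> A" "a = contraction i a'"
    using a(1) A(3) by blast
  obtain b where b: "b \<in> B" "infdist a' B = dist a' b"
    using infdist_attains_inf[OF compact_imp_closed[OF B(1)] B(2)] by blast
  have "contraction i b \<in> B"
    using B(3) i(1) b(1) by blast
  then have "infdist a B \<le> dist a (contraction i b)"
    by (rule infdist_le)
  also have "\<dots> = infdist a' B / 2"
    using i(3) b(2) by (simp add: dist_contraction)
  also have "\<dots> \<le> infdist a B / 2"
    using a(2)[OF i(2)] by simp
  finally have "infdist a B \<le> 0"
    by simp
  then have "infdist x B = 0" if "x \<in> A" for x
    using a(2)[OF that] infdist_nonneg[of x B] by linarith
  then show ?thesis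
    using in_closed_iff_infdist_zero[OF compact_imp_closed[OF B(1)] B(2)] by blast
qed

lemma ex_self_similar: "\<exists>K. self_similar K"
proof -
  let ?I = "{1, 2, 3} :: nat set"
  let ?\<Phi> = "\<lambda>K. \<Union>i\<in>?I. contraction i ` K"
  define D :: "complex set" where "D = cball 0 1"
  define T where "T n = (?\<Phi> ^^ n) D" for n
  have corner: "norm (corner j) \<le> 1" for j
    by (simp add: corner_def)
  have "contraction i z \<in> D" if "z \<in> D" for i z
  proof -
    have "contraction i z = z / 2 + corner (i - 1) / 2"
      by (simp add: contraction_def field_simps)
    then have "norm (contraction i z) \<le> norm z / 2 + norm (corner (i - 1)) / 2"
      by (metis norm_divide norm_numeral norm_triangle_ineq)
    then show ?thesis
      using that corner[of "i - 1"] by (simp add: D_def)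
  qed
  then have step: "?\<Phi> D \<subseteq> D"
    by blast
  have mono: "?\<Phi> X \<subseteq> ?\<Phi> Y" if "X \<subseteq> Y" for X Y
    using that by blast
  have T_Suc: "T (Suc n) = ?\<Phi> (T n)" for n
    by (simp add: T_def)
  have dec: "T (Suc n) \<subseteq> T n" for n
  proof (induction n)
    case 0
    show ?case using step by (simp add: T_def)
  next
    case (Suc n)
    show ?case using mono[OF Suc] by (simp only: T_Suc)
  qed
  have cont: "continuous_on X (contraction i)" for i X
    unfolding contraction_def by (intro continuous_intros) auto
  have comp: "compact (T n)" for n
  proof (induction n)
    case 0
    show ?case by (simp add: T_def D_def)
  next
    case (Suc n)
    show ?case unfolding T_Suc
      by (intro compact_UN compact_continuous_image cont Suc) auto
  qed
  have corner0: "0 \<in> T n" for n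
  proof (induction n)
    case 0
    show ?case by (simp add: T_def D_def)
  next
    case (Suc n)
    have "contraction 1 0 = 0" by (simp add: contraction_def corner_def)
    then show ?case unfolding T_Suc using Suc by force
  qed
  have anti: "T n \<subseteq> T m" if "m \<le> n" for m n
    using that dec by (rule lift_Suc_antimono_le[rotated])
  define K where "K = (\<Inter>n. T n)"
  have K: "compact K"
    unfolding K_def using comp by (intro compact_Inter) auto
  have ne: "K \<noteq> {}"
    unfolding K_def using corner0 by blast
  have "?\<Phi> K \<subseteq> K"
  proof
    fix z assume "z \<in> ?\<Phi> K"
    then obtain i y where z: "i \<in> ?I" "y \<in> K" "z = contraction i y"
      by blast
    have "z \<in> T (Suc n)" for n
      unfolding T_Suc using z by (auto simp: K_def)
    then show "z \<in> K"
      using dec by (auto simp: K_def)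
  qed
  moreover have "K \<subseteq> ?\<Phi> K"
  proof
    fix z assume z: "z \<in> K"
    \<comment> \<open>one of the three maps has preimages of \<open>z\<close> in infinitely many, hence all, \<open>T n\<close>\<close>
    have "\<exists>i\<in>?I. \<forall>n. z \<in> contraction i ` T n"
    proof (rule ccontr)
      assume "\<not> ?thesis"
      then obtain f where f: "\<And>i. i \<in> ?I \<Longrightarrow> z \<notin> contraction i ` T (f i)"
        by metis
      define n where "n = Max (f ` ?I)"
      have "f i \<le> n" if "i \<in> ?I" for i
        unfolding n_def using that by (intro Max_ge) auto
      then have "z \<notin> contraction i ` T n" if "i \<in> ?I" for i
        using f[OF that] anti that by blast
      then have "z \<notin> T (Suc n)"
        unfolding T_Suc by blast
      then show False
        using z by (auto simp: K_def)
    qed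
    then obtain i where i: "i \<in> ?I" "\<And>n. z \<in> contraction i ` T n"
      by blast
    have inj: "inj (contraction i)"
      by (rule injI) (metis dist_contraction dist_eq_0_iff divide_eq_0_iff zero_neq_numeral)
    obtain y where y: "z = contraction i y" "y \<in> T 0"
      using i(2) by blast
    then have "y \<in> T n" for n
      using i(2)[of n] inj by (auto dest: injD)
    then show "z \<in> ?\<Phi> K"
      using y(1) i(1) by (auto simp: K_def)
  qed
  ultimately show ?thesis
    using K ne unfolding self_similar_def by (intro exI[of _ K] conjI subset_antisym)
qed

lemma self_similar_gasket: "self_similar gasket"
  unfolding gasket_def
  using ex_self_similar self_similar_subset by (metis subset_antisym theI')

lemma gasket_unique: "self_similar K \<Longrightarrow> K = gasket"
  using self_similar_gasket self_similar_subset by (metis subset_antisym)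

definition gasket_measure :: "complex measure \<Rightarrow> bool" where
  "gasket_measure \<mu> \<longleftrightarrow>
     sets \<mu> = sets (restrict_space borel gasket) \<and>
     (\<forall>n. \<forall>w\<in>words n. emeasure \<mu> (word_map w ` gasket) = ennreal ((1 / 3) ^ n))"

definition dim_h :: real where "dim_h = ln 3 / ln 2"

definition dim_w :: real where "dim_w = ln 5 / ln 2"

definition reflect_line :: "complex \<Rightarrow> complex \<Rightarrow> complex \<Rightarrow> complex" where
  \<comment> \<open>orthogonal reflection about the line through the distinct points \<open>a\<close> and \<open>b\<close>\<close>
  "reflect_line a b z = a + (b - a) / cnj (b - a) * cnj (z - a)"

definition gasket_reflection :: "nat \<Rightarrow> complex \<Rightarrow> complex" where
  \<comment> \<open>for \<open>i \<in> {1, 2, 3}\<close>: the axis through \<open>corner (i - 1)\<close> and the midpoint of the opposite side\<close>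
  "gasket_reflection i =
     reflect_line (corner (i - 1)) (midpoint (corner (i mod 3)) (corner ((i + 1) mod 3)))"


section \<open>The Dirichlet form and its generator\<close>

text \<open>The energies are written in polarised form; on the diagonal \<open>f = g\<close> they are the
  quadratic forms on functions on the vertices of all levels.\<close>

definition energy_level :: "nat \<Rightarrow> (complex \<Rightarrow> real) \<Rightarrow> (complex \<Rightarrow> real) \<Rightarrow> real" where
  "energy_level n f g = 1 / 2 * (5 / 3) ^ n *
     (\<Sum>w\<in>words n. \<Sum>x\<in>corners. \<Sum>y\<in>corners.
        (f (word_map w x) - f (word_map w y)) * (g (word_map w x) - g (word_map w y)))"

definition energy :: "(complex \<Rightarrow> real) \<Rightarrow> (complex \<Rightarrow> real) \<Rightarrow> real" where
  "energy f g = lim (\<lambda>n. energy_level n f g)"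

definition energy_domain :: "(complex \<Rightarrow> real) set" where
  \<comment> \<open>\<open>energy_level n f f\<close> is nondecreasing in \<open>n\<close>, so convergence in the reals says that
     the limit is finite\<close>
  "energy_domain = {f. continuous_on gasket f \<and> convergent (\<lambda>n. energy_level n f f)}"

text \<open>Elements of \<open>L\<^sup>2\<close> are represented by functions; operators on \<open>L\<^sup>2\<close> are
  described up to almost everywhere equality.\<close>

definition L2 :: "complex measure \<Rightarrow> (complex \<Rightarrow> real) set" where
  "L2 \<mu> = {f \<in> borel_measurable \<mu>. integrable \<mu> (\<lambda>x. (f x)\<^sup>2)}"

definition L2_0 :: "complex measure \<Rightarrow> (complex \<Rightarrow> real) set" where
  "L2_0 \<mu> = {f \<in> L2 \<mu>. (\<integral>x. f x \<partial>\<mu>) = 0}"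

definition is_laplacian :: "complex measure \<Rightarrow> (complex \<Rightarrow> real) \<Rightarrow> (complex \<Rightarrow> real) \<Rightarrow> bool" where
  \<comment> \<open>\<open>f\<close> lies in the domain of the generator \<open>\<Delta>\<close> of the Dirichlet form and \<open>\<Delta> f = h\<close>\<close>
  "is_laplacian \<mu> f h \<longleftrightarrow> f \<in> L2 \<mu> \<and> h \<in> L2 \<mu> \<and>
     (\<exists>u\<in>energy_domain. (AE x in \<mu>. f x = u x) \<and>
        (\<forall>g\<in>energy_domain. energy u g = - (\<integral>x. h x * g x \<partial>\<mu>)))"


section \<open>Heat semigroup, heat kernel and Riesz kernel\<close>

definition heat_semigroup ::
  "complex measure \<Rightarrow> (real \<Rightarrow> (complex \<Rightarrow> real) \<Rightarrow> (complex \<Rightarrow> real)) \<Rightarrow> bool" where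
  \<comment> \<open>\<open>P t = exp (t \<Delta>)\<close>: the strongly continuous semigroup of symmetric contractions
     on \<open>L\<^sup>2\<close> whose infinitesimal generator, including its domain, is \<open>\<Delta>\<close>\<close>
  "heat_semigroup \<mu> P \<longleftrightarrow>
     (\<forall>t\<ge>0. \<forall>f\<in>L2 \<mu>. P t f \<in> L2 \<mu>) \<and>
     (\<forall>t\<ge>0. \<forall>f\<in>L2 \<mu>. \<forall>g\<in>L2 \<mu>. \<forall>a b.
        AE x in \<mu>. P t (\<lambda>z. a * f z + b * g z) x = a * P t f x + b * P t g x) \<and>
     (\<forall>t\<ge>0. \<forall>f\<in>L2 \<mu>. (\<integral>x. (P t f x)\<^sup>2 \<partial>\<mu>) \<le> (\<integral>x. (f x)\<^sup>2 \<partial>\<mu>)) \<and>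
     (\<forall>t\<ge>0. \<forall>f\<in>L2 \<mu>. \<forall>g\<in>L2 \<mu>. (\<integral>x. P t f x * g x \<partial>\<mu>) = (\<integral>x. f x * P t g x \<partial>\<mu>)) \<and>
     (\<forall>f\<in>L2 \<mu>. AE x in \<mu>. P 0 f x = f x) \<and>
     (\<forall>s\<ge>0. \<forall>t\<ge>0. \<forall>f\<in>L2 \<mu>. AE x in \<mu>. P (s + t) f x = P s (P t f) x) \<and>
     (\<forall>f\<in>L2 \<mu>. ((\<lambda>t. \<integral>x. (P t f x - f x)\<^sup>2 \<partial>\<mu>) \<longlongrightarrow> 0) (at_right 0)) \<and>
     (\<forall>f\<in>L2 \<mu>. \<forall>h\<in>L2 \<mu>.
        ((\<lambda>t. \<integral>x. ((P t f x - f x) / t - h x)\<^sup>2 \<partial>\<mu>) \<longlongrightarrow> 0) (at_right 0)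
          \<longleftrightarrow> is_laplacian \<mu> f h)"

definition heat_kernel ::
  "complex measure \<Rightarrow> (real \<Rightarrow> (complex \<Rightarrow> real) \<Rightarrow> (complex \<Rightarrow> real))
     \<Rightarrow> (real \<Rightarrow> complex \<Rightarrow> complex \<Rightarrow> real) \<Rightarrow> bool" where
  "heat_kernel \<mu> P p \<longleftrightarrow>
     continuous_on ({0<..} \<times> gasket \<times> gasket) (\<lambda>(t, x, y). p t x y) \<and>
     (\<forall>t>0. \<forall>f\<in>L2 \<mu>. AE x in \<mu>. P t f x = (\<integral>y. p t x y * f y \<partial>\<mu>))"

definition riesz_kernel ::
  "(real \<Rightarrow> complex \<Rightarrow> complex \<Rightarrow> real) \<Rightarrow> real \<Rightarrow> complex \<Rightarrow> complex \<Rightarrow> real" where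
  \<comment> \<open>meant for \<open>x \<noteq> y\<close>; the diagonal value is immaterial, as points are null sets\<close>
  "riesz_kernel p s x y =
     1 / Gamma s * (LINT t:{0<..}|lborel. t powr (s - 1) * (p t x y - 1))"


section \<open>White noise and the fractional Brownian field\<close>

definition centered_normal :: "real \<Rightarrow> real measure" where
  \<comment> \<open>standard deviation \<open>\<sigma> \<ge> 0\<close>, with the degenerate case \<open>\<sigma> = 0\<close>\<close>
  "centered_normal \<sigma> =
     (if \<sigma> = 0 then return borel 0 else density lborel (\<lambda>x. ennreal (normal_density 0 \<sigma> x)))"

definition centered_jointly_gaussian :: "'w measure \<Rightarrow> 'i set \<Rightarrow> ('i \<Rightarrow> 'w \<Rightarrow> real) \<Rightarrow> bool" where
  "centered_jointly_gaussian N I Y \<longleftrightarrow>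
     (\<forall>i\<in>I. Y i \<in> borel_measurable N) \<and>
     (\<forall>J c. finite J \<and> J \<subseteq> I \<longrightarrow>
        (\<exists>\<sigma>\<ge>0. distr N borel (\<lambda>\<omega>. \<Sum>i\<in>J. c i * Y i \<omega>) = centered_normal \<sigma>))"

definition white_noise ::
  "complex measure \<Rightarrow> 'w measure \<Rightarrow> ((complex \<Rightarrow> real) \<Rightarrow> 'w \<Rightarrow> real) \<Rightarrow> bool" where
  "white_noise \<mu> N W \<longleftrightarrow> prob_space N \<and>
     centered_jointly_gaussian N (L2_0 \<mu>) W \<and>
     (\<forall>f\<in>L2_0 \<mu>. \<forall>g\<in>L2_0 \<mu>. \<forall>a b.
        AE \<omega> in N. W (\<lambda>z. a * f z + b * g z) \<omega> = a * W f \<omega> + b * W g \<omega>) \<and>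
     (\<forall>f\<in>L2_0 \<mu>. \<forall>g\<in>L2_0 \<mu>. (\<integral>\<omega>. W f \<omega> * W g \<omega> \<partial>N) = (\<integral>x. f x * g x \<partial>\<mu>))"

definition white_noise_integral ::
  "complex measure \<Rightarrow> ((complex \<Rightarrow> real) \<Rightarrow> 'w \<Rightarrow> real) \<Rightarrow> (complex \<Rightarrow> real) \<Rightarrow> 'w \<Rightarrow> real" where
  \<comment> \<open>the integrals are only defined on \<open>L2_0 \<mu>\<close>; they are totalised by 0, as
     the Bochner integral is for non-integrable functions\<close>
  "white_noise_integral \<mu> W f \<omega> = (if f \<in> L2_0 \<mu> then W f \<omega> else 0)"

definition fractional_brownian_field ::
  "complex measure \<Rightarrow> (real \<Rightarrow> complex \<Rightarrow> complex \<Rightarrow> real) \<Rightarrow> ((complex \<Rightarrow> real) \<Rightarrow> 'w \<Rightarrow> real)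
     \<Rightarrow> real \<Rightarrow> complex \<Rightarrow> 'w \<Rightarrow> real" where
  "fractional_brownian_field \<mu> p W H x =
     white_noise_integral \<mu> W (riesz_kernel p ((dim_h + 2 * H) / (2 * dim_w)) x)"

definition field_law :: "'w measure \<Rightarrow> 'i set \<Rightarrow> ('i \<Rightarrow> 'w \<Rightarrow> real) \<Rightarrow> ('i \<Rightarrow> real) measure" where
  \<comment> \<open>law on the product \<open>\<sigma>\<close>-algebra, hence the family of finite-dimensional distributions\<close>
  "field_law N I Y = distr N (\<Pi>\<^sub>M i\<in>I. borel) (\<lambda>\<omega>. \<lambda>i\<in>I. Y i \<omega>)"

end

theory Submission
  imports Defs
begin

text \<open>The field is a centred Gaussian family, so its law is determined by the variances of its finite
  linear combinations, and by the isometry of the white noise these are integrals of squares of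
  linear combinations of the functions \<open>G s x\<close>. A reflection \<open>\<sigma>\<close> preserves \<open>\<mu>\<close>, so all these
  integrals are unchanged as soon as \<open>G s (\<sigma> x) (\<sigma> z) = G s x z\<close>, and the Riesz kernel inherits
  this symmetry from the heat kernel. The heart of the matter is therefore
  \<open>p t (\<sigma> x) (\<sigma> y) = p t x y\<close> (\<open>heat_kernel_reflection\<close>).

  The reflected kernel \<open>p t (\<sigma> x) (\<sigma> y)\<close> is a heat kernel of the reflected semigroup
  \<open>f \<mapsto> P t (f \<circ> \<sigma>) \<circ> \<sigma>\<close>. Since \<open>\<sigma>\<close> permutes the cells of every level, it preserves the energies
  and the measure (\<open>energy_level_reflection\<close>, \<open>distr_reflection\<close>), hence the Laplacian together
  with its domain, and the reflected semigroup has the same generator as \<open>P\<close>. Equality of the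
  kernels follows because the generator determines the semigroup and the semigroup determines its
  continuous kernel (\<open>heat_kernel_unique\<close>).

  That two symmetric contraction semigroups \<open>P\<close> and \<open>Q\<close> with the same generator agree is seen from
  \<open>s \<mapsto> \<integral> Q s f * P (t - s) g \<partial>\<mu>\<close>, which is constant for \<open>f\<close> and \<open>g\<close> in the domain of the generator
  (\<open>semigroups_agree_weakly_on_domain\<close>). The domain is dense because it contains the averages of
  \<open>P s f\<close> over time intervals (\<open>domain_dense\<close>); the continuous kernel gives pointwise meaning to
  these averages, so that ordinary integrals over time suffice.

  On the probabilistic side, the passage from linear combinations to the joint law is the
  Cramer-Wold theorem (\<open>joint_law_eqI\<close>), obtained from the uniqueness theorem for characteristic
  functions on the line by treating one coordinate at a time.\<close>

section \<open>Symmetries of the gasket\<close>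

text \<open>The reflection \<open>i\<close> fixes the corner with index \<open>i\<close> and exchanges the two others; as the indices
  \<open>1, 2, 3\<close> add up to \<open>6\<close>, the partner of \<open>j\<close> is \<open>6 - i - j\<close>.\<close>

definition swap_index :: "nat \<Rightarrow> nat \<Rightarrow> nat" where
  "swap_index i j = (if j = i then i else 6 - i - j)"

lemma swap_index_mem: "i \<in> {1, 2, 3} \<Longrightarrow> j \<in> {1, 2, 3} \<Longrightarrow> swap_index i j \<in> {1, 2, 3}"
  by (auto simp: swap_index_def)

lemma swap_index_swap_index:
  "i \<in> {1, 2, 3} \<Longrightarrow> j \<in> {1, 2, 3} \<Longrightarrow> swap_index i (swap_index i j) = j"
  by (auto simp: swap_index_def)

lemma cis_pi_third: "cis (pi / 3) = Complex (1 / 2) (sqrt 3 / 2)"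
  by (simp add: complex_eq_iff cos_60 sin_60)

lemma cis_pi_third_relation: "cis (pi / 3) + cnj (cis (pi / 3)) * cnj (cis (pi / 3)) = 0"
  unfolding cis_pi_third by (simp add: complex_eq_iff)

lemma reflect_line_eq:
  assumes "c * cnj (b - a) = b - a" "b \<noteq> a"
  shows "reflect_line a b z = a + c * cnj (z - a)"
proof -
  have "(b - a) / cnj (b - a) = c"
    using assms by (subst nonzero_divide_eq_eq) auto
  then show ?thesis
    by (simp add: reflect_line_def)
qed

lemma gasket_reflection_formula:
  shows "gasket_reflection 1 z = cis (pi / 3) * cnj z"
    and "gasket_reflection 2 z = cis (pi / 3) + cnj (cis (pi / 3)) * cnj z"
    and "gasket_reflection 3 z = 1 - cnj z"
proof -
  have "gasket_reflection 1 z = reflect_line 0 (midpoint 1 (cis (pi / 3))) z"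
    by (simp only: gasket_reflection_def) (simp add: corner_def)
  also have "\<dots> = 0 + cis (pi / 3) * cnj (z - 0)"
    by (rule reflect_line_eq) (unfold cis_pi_third midpoint_def, simp_all add: complex_eq_iff)
  finally show "gasket_reflection 1 z = cis (pi / 3) * cnj z"
    by simp
  have "gasket_reflection 2 z = reflect_line 1 (midpoint (cis (pi / 3)) 0) z"
    by (simp only: gasket_reflection_def) (simp add: corner_def)
  also have "\<dots> = 1 + cnj (cis (pi / 3)) * cnj (z - 1)"
    by (rule reflect_line_eq) (unfold cis_pi_third midpoint_def, simp_all add: complex_eq_iff)
  also have "\<dots> = cis (pi / 3) + cnj (cis (pi / 3)) * cnj z"
    unfolding cis_pi_third by (simp add: complex_eq_iff algebra_simps)
  finally show "gasket_reflection 2 z = cis (pi / 3) + cnj (cis (pi / 3)) * cnj z" .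
  have "gasket_reflection 3 z = reflect_line (cis (pi / 3)) (midpoint 0 1) z"
    by (simp only: gasket_reflection_def) (simp add: corner_def)
  also have "\<dots> = cis (pi / 3) + (- 1) * cnj (z - cis (pi / 3))"
    by (rule reflect_line_eq) (unfold cis_pi_third midpoint_def, simp_all add: complex_eq_iff)
  also have "\<dots> = 1 - cnj z"
    unfolding cis_pi_third by (simp add: complex_eq_iff)
  finally show "gasket_reflection 3 z = 1 - cnj z" .
qed

text \<open>The last equation expresses that the reflection is an involution: it is
  \<open>gasket_reflection i (gasket_reflection i 0) = 0\<close>.\<close>

lemma gasket_reflection_affine:
  assumes "i \<in> {1, 2, 3}"
  obtains a b where "norm b = 1" "\<And>z. gasket_reflection i z = a + b * cnj z"
    "a + b * cnj a = 0"
proof -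
  consider "i = 1" | "i = 2" | "i = 3"
    using assms by auto
  then show thesis
  proof cases
    case 1
    show ?thesis
      by (rule that[of "cis (pi / 3)" 0]) (simp_all add: 1 gasket_reflection_formula[unfolded One_nat_def])
  next
    case 2
    show ?thesis
      by (rule that[of "cnj (cis (pi / 3))" "cis (pi / 3)"])
        (simp_all add: 2 gasket_reflection_formula cis_cnj[symmetric] cis_mult cis_pi_third_relation)
  next
    case 3
    show ?thesis
      by (rule that[of "-1" 1]) (simp_all add: 3 gasket_reflection_formula)
  qed
qed

lemma gasket_reflection_involution:
  assumes "i \<in> {1, 2, 3}"
  shows "gasket_reflection i (gasket_reflection i z) = z"
proof -
  obtain a b where ab: "norm b = 1" "\<And>z. gasket_reflection i z = a + b * cnj z"
    "a + b * cnj a = 0"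
    using gasket_reflection_affine[OF assms] by metis
  have "b * cnj b = 1"
    using ab(1) complex_norm_square[of b] by simp
  moreover have "gasket_reflection i (gasket_reflection i z) = (a + b * cnj a) + (b * cnj b) * z"
    by (simp add: ab(2) algebra_simps)
  ultimately show ?thesis
    using ab(3) by simp
qed

lemma continuous_on_gasket_reflection:
  assumes "i \<in> {1, 2, 3}"
  shows "continuous_on A (gasket_reflection i)"
proof -
  obtain a b where "\<And>z. gasket_reflection i z = a + b * cnj z"
    using gasket_reflection_affine[OF assms] by metis
  then have "gasket_reflection i = (\<lambda>z. a + b * cnj z)"
    by (rule ext)
  then show ?thesis
    by (auto intro!: continuous_intros)
qed

lemma gasket_reflection_corner:
  assumes "i \<in> {1, 2, 3}" "j \<in> {1, 2, 3}"
  shows "gasket_reflection i (corner (j - 1)) = corner (swap_index i j - 1)"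
proof -
  have "i = 1 \<or> i = 2 \<or> i = 3" "j = 1 \<or> j = 2 \<or> j = 3"
    using assms by auto
  then show ?thesis
    by (elim disjE) (simp_all add: gasket_reflection_formula[unfolded One_nat_def]
      corner_def swap_index_def cis_pi_third complex_eq_iff)
qed

text \<open>The contraction \<open>j\<close> sends \<open>z\<close> to the midpoint of \<open>z\<close> and a corner, and a real affine map preserves
  midpoints; hence only the action of the reflection on the corners matters.\<close>

lemma gasket_reflection_contraction:
  assumes "i \<in> {1, 2, 3}" "j \<in> {1, 2, 3}"
  shows "gasket_reflection i (contraction j z) =
    contraction (swap_index i j) (gasket_reflection i z)"
proof -
  obtain a b where ab: "\<And>z. gasket_reflection i z = a + b * cnj z"
    using gasket_reflection_affine[OF assms(1)] by metis
  have half: "contraction k w = (w + corner (k - 1)) / 2" for k w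
    by (simp add: contraction_def field_simps)
  have mid: "gasket_reflection i ((w + v) / 2) = (gasket_reflection i w + gasket_reflection i v) / 2"
    for w v
    by (simp add: ab field_simps)
  show ?thesis
    by (simp only: half mid gasket_reflection_corner[OF assms])
qed

lemma swap_index_words:
  assumes "i \<in> {1, 2, 3}" "w \<in> words n"
  shows "map (swap_index i) w \<in> words n"
proof -
  have "set w \<subseteq> {1, 2, 3}" "length w = n"
    using assms(2) by (simp_all add: words_def)
  then have "swap_index i ` set w \<subseteq> {1, 2, 3}"
    using swap_index_mem[OF assms(1)] by blast
  then show ?thesis
    using \<open>length w = n\<close> by (simp add: words_def)
qed

lemma gasket_reflection_word_map:
  assumes "i \<in> {1, 2, 3}" "w \<in> words n"
  shows "gasket_reflection i (word_map w z) =
    word_map (map (swap_index i) w) (gasket_reflection i z)"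
  using assms(2)
proof (induction w arbitrary: n)
  case (Cons j w)
  then have j: "j \<in> {1, 2, 3}" and w: "w \<in> words (length w)"
    by (auto simp: words_def)
  show ?case
    by (simp only: word_map.simps list.map o_apply gasket_reflection_contraction[OF assms(1) j]
      Cons.IH[OF w])
qed simp

lemma bij_betw_swap_words:
  assumes "i \<in> {1, 2, 3}"
  shows "bij_betw (map (swap_index i)) (words n) (words n)"
proof -
  have "map (swap_index i) (map (swap_index i) w) = w" if "w \<in> words n" for w
    using that swap_index_swap_index[OF assms]
    by (auto simp: words_def intro!: map_idI)
  then show ?thesis
    by (intro bij_betw_byWitness[where f' = "map (swap_index i)"])
      (auto intro: swap_index_words[OF assms])
qed

lemma bij_betw_reflection_corners:
  assumes "i \<in> {1, 2, 3}"
  shows "bij_betw (gasket_reflection i) corners corners"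
proof -
  have corners: "corners = (\<lambda>j. corner (j - 1)) ` {1, 2, 3}"
    by (simp add: corners_def)
  have "gasket_reflection i ` corners \<subseteq> corners"
  proof
    fix z assume "z \<in> gasket_reflection i ` corners"
    then obtain j where j: "j \<in> {1, 2, 3}" "z = gasket_reflection i (corner (j - 1))"
      unfolding corners by blast
    then show "z \<in> corners"
      unfolding corners gasket_reflection_corner[OF assms j(1)]
      using swap_index_mem[OF assms j(1)] by blast
  qed
  then show ?thesis
    by (intro bij_betw_byWitness[where f' = "gasket_reflection i"])
      (auto simp: gasket_reflection_involution[OF assms])
qed

lemma gasket_unfold: "gasket = (\<Union>j\<in>{1, 2, 3}. contraction j ` gasket)"
  using self_similar_gasket by (simp add: self_similar_def)

lemma compact_gasket: "compact gasket" and gasket_nonempty: "gasket \<noteq> {}"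
  using self_similar_gasket by (simp_all add: self_similar_def)

text \<open>Reflecting the self-similarity equation merely permutes its three terms, so the reflected gasket
  solves the same equation, whose compact solution is unique.\<close>

lemma gasket_reflection_image:
  assumes "i \<in> {1, 2, 3}"
  shows "gasket_reflection i ` gasket = gasket"
proof (rule gasket_unique)
  have "gasket_reflection i ` gasket =
      (\<Union>j\<in>{1, 2, 3}. gasket_reflection i ` contraction j ` gasket)"
    by (subst gasket_unfold) blast
  also have "\<dots> = (\<Union>j\<in>{1, 2, 3}. contraction (swap_index i j) ` gasket_reflection i ` gasket)"
    by (intro SUP_cong refl) (simp add: image_image gasket_reflection_contraction[OF assms])
  also have "\<dots> = (\<Union>j\<in>swap_index i ` {1, 2, 3}. contraction j ` gasket_reflection i ` gasket)"
    by blast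
  also have "swap_index i ` {1, 2, 3} = {1, 2, 3}"
    using assms by (auto simp: swap_index_def)
  finally show "self_similar (gasket_reflection i ` gasket)"
    unfolding self_similar_def
    using compact_continuous_image[OF continuous_on_gasket_reflection[OF assms] compact_gasket]
      gasket_nonempty by blast
qed

lemma gasket_reflection_mem:
  "i \<in> {1, 2, 3} \<Longrightarrow> x \<in> gasket \<Longrightarrow> gasket_reflection i x \<in> gasket"
  using gasket_reflection_image by blast

section \<open>The self-similar measure\<close>

lemma finite_words: "finite (words n)"
  unfolding words_def by (rule finite_subset[OF _ finite_lists_length_eq[of "{1,2,3}" n]]) auto

lemma card_words: "card (words n) = 3 ^ n"
  using card_lists_length_eq[of "{1, 2, 3 :: nat}" n] by (simp add: words_def conj_commute numeral_3_eq_3)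

lemma words_Suc: "words (Suc n) = (\<Union>j\<in>{1, 2, 3}. (#) j ` words n)"
  by (auto simp: words_def length_Suc_conv)

lemma gasket_eq_cells: "gasket = (\<Union>w\<in>words n. word_map w ` gasket)"
proof (induction n)
  case 0
  show ?case by (simp add: words_def)
next
  case (Suc n)
  have "(\<Union>w\<in>words (Suc n). word_map w ` gasket) =
      (\<Union>j\<in>{1, 2, 3}. contraction j ` (\<Union>w\<in>words n. word_map w ` gasket))"
    unfolding words_Suc by (simp add: image_UN image_comp UN_extend_simps(9))
  then show ?case
    using Suc gasket_unfold by simp
qed

lemma dist_word_map: "dist (word_map w x) (word_map w y) = dist x y / 2 ^ length w"
  by (induction w) (simp_all add: dist_contraction)

lemma compact_cell: "compact (word_map w ` gasket)"
proof -
  have "1-lipschitz_on UNIV (word_map w)"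
    by (intro lipschitz_onI) (simp_all add: dist_word_map divide_le_eq mult_left_le_one_le
      mult_le_cancel_left1 field_simps)
  then show ?thesis
    by (intro compact_continuous_image compact_gasket)
      (metis lipschitz_on_continuous_on continuous_on_subset subset_UNIV)
qed

locale gasket_measure_space =
  fixes \<mu> :: "complex measure"
  assumes gasket_measure: "gasket_measure \<mu>"
begin

lemma sets_mu: "sets \<mu> = sets (restrict_space borel gasket)"
  using gasket_measure by (simp add: gasket_measure_def)

lemma space_mu [simp]: "space \<mu> = gasket"
  using sets_eq_imp_space_eq[OF sets_mu] by (simp add: space_restrict_space)

lemma borel_gasket: "gasket \<in> sets borel"
  using compact_gasket by (simp add: borel_compact)

lemma sets_mu_iff: "A \<in> sets \<mu> \<longleftrightarrow> A \<in> sets borel \<and> A \<subseteq> gasket"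
  using borel_gasket by (auto simp: sets_mu sets_restrict_space_iff)

lemma emeasure_cell: "w \<in> words n \<Longrightarrow> emeasure \<mu> (word_map w ` gasket) = ennreal ((1 / 3) ^ n)"
  using gasket_measure by (auto simp: gasket_measure_def)

sublocale prob_space \<mu>
proof
  have "emeasure \<mu> (word_map [] ` gasket) = ennreal ((1 / 3) ^ 0)"
    by (rule emeasure_cell) (simp add: words_def)
  then show "emeasure \<mu> (space \<mu>) = 1"
    by simp
qed

lemma prob_gasket [simp]: "prob gasket = 1"
  using prob_space by simp

lemma cell_subset: "w \<in> words n \<Longrightarrow> word_map w ` gasket \<subseteq> gasket"
  using gasket_eq_cells by blast

lemma cell_measurable [measurable]: "w \<in> words n \<Longrightarrow> word_map w ` gasket \<in> sets \<mu>"
  by (simp add: sets_mu_iff cell_subset borel_compact compact_cell)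

lemma measure_cell: "w \<in> words n \<Longrightarrow> prob (word_map w ` gasket) = (1 / 3) ^ n"
  using emeasure_cell by (simp add: measure_def)

text \<open>Cells of the same level may touch, but they overlap in null sets only: \<open>3 ^ n\<close> cells of mass
  \<open>(1 / 3) ^ n\<close> cover a space of mass \<open>1\<close>, so subadditivity is an equality for all of them, and
  hence for every subfamily.\<close>

lemma measure_Union_cells:
  assumes "S \<subseteq> words n"
  shows "prob (\<Union>w\<in>S. word_map w ` gasket) = card S * (1 / 3) ^ n"
proof (rule antisym)
  have upper: "prob (\<Union>w\<in>T. word_map w ` gasket) \<le> card T * (1 / 3) ^ n" if "T \<subseteq> words n" for T
  proof -
    have T: "finite T" using that finite_words finite_subset by blast
    have "prob (\<Union>w\<in>T. word_map w ` gasket) \<le> (\<Sum>w\<in>T. prob (word_map w ` gasket))"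
      using that cell_measurable T by (intro finite_measure_subadditive_finite) auto
    also have "\<dots> = card T * (1 / 3) ^ n"
      using that measure_cell[of _ n] by (simp add: subset_iff)
    finally show ?thesis .
  qed
  show "prob (\<Union>w\<in>S. word_map w ` gasket) \<le> card S * (1 / 3) ^ n"
    using upper[OF assms] .
  have meas: "(\<Union>w\<in>T. word_map w ` gasket) \<in> sets \<mu>" if "T \<subseteq> words n" for T
    using that finite_words finite_subset by (intro sets.finite_UN cell_measurable[of _ n]) auto
  have "1 = prob ((\<Union>w\<in>S. word_map w ` gasket) \<union> (\<Union>w\<in>words n - S. word_map w ` gasket))"
    using prob_space gasket_eq_cells[of n] assms
    by (simp add: UN_Un[symmetric] Un_absorb1)
  also have "\<dots> \<le> prob (\<Union>w\<in>S. word_map w ` gasket) + prob (\<Union>w\<in>words n - S. word_map w ` gasket)"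
    using assms by (intro measure_Un_le meas) auto
  also have "\<dots> \<le> prob (\<Union>w\<in>S. word_map w ` gasket) + (3 ^ n - real (card S)) * (1 / 3) ^ n"
    using upper[of "words n - S"] assms card_mono[OF finite_words assms]
    by (simp add: card_Diff_subset finite_subset[OF assms finite_words] card_words of_nat_diff)
  finally show "card S * (1 / 3) ^ n \<le> prob (\<Union>w\<in>S. word_map w ` gasket)"
    by (simp add: left_diff_distrib power_mult_distrib[symmetric])
qed

text \<open>Full support: a cell of small enough diameter around \<open>x\<close> lies inside the ball.\<close>

lemma measure_ball_pos:
  assumes "x \<in> gasket" "0 < r"
  shows "0 < prob (ball x r \<inter> gasket)"
proof -
  obtain n where n: "diameter gasket / 2 ^ n < r"
  proof -
    have "(\<lambda>n. diameter gasket * (1 / 2) ^ n) \<longlonglongrightarrow> diameter gasket * 0"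
      by (intro tendsto_intros) auto
    then have "eventually (\<lambda>n. diameter gasket * (1 / 2) ^ n < r) sequentially"
      using assms(2) by (intro order_tendstoD) auto
    then show ?thesis
      using that by (auto simp: eventually_sequentially power_one_over field_simps)
  qed
  obtain w y where w: "w \<in> words n" "y \<in> gasket" "x = word_map w y"
    using assms(1) gasket_eq_cells[of n] by blast
  have "word_map w ` gasket \<subseteq> ball x r"
  proof safe
    fix z assume z: "z \<in> gasket"
    have "dist x (word_map w z) = dist y z / 2 ^ n"
      using w by (simp add: dist_word_map words_def)
    also have "\<dots> \<le> diameter gasket / 2 ^ n"
      using z w diameter_bounded_bound[OF compact_imp_bounded[OF compact_gasket]]
      by (simp add: divide_right_mono)
    finally show "word_map w z \<in> ball x r"
      using n by simp
  qed
  then have "word_map w ` gasket \<subseteq> ball x r \<inter> gasket"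
    using cell_subset[OF w(1)] by blast
  moreover have "ball x r \<inter> gasket \<in> sets \<mu>"
    using borel_gasket by (simp add: sets_mu_iff)
  ultimately have "prob (word_map w ` gasket) \<le> prob (ball x r \<inter> gasket)"
    by (intro finite_measure_mono)
  then show ?thesis
    using measure_cell[OF w(1)] by (smt (verit) zero_less_power zero_less_divide_1_iff)
qed

lemma continuous_AE_zero:
  fixes f :: "complex \<Rightarrow> real"
  assumes "continuous_on gasket f" "AE x in \<mu>. f x = 0" "x \<in> gasket"
  shows "f x = 0"
proof (rule ccontr)
  assume "f x \<noteq> 0"
  then obtain r where r: "0 < r" "\<And>y. y \<in> gasket \<Longrightarrow> dist y x < r \<Longrightarrow> dist (f y) (f x) < \<bar>f x\<bar>"
    using assms(1,3) unfolding continuous_on_iff by (metis zero_less_abs_iff)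
  have "AE y in \<mu>. y \<notin> ball x r \<inter> gasket"
    using assms(2) by eventually_elim (use r(2) in \<open>fastforce simp: dist_commute dist_real_def\<close>)
  moreover have "ball x r \<inter> gasket \<in> sets \<mu>"
    using borel_gasket by (simp add: sets_mu_iff)
  ultimately have "prob (ball x r \<inter> gasket) = 0"
    by (metis AE_iff_null_sets measure_eq_0_null_sets)
  then show False
    using measure_ball_pos[OF assms(3) r(1)] by simp
qed

lemma continuous_measurable:
  fixes f :: "complex \<Rightarrow> real"
  assumes "continuous_on gasket f"
  shows "f \<in> borel_measurable \<mu>"
proof -
  have "f \<in> borel_measurable (restrict_space borel gasket)"
    by (rule borel_measurable_continuous_on_restrict[OF assms])
  then show ?thesis
    by (simp only: measurable_cong_sets[OF sets_mu refl])
qed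

lemma continuous_bounded:
  fixes f :: "complex \<Rightarrow> real"
  assumes "continuous_on gasket f"
  obtains B where "0 \<le> B" "\<And>x. x \<in> gasket \<Longrightarrow> \<bar>f x\<bar> \<le> B"
proof -
  have "bounded (f ` gasket)"
    by (intro compact_imp_bounded compact_continuous_image assms compact_gasket)
  then obtain B where "\<And>x. x \<in> gasket \<Longrightarrow> \<bar>f x\<bar> \<le> B"
    unfolding bounded_iff by (auto simp: image_iff)
  then show ?thesis
    using gasket_nonempty that by (metis abs_ge_zero ex_in_conv order_trans)
qed

lemma measurable_reflection:
  assumes "i \<in> {1, 2, 3}"
  shows "gasket_reflection i \<in> measurable \<mu> \<mu>"
proof (rule measurableI)
  fix A assume "A \<in> sets \<mu>"
  then have A: "A \<in> sets borel" "A \<subseteq> gasket"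
    by (simp_all add: sets_mu_iff)
  have "gasket_reflection i \<in> borel_measurable borel"
    by (intro borel_measurable_continuous_onI continuous_on_gasket_reflection assms)
  then have "gasket_reflection i -` A \<inter> space borel \<in> sets borel"
    using A(1) by (rule measurable_sets)
  then show "gasket_reflection i -` A \<inter> space \<mu> \<in> sets \<mu>"
    using borel_gasket by (simp add: sets_mu_iff)
qed (simp add: gasket_reflection_mem[OF assms])

end

text \<open>The cells of level \<open>n\<close> that meet \<open>A\<close> cover \<open>A\<close> and stay in a neighbourhood of \<open>A\<close> that shrinks to
  \<open>A\<close>. Both measures give the union of these cells the same mass, which depends only on their
  number.\<close>

lemma measure_le_of_gasket_measures:
  assumes "gasket_measure \<mu>" "gasket_measure \<nu>" "closed A" "A \<subseteq> gasket"
  shows "measure \<mu> A \<le> measure \<nu> A"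
proof (cases "A = {}")
  case False
  interpret M: gasket_measure_space \<mu> by standard fact
  interpret N: gasket_measure_space \<nu> by standard fact
  define S where "S n = {w \<in> words n. word_map w ` gasket \<inter> A \<noteq> {}}" for n
  define B where "B n = {x \<in> gasket. infdist x A \<le> diameter gasket * (1 / 2) ^ n}" for n
  have S: "S n \<subseteq> words n" for n
    by (auto simp: S_def)
  have closed_B: "closed (B n)" for n
  proof -
    have "closed {x. infdist x A \<le> diameter gasket * (1 / 2) ^ n}"
      by (intro closed_Collect_le continuous_intros)
    then show ?thesis
      using closed_Int[OF compact_imp_closed[OF compact_gasket]] by (simp add: B_def Collect_conj_eq)
  qed
  have B_sets: "B n \<in> sets \<nu>" for n
    using borel_closed[OF closed_B[of n]] by (auto simp: N.sets_mu_iff B_def)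
  have cells: "(\<Union>w\<in>S n. word_map w ` gasket) \<subseteq> B n" for n
  proof safe
    fix w y assume w: "w \<in> S n" and y: "y \<in> gasket"
    then obtain z where z: "z \<in> gasket" "word_map w z \<in> A"
      by (auto simp: S_def)
    have "infdist (word_map w y) A \<le> dist (word_map w y) (word_map w z)"
      by (rule infdist_le[OF z(2)])
    also have "\<dots> = dist y z * (1 / 2) ^ n"
      using w by (simp add: dist_word_map S_def words_def power_divide)
    also have "\<dots> \<le> diameter gasket * (1 / 2) ^ n"
      using y z diameter_bounded_bound[OF compact_imp_bounded[OF compact_gasket]]
      by (intro mult_right_mono) auto
    finally show "word_map w y \<in> B n"
      using w y N.cell_subset[of w n] S by (auto simp: B_def)
  qed
  have le: "measure \<mu> A \<le> measure \<nu> (B n)" for n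
  proof -
    have meas: "(\<Union>w\<in>S n. word_map w ` gasket) \<in> sets \<mu>" "(\<Union>w\<in>S n. word_map w ` gasket) \<in> sets \<nu>"
      using S finite_subset[OF S finite_words]
      by (auto intro!: sets.finite_UN M.cell_measurable[of _ n] N.cell_measurable[of _ n])
    have "A \<subseteq> (\<Union>w\<in>S n. word_map w ` gasket)"
    proof
      fix x assume x: "x \<in> A"
      then obtain w where "w \<in> words n" "x \<in> word_map w ` gasket"
        using assms(4) gasket_eq_cells[of n] by blast
      then show "x \<in> (\<Union>w\<in>S n. word_map w ` gasket)"
        using x by (auto simp: S_def)
    qed
    then have "measure \<mu> A \<le> measure \<mu> (\<Union>w\<in>S n. word_map w ` gasket)"
      using meas by (intro M.finite_measure_mono) auto
    also have "\<dots> = measure \<nu> (\<Union>w\<in>S n. word_map w ` gasket)"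
      by (simp add: M.measure_Union_cells[OF S] N.measure_Union_cells[OF S])
    also have "\<dots> \<le> measure \<nu> (B n)"
      by (intro N.finite_measure_mono cells B_sets)
    finally show ?thesis .
  qed
  have d: "0 \<le> diameter gasket"
    by (rule diameter_ge_0[OF compact_imp_bounded[OF compact_gasket]])
  have "decseq B"
  proof (rule decseq_SucI, rule subsetI)
    fix n x assume "x \<in> B (Suc n)"
    then have "x \<in> gasket" "infdist x A * 2 \<le> diameter gasket * (1 / 2) ^ n"
      by (auto simp: B_def)
    then show "x \<in> B n"
      using infdist_nonneg[of x A] by (simp add: B_def)
  qed
  then have "(\<lambda>n. measure \<nu> (B n)) \<longlonglongrightarrow> measure \<nu> (\<Inter>n. B n)"
    using B_sets by (intro N.finite_Lim_measure_decseq) auto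
  also have "(\<Inter>n. B n) = A"
  proof
    show "A \<subseteq> (\<Inter>n. B n)"
      using assms(4) d by (auto simp: B_def)
    show "(\<Inter>n. B n) \<subseteq> A"
    proof
      fix x assume x: "x \<in> (\<Inter>n. B n)"
      have "(\<lambda>n. diameter gasket * (1 / 2) ^ n) \<longlonglongrightarrow> diameter gasket * 0"
        by (intro tendsto_intros) auto
      then have "infdist x A \<le> diameter gasket * 0"
        by (rule LIMSEQ_le_const) (use x in \<open>auto simp: B_def\<close>)
      then have "infdist x A = 0"
        using infdist_nonneg[of x A] by simp
      then show "x \<in> A"
        using in_closed_iff_infdist_zero[OF assms(3) False] by blast
    qed
  qed
  finally show ?thesis
    by (rule LIMSEQ_le_const) (use le in auto)
qed simp

lemma gasket_measure_unique:
  assumes "gasket_measure \<mu>" "gasket_measure \<nu>"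
  shows "\<mu> = \<nu>"
proof -
  interpret M: gasket_measure_space \<mu> by standard fact
  interpret N: gasket_measure_space \<nu> by standard fact
  let ?E = "{A. closed A \<and> A \<subseteq> gasket}"
  have "(\<inter>) gasket ` Collect closed = ?E"
  proof
    show "(\<inter>) gasket ` Collect closed \<subseteq> ?E"
      using closed_Int[OF compact_imp_closed[OF compact_gasket]] by auto
    show "?E \<subseteq> (\<inter>) gasket ` Collect closed"
    proof
      fix A assume "A \<in> ?E"
      then have "A = gasket \<inter> A" "closed A"
        by auto
      then show "A \<in> (\<inter>) gasket ` Collect closed"
        by (metis imageI mem_Collect_eq)
    qed
  qed
  moreover have "sets (restrict_space borel gasket) = sigma_sets gasket ((\<inter>) gasket ` Collect closed)"
  proof -
    have borel: "sets (borel :: complex measure) = sigma_sets UNIV (Collect closed)"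
      by (subst borel_eq_closed) simp
    show ?thesis
      unfolding sets_restrict_space borel
      using M.borel_gasket borel by (intro sigma_sets_Int) auto
  qed
  ultimately have gen: "sets (restrict_space borel gasket) = sigma_sets gasket ?E"
    by (simp only:)
  have eq: "emeasure \<mu> A = emeasure \<nu> A" if "A \<in> ?E" for A
  proof -
    have "measure \<mu> A = measure \<nu> A"
      using measure_le_of_gasket_measures[OF assms, of A]
        measure_le_of_gasket_measures[OF assms(2,1), of A] that by simp
    then show ?thesis
      by (simp add: M.emeasure_eq_measure N.emeasure_eq_measure)
  qed
  show ?thesis
  proof (rule measure_eqI_generator_eq[where E = ?E and \<Omega> = gasket and A = "\<lambda>_. gasket"])
    show "Int_stable ?E"
      by (auto simp: Int_stable_def)
    show "range (\<lambda>_::nat. gasket) \<subseteq> ?E"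
      using compact_imp_closed[OF compact_gasket] by auto
    show "emeasure \<mu> A = emeasure \<nu> A" if "A \<in> ?E" for A
      using eq[OF that] .
    show "sets \<mu> = sigma_sets gasket ?E" "sets \<nu> = sigma_sets gasket ?E"
      using gen by (simp_all only: M.sets_mu N.sets_mu)
  qed auto
qed

context gasket_measure_space
begin

text \<open>The reflection permutes the cells of each level, so the image measure has the defining property
  of \<open>\<mu>\<close>, and there is only one such measure.\<close>

lemma distr_reflection:
  assumes "i \<in> {1, 2, 3}"
  shows "distr \<mu> \<mu> (gasket_reflection i) = \<mu>"
proof (rule gasket_measure_unique[OF _ gasket_measure])
  have "emeasure (distr \<mu> \<mu> (gasket_reflection i)) (word_map w ` gasket) = ennreal ((1 / 3) ^ n)"
    if w: "w \<in> words n" for n w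
  proof -
    let ?w = "map (swap_index i) w"
    have "gasket_reflection i ` word_map w ` gasket = word_map ?w ` gasket_reflection i ` gasket"
      unfolding image_image by (intro image_cong refl gasket_reflection_word_map[OF assms w])
    then have img: "gasket_reflection i ` word_map w ` gasket = word_map ?w ` gasket"
      by (simp only: gasket_reflection_image[OF assms])
    have "gasket_reflection i -` (word_map w ` gasket) \<inter> gasket =
        gasket_reflection i ` word_map w ` gasket"
    proof (intro equalityI subsetI)
      fix x assume "x \<in> gasket_reflection i -` (word_map w ` gasket) \<inter> gasket"
      then have "gasket_reflection i x \<in> word_map w ` gasket"
        by blast
      then have "gasket_reflection i (gasket_reflection i x) \<in> gasket_reflection i ` word_map w ` gasket"
        by (rule imageI)
      then show "x \<in> gasket_reflection i ` word_map w ` gasket"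
        by (simp only: gasket_reflection_involution[OF assms])
    next
      fix x assume "x \<in> gasket_reflection i ` word_map w ` gasket"
      then obtain y where y: "y \<in> word_map w ` gasket" "x = gasket_reflection i y"
        by blast
      moreover have "x \<in> gasket"
        using y cell_subset[OF w] gasket_reflection_mem[OF assms] by blast
      ultimately show "x \<in> gasket_reflection i -` (word_map w ` gasket) \<inter> gasket"
        using gasket_reflection_involution[OF assms, of y] by (simp only: vimage_eq Int_iff)
    qed
    then show ?thesis
      using emeasure_cell[OF swap_index_words[OF assms w]] cell_measurable[OF w]
      by (simp add: emeasure_distr measurable_reflection[OF assms] img)
  qed
  then show "gasket_measure (distr \<mu> \<mu> (gasket_reflection i))"
    by (simp add: gasket_measure_def sets_mu)
qed

lemma integral_reflection:
  fixes f :: "complex \<Rightarrow> real"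
  assumes "i \<in> {1, 2, 3}" "f \<in> borel_measurable \<mu>"
  shows "(\<integral>x. f (gasket_reflection i x) \<partial>\<mu>) = (\<integral>x. f x \<partial>\<mu>)"
  using integral_distr[OF measurable_reflection[OF assms(1)] assms(2)]
  by (simp add: distr_reflection[OF assms(1)])

lemma integrable_reflection:
  fixes f :: "complex \<Rightarrow> real"
  assumes "i \<in> {1, 2, 3}" "integrable \<mu> f"
  shows "integrable \<mu> (\<lambda>x. f (gasket_reflection i x))"
  using integrable_distr[OF measurable_reflection[OF assms(1)]] assms(2)
  by (simp add: distr_reflection[OF assms(1)])

lemma AE_reflection:
  assumes "i \<in> {1, 2, 3}" "AE x in \<mu>. Q x"
  shows "AE x in \<mu>. Q (gasket_reflection i x)"
  by (rule AE_distrD[OF measurable_reflection[OF assms(1)], of Q])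
    (simp only: distr_reflection[OF assms(1)] assms(2))

end

section \<open>Square integrable functions\<close>

abbreviation norm2 :: "complex measure \<Rightarrow> (complex \<Rightarrow> real) \<Rightarrow> real" where
  "norm2 \<mu> f \<equiv> sqrt (\<integral>x. (f x)\<^sup>2 \<partial>\<mu>)"

lemma L2_measurable: "f \<in> L2 \<mu> \<Longrightarrow> f \<in> borel_measurable \<mu>"
  by (simp add: L2_def)

lemma L2_integrable_square: "f \<in> L2 \<mu> \<Longrightarrow> integrable \<mu> (\<lambda>x. (f x)\<^sup>2)"
  by (simp add: L2_def)

lemma L2_integrable_mult:
  assumes "f \<in> L2 \<mu>" "g \<in> L2 \<mu>"
  shows "integrable \<mu> (\<lambda>x. f x * g x)"
proof (rule Bochner_Integration.integrable_bound)
  show "integrable \<mu> (\<lambda>x. (f x)\<^sup>2 + (g x)\<^sup>2)"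
    using assms by (intro Bochner_Integration.integrable_add L2_integrable_square)
  show "(\<lambda>x. f x * g x) \<in> borel_measurable \<mu>"
    using assms by (intro borel_measurable_times L2_measurable)
  show "AE x in \<mu>. norm (f x * g x) \<le> norm ((f x)\<^sup>2 + (g x)\<^sup>2)"
  proof (rule AE_I2)
    fix x
    have "2 * \<bar>f x * g x\<bar> \<le> (f x)\<^sup>2 + (g x)\<^sup>2"
      using sum_squares_bound[of "\<bar>f x\<bar>" "\<bar>g x\<bar>"] by (simp add: abs_mult)
    then show "norm (f x * g x) \<le> norm ((f x)\<^sup>2 + (g x)\<^sup>2)"
      by simp
  qed
qed

lemma L2_lincomb:
  assumes "f \<in> L2 \<mu>" "g \<in> L2 \<mu>"
  shows "(\<lambda>x. a * f x + b * g x) \<in> L2 \<mu>"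
proof -
  have "integrable \<mu> (\<lambda>x. a\<^sup>2 * (f x)\<^sup>2 + b\<^sup>2 * (g x)\<^sup>2 + 2 * a * b * (f x * g x))"
    using assms by (intro Bochner_Integration.integrable_add integrable_mult_right
      L2_integrable_square L2_integrable_mult)
  then have "integrable \<mu> (\<lambda>x. (a * f x + b * g x)\<^sup>2)"
    by (simp add: power2_eq_square algebra_simps)
  moreover have "(\<lambda>x. a * f x + b * g x) \<in> borel_measurable \<mu>"
    using assms[THEN L2_measurable] by measurable
  ultimately show ?thesis
    by (simp add: L2_def)
qed

lemma L2_diff: "f \<in> L2 \<mu> \<Longrightarrow> g \<in> L2 \<mu> \<Longrightarrow> (\<lambda>x. f x - g x) \<in> L2 \<mu>"
  using L2_lincomb[of f \<mu> g 1 "-1"] by simp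

lemma L2_scale: "f \<in> L2 \<mu> \<Longrightarrow> (\<lambda>x. c * f x) \<in> L2 \<mu>"
  using L2_lincomb[of f \<mu> f c 0] by simp

lemma Cauchy_Schwarz_L2:
  assumes "f \<in> L2 \<mu>" "g \<in> L2 \<mu>"
  shows "\<bar>\<integral>x. f x * g x \<partial>\<mu>\<bar> \<le> norm2 \<mu> f * norm2 \<mu> g"
proof -
  define A B C where "A = (\<integral>x. (f x)\<^sup>2 \<partial>\<mu>)" and "B = (\<integral>x. f x * g x \<partial>\<mu>)"
    and "C = (\<integral>x. (g x)\<^sup>2 \<partial>\<mu>)"
  have quad: "0 \<le> A - 2 * s * B + s\<^sup>2 * C" for s
  proof -
    have "0 \<le> (\<integral>x. (f x - s * g x)\<^sup>2 \<partial>\<mu>)"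
      by simp
    also have "(\<lambda>x. (f x - s * g x)\<^sup>2) = (\<lambda>x. (f x)\<^sup>2 - 2 * s * (f x * g x) + s\<^sup>2 * (g x)\<^sup>2)"
      by (auto simp: power2_eq_square algebra_simps)
    also have "(\<integral>x. (f x)\<^sup>2 - 2 * s * (f x * g x) + s\<^sup>2 * (g x)\<^sup>2 \<partial>\<mu>) = A - 2 * s * B + s\<^sup>2 * C"
      using L2_integrable_square[OF assms(1)] L2_integrable_square[OF assms(2)]
        L2_integrable_mult[OF assms] by (simp add: A_def B_def C_def)
    finally show ?thesis .
  qed
  have C: "0 \<le> C" by (simp add: C_def)
  have "B\<^sup>2 \<le> A * C"
  proof (cases "C = 0")
    case True
    have "B = 0"
    proof (rule ccontr)
      assume "B \<noteq> 0"
      then show False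
        using quad[of "(A + 1) / (2 * B)"] True by (simp add: field_simps)
    qed
    then show ?thesis using True by simp
  next
    case False
    then have "0 < C" using C by simp
    then show ?thesis
      using quad[of "B / C"] by (simp add: field_simps power2_eq_square)
  qed
  then have "\<bar>B\<bar> \<le> sqrt (A * C)"
    using real_sqrt_le_mono[of "B\<^sup>2" "A * C"] by (simp only: real_sqrt_abs)
  then show ?thesis
    by (simp add: real_sqrt_mult A_def B_def C_def)
qed

lemma (in gasket_measure_space) continuous_L2:
  assumes "continuous_on gasket f"
  shows "f \<in> L2 \<mu>"
proof -
  obtain B where B: "0 \<le> B" "\<And>x. x \<in> gasket \<Longrightarrow> \<bar>f x\<bar> \<le> B"
    using continuous_bounded[OF assms] by blast
  have "AE x in \<mu>. norm ((f x)\<^sup>2) \<le> B\<^sup>2"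
  proof (rule AE_I2)
    fix x assume "x \<in> space \<mu>"
    then have "\<bar>f x\<bar> \<le> \<bar>B\<bar>"
      using B(1) B(2)[of x] by simp
    then show "norm ((f x)\<^sup>2) \<le> B\<^sup>2"
      by (simp add: abs_le_square_iff)
  qed
  then show ?thesis
    using continuous_measurable[OF assms] by (auto simp: L2_def intro!: integrable_const_bound)
qed

lemma (in gasket_measure_space) L2_integrable:
  assumes "f \<in> L2 \<mu>"
  shows "integrable \<mu> f"
  using L2_integrable_mult[OF assms continuous_L2[of "\<lambda>_. 1"]] by simp

section \<open>Uniqueness of the semigroup\<close>

text \<open>Telescoping over \<open>n\<close> steps of length \<open>t / n\<close> bounds the total increment by \<open>t * \<epsilon> (t / n)\<close>. The
  hypothesis says that the derivative vanishes uniformly, in a form that can be checked without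
  differentiating curves in \<open>L2\<close>.\<close>

lemma constant_of_uniform_little_o:
  fixes \<phi> \<epsilon> :: "real \<Rightarrow> real"
  assumes step: "\<And>s d. 0 \<le> s \<Longrightarrow> 0 < d \<Longrightarrow> s + d \<le> t \<Longrightarrow> \<bar>\<phi> (s + d) - \<phi> s\<bar> \<le> d * \<epsilon> d"
    and lim: "(\<epsilon> \<longlongrightarrow> 0) (at_right 0)" and t: "0 \<le> t"
  shows "\<phi> t = \<phi> 0"
proof (cases "t = 0")
  case False
  then have t: "0 < t" using t by simp
  have bound: "\<bar>\<phi> t - \<phi> 0\<bar> \<le> t * \<epsilon> (t / real (Suc n))" for n
  proof -
    define d where "d = t / real (Suc n)"
    have d: "0 < d" "real (Suc n) * d = t"
      using t by (simp_all add: d_def)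
    have "\<bar>\<phi> (real k * d) - \<phi> 0\<bar> \<le> real k * (d * \<epsilon> d)" if "k \<le> Suc n" for k
      using that
    proof (induction k)
      case (Suc k)
      have "real (Suc k) * d \<le> real (Suc n) * d"
        using Suc.prems d by (intro mult_right_mono) auto
      then have "real k * d + d \<le> t"
        using d(2) by (simp add: distrib_right add.commute)
      then have "\<bar>\<phi> (real k * d + d) - \<phi> (real k * d)\<bar> \<le> d * \<epsilon> d"
        using d by (intro step) auto
      moreover have "real k * d + d = real (Suc k) * d"
        by (simp add: distrib_right)
      ultimately have "\<bar>\<phi> (real (Suc k) * d) - \<phi> 0\<bar> \<le> real k * (d * \<epsilon> d) + d * \<epsilon> d"
        using Suc.IH Suc.prems by simp
      also have "\<dots> = real (Suc k) * (d * \<epsilon> d)"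
        by (simp add: distrib_right)
      finally show ?case .
    qed simp
    from this[OF order_refl] have "\<bar>\<phi> t - \<phi> 0\<bar> \<le> real (Suc n) * (d * \<epsilon> d)"
      by (simp only: d(2))
    also have "\<dots> = (real (Suc n) * d) * \<epsilon> d"
      by (simp only: mult.assoc)
    also have "\<dots> = t * \<epsilon> (t / real (Suc n))"
      by (simp only: d(2)) (simp only: d_def)
    finally show ?thesis .
  qed
  have "filterlim (\<lambda>n. t / real (Suc n)) (at_right 0) sequentially"
  proof (rule tendsto_imp_filterlim_at_right)
    show "(\<lambda>n. t / real (Suc n)) \<longlonglongrightarrow> 0"
      using LIMSEQ_Suc[OF lim_const_over_n[of t]] by simp
  qed (use t in simp)
  then have "(\<lambda>n. t * \<epsilon> (t / real (Suc n))) \<longlonglongrightarrow> t * 0"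
    by (intro tendsto_mult tendsto_const filterlim_compose[OF lim])
  then have "\<bar>\<phi> t - \<phi> 0\<bar> \<le> t * 0"
    by (rule LIMSEQ_le_const) (use bound in auto)
  then show ?thesis by simp
qed simp

lemma energy_commute: "energy f g = energy g f"
  by (simp add: energy_def energy_level_def mult.commute)

lemma energy_domain_continuous: "u \<in> energy_domain \<Longrightarrow> continuous_on gasket u"
  by (simp add: energy_domain_def)

context gasket_measure_space
begin

text \<open>Both sides are \<open>- energy u v\<close> for the representatives \<open>u\<close> of \<open>f\<close> and \<open>v\<close> of \<open>g\<close>, and the energy is
  a symmetric form.\<close>

lemma laplacian_symmetric:
  assumes "is_laplacian \<mu> f h" "is_laplacian \<mu> g k"
  shows "(\<integral>x. h x * g x \<partial>\<mu>) = (\<integral>x. f x * k x \<partial>\<mu>)"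
proof -
  obtain u where u: "u \<in> energy_domain" "AE x in \<mu>. f x = u x"
    "\<And>g. g \<in> energy_domain \<Longrightarrow> energy u g = - (\<integral>x. h x * g x \<partial>\<mu>)"
    using assms(1) by (auto simp: is_laplacian_def)
  obtain v where v: "v \<in> energy_domain" "AE x in \<mu>. g x = v x"
    "\<And>g. g \<in> energy_domain \<Longrightarrow> energy v g = - (\<integral>x. k x * g x \<partial>\<mu>)"
    using assms(2) by (auto simp: is_laplacian_def)
  have [measurable]: "f \<in> borel_measurable \<mu>" "h \<in> borel_measurable \<mu>" "g \<in> borel_measurable \<mu>"
    "k \<in> borel_measurable \<mu>" "u \<in> borel_measurable \<mu>" "v \<in> borel_measurable \<mu>"
    using assms u(1) v(1) by (auto simp: is_laplacian_def L2_def
      intro: continuous_measurable energy_domain_continuous)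
  have "(\<integral>x. h x * g x \<partial>\<mu>) = (\<integral>x. h x * v x \<partial>\<mu>)"
    by (rule integral_cong_AE) (use v(2) in auto)
  also have "\<dots> = (\<integral>x. k x * u x \<partial>\<mu>)"
    using u(3)[OF v(1)] v(3)[OF u(1)] energy_commute[of u v] by simp
  also have "\<dots> = (\<integral>x. f x * k x \<partial>\<mu>)"
    by (rule integral_cong_AE) (use u(2) in auto)
  finally show ?thesis .
qed

end

locale gasket_semigroup = gasket_measure_space +
  fixes P :: "real \<Rightarrow> (complex \<Rightarrow> real) \<Rightarrow> (complex \<Rightarrow> real)"
  assumes heat_semigroup: "heat_semigroup \<mu> P"
begin

lemma P_L2: "0 \<le> t \<Longrightarrow> f \<in> L2 \<mu> \<Longrightarrow> P t f \<in> L2 \<mu>"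
  and P_linear: "0 \<le> t \<Longrightarrow> f \<in> L2 \<mu> \<Longrightarrow> g \<in> L2 \<mu> \<Longrightarrow>
    AE x in \<mu>. P t (\<lambda>z. a * f z + b * g z) x = a * P t f x + b * P t g x"
  and P_contraction: "0 \<le> t \<Longrightarrow> f \<in> L2 \<mu> \<Longrightarrow> (\<integral>x. (P t f x)\<^sup>2 \<partial>\<mu>) \<le> (\<integral>x. (f x)\<^sup>2 \<partial>\<mu>)"
  and P_symmetric: "0 \<le> t \<Longrightarrow> f \<in> L2 \<mu> \<Longrightarrow> g \<in> L2 \<mu> \<Longrightarrow>
    (\<integral>x. P t f x * g x \<partial>\<mu>) = (\<integral>x. f x * P t g x \<partial>\<mu>)"
  and P_zero: "f \<in> L2 \<mu> \<Longrightarrow> AE x in \<mu>. P 0 f x = f x"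
  and P_add: "0 \<le> s \<Longrightarrow> 0 \<le> t \<Longrightarrow> f \<in> L2 \<mu> \<Longrightarrow> AE x in \<mu>. P (s + t) f x = P s (P t f) x"
  and P_continuous: "f \<in> L2 \<mu> \<Longrightarrow>
    ((\<lambda>t. \<integral>x. (P t f x - f x)\<^sup>2 \<partial>\<mu>) \<longlongrightarrow> 0) (at_right 0)"
  and P_generator: "f \<in> L2 \<mu> \<Longrightarrow> h \<in> L2 \<mu> \<Longrightarrow>
    ((\<lambda>t. \<integral>x. ((P t f x - f x) / t - h x)\<^sup>2 \<partial>\<mu>) \<longlongrightarrow> 0) (at_right 0) \<longleftrightarrow> is_laplacian \<mu> f h"
  using heat_semigroup unfolding heat_semigroup_def by simp_all

lemma P_measurable: "0 \<le> t \<Longrightarrow> f \<in> L2 \<mu> \<Longrightarrow> P t f \<in> borel_measurable \<mu>"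
  by (intro L2_measurable P_L2)

lemma P_linear3:
  assumes "0 \<le> t" "f \<in> L2 \<mu>" "g \<in> L2 \<mu>" "h \<in> L2 \<mu>"
  shows "AE x in \<mu>. P t (\<lambda>z. a * f z + (b * g z + c * h z)) x = a * P t f x + (b * P t g x + c * P t h x)"
  using P_linear[OF assms(1,2) L2_lincomb[OF assms(3,4)], of a 1 b c] P_linear[OF assms(1,3,4), of b c]
  by eventually_elim simp

lemma quotient_L2:
  assumes "0 \<le> t" "f \<in> L2 \<mu>" "h \<in> L2 \<mu>"
  shows "(\<lambda>x. (P t f x - f x) / t - h x) \<in> L2 \<mu>"
  using L2_diff[OF L2_scale[OF L2_diff[OF P_L2[OF assms(1,2)] assms(2)], of "1 / t"] assms(3)] by simp

text \<open>The operator \<open>P s\<close> commutes with difference quotients of the semigroup and contracts norms, so it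
  carries the convergence of the quotients at \<open>f\<close> over to \<open>P s f\<close>.\<close>

lemma laplacian_semigroup:
  assumes "is_laplacian \<mu> f h" "0 \<le> s"
  shows "is_laplacian \<mu> (P s f) (P s h)"
proof -
  have L2: "f \<in> L2 \<mu>" "h \<in> L2 \<mu>"
    using assms(1) by (auto simp: is_laplacian_def)
  have lim: "((\<lambda>t. \<integral>x. ((P t f x - f x) / t - h x)\<^sup>2 \<partial>\<mu>) \<longlongrightarrow> 0) (at_right 0)"
    using P_generator[OF L2] assms(1) by simp
  have "(\<integral>x. ((P t (P s f) x - P s f x) / t - P s h x)\<^sup>2 \<partial>\<mu>)
      \<le> (\<integral>x. ((P t f x - f x) / t - h x)\<^sup>2 \<partial>\<mu>)" if t: "0 < t" for t
  proof -
    define r where "r x = 1 / t * P t f x + (- 1 / t * f x + - 1 * h x)" for x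
    have r: "r = (\<lambda>x. (P t f x - f x) / t - h x)"
      by (auto simp: r_def diff_divide_distrib)
    have rL2: "r \<in> L2 \<mu>"
      unfolding r using t L2 by (intro quotient_L2) auto
    have Pt: "P t f \<in> L2 \<mu>"
      using t L2 by (intro P_L2) auto
    have "AE x in \<mu>. P s r x = 1 / t * P s (P t f) x + (- 1 / t * P s f x + - 1 * P s h x)"
      unfolding r_def by (rule P_linear3[OF assms(2) Pt L2])
    moreover have "AE x in \<mu>. P (s + t) f x = P s (P t f) x"
      "AE x in \<mu>. P (t + s) f x = P t (P s f) x"
      using t assms(2) L2 by (auto intro!: P_add)
    ultimately have "AE x in \<mu>. ((P t (P s f) x - P s f x) / t - P s h x)\<^sup>2 = (P s r x)\<^sup>2"
    proof eventually_elim
      case (elim x)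
      then have "P t (P s f) x = P s (P t f) x"
        by (simp add: add.commute)
      then have "(P t (P s f) x - P s f x) / t - P s h x = P s r x"
        using elim(1) by (simp add: diff_divide_distrib)
      then show ?case
        by (simp only:)
    qed
    then have "(\<integral>x. ((P t (P s f) x - P s f x) / t - P s h x)\<^sup>2 \<partial>\<mu>) = (\<integral>x. (P s r x)\<^sup>2 \<partial>\<mu>)"
      using t assms(2) L2 rL2
      by (intro integral_cong_AE borel_measurable_power L2_measurable quotient_L2 P_L2) auto
    also have "\<dots> \<le> (\<integral>x. (r x)\<^sup>2 \<partial>\<mu>)"
      by (rule P_contraction[OF assms(2) rL2])
    finally show ?thesis
      by (simp add: r)
  qed
  then have "\<forall>\<^sub>F t in at_right 0. (\<integral>x. ((P t (P s f) x - P s f x) / t - P s h x)\<^sup>2 \<partial>\<mu>)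
      \<le> (\<integral>x. ((P t f x - f x) / t - h x)\<^sup>2 \<partial>\<mu>)"
    by (intro eventually_at_right_less[THEN eventually_mono]) auto
  then have "((\<lambda>t. \<integral>x. ((P t (P s f) x - P s f x) / t - P s h x)\<^sup>2 \<partial>\<mu>) \<longlongrightarrow> 0) (at_right 0)"
    by (intro tendsto_sandwich[OF _ _ tendsto_const lim]) auto
  then show ?thesis
    using P_generator[OF P_L2[OF assms(2) L2(1)] P_L2[OF assms(2) L2(2)]] by simp
qed

end

text \<open>The function \<open>\<phi> s = \<integral> Q s f * P (t - s) g\<close> interpolates between the two sides. A time step \<open>d\<close>
  moved from \<open>P\<close> to \<open>Q\<close> changes it, to first order in \<open>d\<close>, by \<open>d\<close> times
  \<open>\<integral> Q s h * P r g - \<integral> Q s f * P r k\<close> with \<open>r = t - s - d\<close>, and this vanishes because the common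
  generator is symmetric. The error terms are governed by the remainders \<open>R d\<close> and \<open>S d\<close> of the
  difference quotients at \<open>f\<close> and \<open>g\<close> alone, because all operators are contractions; this is what
  makes the estimate uniform in \<open>s\<close>.\<close>

lemma semigroups_agree_weakly_on_domain:
  assumes "gasket_semigroup \<mu> P" "gasket_semigroup \<mu> Q"
    and f: "is_laplacian \<mu> f h" and g: "is_laplacian \<mu> g k" and t: "0 \<le> t"
  shows "(\<integral>x. Q t f x * g x \<partial>\<mu>) = (\<integral>x. f x * P t g x \<partial>\<mu>)"
proof -
  interpret P: gasket_semigroup \<mu> P by fact
  interpret Q: gasket_semigroup \<mu> Q by fact
  have L2: "f \<in> L2 \<mu>" "h \<in> L2 \<mu>" "g \<in> L2 \<mu>" "k \<in> L2 \<mu>"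
    using f g by (auto simp: is_laplacian_def)
  define \<phi> where "\<phi> s = (\<integral>x. Q s f x * P (t - s) g x \<partial>\<mu>)" for s
  define R where "R d x = (Q d f x - f x) / d - h x" for d x
  define S where "S d x = (P d g x - g x) / d - k x" for d x
  have step: "\<bar>\<phi> (s + d) - \<phi> s\<bar> \<le> d * (norm2 \<mu> (R d) * norm2 \<mu> g + norm2 \<mu> f * norm2 \<mu> (S d))"
    if s: "0 \<le> s" "0 < d" "s + d \<le> t" for s d
  proof -
    define r where "r = t - s - d"
    have r: "0 \<le> r" "t - (s + d) = r" "t - s = r + d"
      using s by (simp_all add: r_def)
    have RS: "R d \<in> L2 \<mu>" "S d \<in> L2 \<mu>"
      unfolding R_def S_def using s L2 by (auto intro!: Q.quotient_L2 P.quotient_L2)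
    note mem = Q.P_L2[OF s(1) L2(1)] Q.P_L2[OF s(1) L2(2)] Q.P_L2[OF s(1) RS(1)]
      P.P_L2[OF r(1) L2(3)] P.P_L2[OF r(1) L2(4)] P.P_L2[OF r(1) RS(2)]
    \<comment> \<open>expansion to first order in the time step, with the error absorbed into \<open>R\<close> and \<open>S\<close>\<close>
    have Qd: "Q d f = (\<lambda>x. 1 * f x + (d * h x + d * R d x))"
      and Pd: "P d g = (\<lambda>x. 1 * g x + (d * k x + d * S d x))"
      using s by (auto simp: R_def S_def field_simps)
    have QAE: "AE x in \<mu>. Q (s + d) f x = 1 * Q s f x + (d * Q s h x + d * Q s (R d) x)"
      using Q.P_add[OF s(1) less_imp_le[OF s(2)] L2(1)] Q.P_linear3[OF s(1) L2(1,2) RS(1), of 1 d d]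
      unfolding Qd[symmetric] by eventually_elim simp
    have PAE: "AE x in \<mu>. P (r + d) g x = 1 * P r g x + (d * P r k x + d * P r (S d) x)"
      using P.P_add[OF r(1) less_imp_le[OF s(2)] L2(3)] P.P_linear3[OF r(1) L2(3,4) RS(2), of 1 d d]
      unfolding Pd[symmetric] by eventually_elim simp
    have Qmeas: "Q (s + d) f \<in> borel_measurable \<mu>" and Pmeas: "P (r + d) g \<in> borel_measurable \<mu>"
      using s r L2 by (auto intro!: Q.P_measurable P.P_measurable)
    note meas [measurable] = mem[THEN L2_measurable] Qmeas Pmeas
    have "\<phi> (s + d) = (\<integral>x. Q s f x * P r g x + (d * (Q s h x * P r g x) + d * (Q s (R d) x * P r g x)) \<partial>\<mu>)"
      unfolding \<phi>_def r(2) by (rule integral_cong_AE; (measurable)?)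
        (use QAE in \<open>eventually_elim, simp add: algebra_simps\<close>)
    also have "\<dots> = (\<integral>x. Q s f x * P r g x \<partial>\<mu>)
        + (d * (\<integral>x. Q s h x * P r g x \<partial>\<mu>) + d * (\<integral>x. Q s (R d) x * P r g x \<partial>\<mu>))"
      using mem by (simp add: L2_integrable_mult)
    finally have 1: "\<phi> (s + d) = \<dots>" .
    have "\<phi> s = (\<integral>x. Q s f x * P r g x + (d * (Q s f x * P r k x) + d * (Q s f x * P r (S d) x)) \<partial>\<mu>)"
      unfolding \<phi>_def r(3) by (rule integral_cong_AE; (measurable)?)
        (use PAE in \<open>eventually_elim, simp add: algebra_simps\<close>)
    also have "\<dots> = (\<integral>x. Q s f x * P r g x \<partial>\<mu>)
        + (d * (\<integral>x. Q s f x * P r k x \<partial>\<mu>) + d * (\<integral>x. Q s f x * P r (S d) x \<partial>\<mu>))"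
      using mem by (simp add: L2_integrable_mult)
    finally have 2: "\<phi> s = \<dots>" .
    have "(\<integral>x. Q s h x * P r g x \<partial>\<mu>) = (\<integral>x. Q s f x * P r k x \<partial>\<mu>)"
      by (rule P.laplacian_symmetric[OF Q.laplacian_semigroup[OF f s(1)] P.laplacian_semigroup[OF g r(1)]])
    then have "\<phi> (s + d) - \<phi> s
        = d * ((\<integral>x. Q s (R d) x * P r g x \<partial>\<mu>) - (\<integral>x. Q s f x * P r (S d) x \<partial>\<mu>))"
      unfolding 1 2 by (simp add: algebra_simps)
    then have "\<bar>\<phi> (s + d) - \<phi> s\<bar>
        = d * \<bar>(\<integral>x. Q s (R d) x * P r g x \<partial>\<mu>) - (\<integral>x. Q s f x * P r (S d) x \<partial>\<mu>)\<bar>"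
      using s(2) by (simp add: abs_mult)
    also have "\<dots> \<le> d * (norm2 \<mu> (R d) * norm2 \<mu> g + norm2 \<mu> f * norm2 \<mu> (S d))"
    proof (intro mult_left_mono)
      have "\<bar>\<integral>x. Q s (R d) x * P r g x \<partial>\<mu>\<bar> \<le> norm2 \<mu> (Q s (R d)) * norm2 \<mu> (P r g)"
        by (rule Cauchy_Schwarz_L2[OF mem(3,4)])
      also have "\<dots> \<le> norm2 \<mu> (R d) * norm2 \<mu> g"
        by (intro mult_mono real_sqrt_le_mono Q.P_contraction P.P_contraction s r RS L2) auto
      finally have a: "\<bar>\<integral>x. Q s (R d) x * P r g x \<partial>\<mu>\<bar> \<le> norm2 \<mu> (R d) * norm2 \<mu> g" .
      have "\<bar>\<integral>x. Q s f x * P r (S d) x \<partial>\<mu>\<bar> \<le> norm2 \<mu> (Q s f) * norm2 \<mu> (P r (S d))"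
        by (rule Cauchy_Schwarz_L2[OF mem(1,6)])
      also have "\<dots> \<le> norm2 \<mu> f * norm2 \<mu> (S d)"
        by (intro mult_mono real_sqrt_le_mono Q.P_contraction P.P_contraction s r RS L2) auto
      finally show "\<bar>(\<integral>x. Q s (R d) x * P r g x \<partial>\<mu>) - (\<integral>x. Q s f x * P r (S d) x \<partial>\<mu>)\<bar>
          \<le> norm2 \<mu> (R d) * norm2 \<mu> g + norm2 \<mu> f * norm2 \<mu> (S d)"
        using a by linarith
    qed (use s in simp)
    finally show ?thesis .
  qed
  have R: "((\<lambda>d. norm2 \<mu> (R d)) \<longlongrightarrow> sqrt 0) (at_right 0)"
    unfolding R_def by (rule tendsto_real_sqrt, rule iffD2[OF Q.P_generator[OF L2(1,2)] f])
  have S: "((\<lambda>d. norm2 \<mu> (S d)) \<longlongrightarrow> sqrt 0) (at_right 0)"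
    unfolding S_def by (rule tendsto_real_sqrt, rule iffD2[OF P.P_generator[OF L2(3,4)] g])
  have lim: "((\<lambda>d. norm2 \<mu> (R d) * norm2 \<mu> g + norm2 \<mu> f * norm2 \<mu> (S d)) \<longlongrightarrow> 0) (at_right 0)"
    using tendsto_add[OF tendsto_mult[OF R tendsto_const] tendsto_mult[OF tendsto_const S],
      of "norm2 \<mu> g" "norm2 \<mu> f"] by (simp only: real_sqrt_zero mult_zero_left mult_zero_right add_0)
  have "\<phi> t = \<phi> 0"
    by (rule constant_of_uniform_little_o[OF step lim t])
  moreover have "\<phi> t = (\<integral>x. Q t f x * g x \<partial>\<mu>)"
    unfolding \<phi>_def using P.P_zero[OF L2(3)] t L2
    by (intro integral_cong_AE borel_measurable_times Q.P_measurable P.P_measurable L2_measurable) auto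
  moreover have "\<phi> 0 = (\<integral>x. f x * P t g x \<partial>\<mu>)"
    unfolding \<phi>_def using Q.P_zero[OF L2(1)] t L2
    by (intro integral_cong_AE borel_measurable_times Q.P_measurable P.P_measurable L2_measurable) auto
  ultimately show ?thesis
    by simp
qed

section \<open>Density of the domain of the Laplacian\<close>

locale gasket_kernel = gasket_semigroup +
  fixes p :: "real \<Rightarrow> complex \<Rightarrow> complex \<Rightarrow> real"
  assumes heat_kernel: "heat_kernel \<mu> P p"
begin

text \<open>The kernel singles out a version of \<open>P t f\<close> that is defined at every point and jointly continuous
  in time and space.\<close>

definition heat_flow :: "(complex \<Rightarrow> real) \<Rightarrow> real \<Rightarrow> complex \<Rightarrow> real" where
  "heat_flow f t x = (\<integral>y. p t x y * f y \<partial>\<mu>)"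

lemma kernel_continuous: "continuous_on ({0<..} \<times> gasket \<times> gasket) (\<lambda>(t, x, y). p t x y)"
  using heat_kernel by (simp add: heat_kernel_def)

lemma P_eq_heat_flow: "0 < t \<Longrightarrow> f \<in> L2 \<mu> \<Longrightarrow> AE x in \<mu>. P t f x = heat_flow f t x"
  using heat_kernel by (simp add: heat_kernel_def heat_flow_def)

lemma kernel_continuous_compose:
  assumes "continuous_on A f" "continuous_on A g" "continuous_on A h"
    and "\<And>z. z \<in> A \<Longrightarrow> 0 < f z" "\<And>z. z \<in> A \<Longrightarrow> g z \<in> gasket" "\<And>z. z \<in> A \<Longrightarrow> h z \<in> gasket"
  shows "continuous_on A (\<lambda>z. p (f z) (g z) (h z))"
proof -
  have "continuous_on A (\<lambda>z. case (f z, g z, h z) of (t, x, y) \<Rightarrow> p t x y)"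
    by (rule continuous_on_compose2[OF kernel_continuous]) (use assms in \<open>auto intro!: continuous_on_Pair\<close>)
  then show ?thesis
    by simp
qed

lemma kernel_continuous_right:
  assumes "0 < t" "x \<in> gasket"
  shows "continuous_on gasket (p t x)"
  using assms by (intro kernel_continuous_compose continuous_on_const continuous_on_id)

lemma kernel_L2: "0 < t \<Longrightarrow> x \<in> gasket \<Longrightarrow> p t x \<in> L2 \<mu>"
  by (intro continuous_L2 kernel_continuous_right)

text \<open>Along a sequence converging to a point with positive time, the sequence and its limit form a
  compact set, on which the kernel is bounded; dominated convergence applies.\<close>

lemma heat_flow_continuous:
  assumes "f \<in> L2 \<mu>"
  shows "continuous_on ({0<..} \<times> gasket) (\<lambda>(t, x). heat_flow f t x)"
  unfolding continuous_on_sequentially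
proof (intro allI ballI impI)
  fix X :: "nat \<Rightarrow> real \<times> complex" and a
  assume a: "a \<in> {0<..} \<times> gasket" and X: "(\<forall>n. X n \<in> {0<..} \<times> gasket) \<and> X \<longlonglongrightarrow> a"
  define C where "C = insert a (range X)"
  let ?p = "\<lambda>(c :: real \<times> complex, y). p (fst c) (snd c) y"
  have cont: "continuous_on (({0<..} \<times> gasket) \<times> gasket) ?p"
    unfolding case_prod_unfold
    by (intro kernel_continuous_compose continuous_intros) auto
  have "compact (C \<times> gasket)"
    using X unfolding C_def by (intro compact_Times compact_sequence_with_limit compact_gasket) auto
  moreover have "C \<times> gasket \<subseteq> ({0<..} \<times> gasket) \<times> gasket"
  proof -
    have "range X \<subseteq> {0<..} \<times> gasket"
      using X by blast
    then have "C \<subseteq> {0<..} \<times> gasket"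
      using a by (simp add: C_def)
    then show ?thesis
      by blast
  qed
  ultimately have "bounded (?p ` (C \<times> gasket))"
    by (intro compact_imp_bounded compact_continuous_image continuous_on_subset[OF cont])
  then obtain B where B: "\<And>z. z \<in> ?p ` (C \<times> gasket) \<Longrightarrow> norm z \<le> B"
    unfolding bounded_iff by blast
  have bound: "\<bar>p (fst c) (snd c) y\<bar> \<le> B" if "c \<in> C" "y \<in> gasket" for c y
  proof -
    have "?p (c, y) \<in> ?p ` (C \<times> gasket)"
      using that by (intro imageI SigmaI)
    from B[OF this] show ?thesis
      by simp
  qed
  have [measurable]: "f \<in> borel_measurable \<mu>"
    using assms by (rule L2_measurable)
  have meas: "(\<lambda>y. p (fst c) (snd c) y * f y) \<in> borel_measurable \<mu>" if "c \<in> {0<..} \<times> gasket" for c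
    using that continuous_measurable[OF kernel_continuous_right[of "fst c" "snd c"]] by auto
  have "(\<lambda>n. \<integral>y. p (fst (X n)) (snd (X n)) y * f y \<partial>\<mu>) \<longlonglongrightarrow> (\<integral>y. p (fst a) (snd a) y * f y \<partial>\<mu>)"
  proof (rule integral_dominated_convergence)
    show "integrable \<mu> (\<lambda>y. B * \<bar>f y\<bar>)"
      using L2_integrable[OF assms] by simp
    show "AE y in \<mu>. (\<lambda>n. p (fst (X n)) (snd (X n)) y * f y) \<longlonglongrightarrow> p (fst a) (snd a) y * f y"
    proof (rule AE_I2)
      fix y assume "y \<in> space \<mu>"
      then have y: "y \<in> gasket" by simp
      have "continuous_on ({0<..} \<times> gasket) (\<lambda>c. p (fst c) (snd c) y)"
        using y by (intro kernel_continuous_compose continuous_intros) auto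
      then have "(\<lambda>n. p (fst (X n)) (snd (X n)) y) \<longlonglongrightarrow> p (fst a) (snd a) y"
        by (rule continuous_on_tendsto_compose) (use a X in simp_all)
      then show "(\<lambda>n. p (fst (X n)) (snd (X n)) y * f y) \<longlonglongrightarrow> p (fst a) (snd a) y * f y"
        by (intro tendsto_mult tendsto_const)
    qed
    show "AE y in \<mu>. norm (p (fst (X n)) (snd (X n)) y * f y) \<le> B * \<bar>f y\<bar>" for n
    proof (rule AE_I2)
      fix y assume "y \<in> space \<mu>"
      then have "\<bar>p (fst (X n)) (snd (X n)) y\<bar> \<le> B"
        by (intro bound) (simp_all add: C_def)
      then show "norm (p (fst (X n)) (snd (X n)) y * f y) \<le> B * \<bar>f y\<bar>"
        by (simp add: abs_mult mult_right_mono)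
    qed
    show "(\<lambda>y. p (fst a) (snd a) y * f y) \<in> borel_measurable \<mu>"
      by (rule meas[OF a])
    show "(\<lambda>y. p (fst (X n)) (snd (X n)) y * f y) \<in> borel_measurable \<mu>" for n
      using X by (intro meas) blast
  qed
  then show "((\<lambda>(t, x). heat_flow f t x) \<circ> X) \<longlonglongrightarrow> (\<lambda>(t, x). heat_flow f t x) a"
    by (simp add: o_def heat_flow_def case_prod_unfold)
qed

lemma heat_flow_continuous_right:
  assumes "f \<in> L2 \<mu>" "0 < t"
  shows "continuous_on gasket (heat_flow f t)"
proof -
  have "continuous_on gasket (\<lambda>x. case (t, x) of (t, x) \<Rightarrow> heat_flow f t x)"
    by (rule continuous_on_compose2[OF heat_flow_continuous[OF assms(1)]])
      (use assms(2) in \<open>auto intro!: continuous_intros\<close>)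
  then show ?thesis
    by simp
qed

lemma heat_flow_continuous_left:
  assumes "f \<in> L2 \<mu>" "x \<in> gasket"
  shows "continuous_on {0<..} (\<lambda>t. heat_flow f t x)"
proof -
  have "continuous_on {0<..} (\<lambda>t. case (t, x) of (t, x) \<Rightarrow> heat_flow f t x)"
    by (rule continuous_on_compose2[OF heat_flow_continuous[OF assms(1)]])
      (use assms(2) in \<open>auto intro!: continuous_intros\<close>)
  then show ?thesis
    by simp
qed

lemma heat_flow_L2: "f \<in> L2 \<mu> \<Longrightarrow> 0 < t \<Longrightarrow> heat_flow f t \<in> L2 \<mu>"
  by (rule continuous_L2[OF heat_flow_continuous_right])

lemma heat_flow_cong_AE:
  assumes "f \<in> L2 \<mu>" "g \<in> L2 \<mu>" "AE x in \<mu>. f x = g x" "0 < t" "x \<in> gasket"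
  shows "heat_flow f t x = heat_flow g t x"
  unfolding heat_flow_def
  using assms(3) L2_measurable[OF assms(1)] L2_measurable[OF assms(2)]
    L2_measurable[OF kernel_L2[OF assms(4,5)]]
  by (intro integral_cong_AE) auto

text \<open>The semigroup law holds at every point and not only almost everywhere: both sides are continuous
  in \<open>x\<close> and \<open>\<mu>\<close> charges every ball.\<close>

lemma heat_flow_add:
  assumes "f \<in> L2 \<mu>" "0 < s" "0 < t" "x \<in> gasket"
  shows "heat_flow (heat_flow f s) t x = heat_flow f (s + t) x"
proof -
  have Ps: "P s f \<in> L2 \<mu>"
    using assms by (intro P_L2) auto
  have "AE x in \<mu>. heat_flow (P s f) t x - heat_flow f (s + t) x = 0"
    using P_add[of t s f] P_eq_heat_flow[of "s + t" f] P_eq_heat_flow[of t "P s f"] assms Ps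
    by (auto simp: add.commute)
  then have "heat_flow (P s f) t x - heat_flow f (s + t) x = 0"
    using assms Ps by (intro continuous_AE_zero[of "\<lambda>x. heat_flow (P s f) t x - heat_flow f (s + t) x"]
      continuous_on_diff heat_flow_continuous_right) auto
  moreover have "heat_flow (P s f) t x = heat_flow (heat_flow f s) t x"
    using assms Ps by (intro heat_flow_cong_AE P_eq_heat_flow heat_flow_L2) auto
  ultimately show ?thesis
    by simp
qed

text \<open>This makes Fubini's theorem available for continuous functions of time and space.\<close>

lemma integrable_box:
  fixes G :: "real \<times> complex \<Rightarrow> real"
  assumes "continuous_on ({a..b} \<times> gasket) G"
  shows "integrable (lborel \<Otimes>\<^sub>M \<mu>) (\<lambda>(s, y). indicator {a..b} s * G (s, y))"
proof -
  let ?A = "{a..b} \<times> gasket"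
  have A: "?A \<in> sets borel"
    by (intro borel_compact compact_Times compact_gasket) auto
  have "(\<lambda>z. indicator ?A z *\<^sub>R G z) \<in> borel_measurable borel"
    by (rule borel_measurable_continuous_on_indicator[OF A assms])
  moreover have "(\<lambda>z. z) \<in> measurable (lborel \<Otimes>\<^sub>M \<mu>) (borel :: (real \<times> complex) measure)"
  proof -
    have "(\<lambda>y. y) \<in> measurable \<mu> borel"
      unfolding measurable_cong_sets[OF sets_mu refl] by (intro measurable_restrict_space1) simp
    then have "(\<lambda>z. (fst z, snd z)) \<in> measurable (lborel \<Otimes>\<^sub>M \<mu>) ((borel :: real measure) \<Otimes>\<^sub>M (borel :: complex measure))"
      by measurable
    then show ?thesis
      by (simp add: borel_prod)
  qed
  ultimately have "(\<lambda>z. indicator ?A z *\<^sub>R G z) \<in> borel_measurable (lborel \<Otimes>\<^sub>M \<mu>)"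
    by (rule measurable_compose[rotated])
  then have "(\<lambda>(s, y). indicator {a..b} s * G (s, y)) \<in> borel_measurable (lborel \<Otimes>\<^sub>M \<mu>)"
    by (rule measurable_cong[THEN iffD1, rotated])
      (auto simp: space_pair_measure indicator_def split: if_splits)
  moreover have "?A \<in> sets (lborel \<Otimes>\<^sub>M \<mu>)"
    using sets.top[of \<mu>] by (intro pair_measureI) auto
  moreover have "emeasure (lborel \<Otimes>\<^sub>M \<mu>) ?A < \<infinity>"
    using sets.top[of \<mu>] by (subst emeasure_pair_measure_Times)
      (auto simp: emeasure_eq_measure ennreal_mult_less_top emeasure_lborel_Icc_eq)
  moreover have "bounded (G ` ?A)"
    by (intro compact_imp_bounded compact_continuous_image compact_Times compact_gasket assms) auto
  then obtain B where B: "\<And>z. z \<in> G ` ?A \<Longrightarrow> norm z \<le> B"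
    unfolding bounded_iff by blast
  have "AE z in lborel \<Otimes>\<^sub>M \<mu>. z \<in> ?A \<longrightarrow> norm (case z of (s, y) \<Rightarrow> indicator {a..b} s * G (s, y)) \<le> B"
    using B by (intro AE_I2) auto
  moreover have "AE z in lborel \<Otimes>\<^sub>M \<mu>. z \<notin> ?A \<longrightarrow> (case z of (s, y) \<Rightarrow> indicator {a..b} s * G (s, y)) = 0"
    by (intro AE_I2) (auto simp: space_pair_measure indicator_def split: if_splits)
  ultimately show ?thesis
    by (intro integrableI_bounded_set[where A = ?A and B = B])
qed

definition time_average :: "(complex \<Rightarrow> real) \<Rightarrow> real \<Rightarrow> real \<Rightarrow> complex \<Rightarrow> real" where
  "time_average f a b x = (\<integral>s. indicator {a..b} s * heat_flow f s x \<partial>lborel) / (b - a)"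

lemma integrable_interval:
  fixes u :: "real \<Rightarrow> real"
  assumes "continuous_on {0<..} u" "0 < a"
  shows "integrable lborel (\<lambda>s. indicator {a..b} s * u s)"
proof -
  have "set_integrable lborel {a..b} u"
    by (rule borel_integrable_atLeastAtMost') (rule continuous_on_subset[OF assms(1)], use assms(2) in auto)
  then show ?thesis
    by (simp add: set_integrable_def)
qed

lemma average_close:
  fixes u :: "real \<Rightarrow> real"
  assumes u: "continuous_on {0<..} u" and "0 < a" "a < b" "I \<in> sets borel" "I \<subseteq> {a..b}"
    and I: "measure lborel I = b - a"
    and close: "\<And>s. s \<in> {a..b} \<Longrightarrow> \<bar>u s - c\<bar> \<le> \<epsilon>"
  shows "\<bar>(\<integral>s. indicator I s * u s \<partial>lborel) / (b - a) - c\<bar> \<le> \<epsilon>"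
proof -
  have int_ab: "integrable lborel (\<lambda>s. indicator {a..b} s * u s)"
    by (rule integrable_interval[OF u assms(2)])
  have "integrable lborel (\<lambda>s. indicator I s *\<^sub>R (indicator {a..b} s * u s))"
    using assms(4) by (intro integrable_mult_indicator int_ab) simp
  moreover have "(\<lambda>s. indicator I s *\<^sub>R (indicator {a..b} s * u s)) = (\<lambda>s. indicator I s * u s)"
    by (rule ext) (use assms(5) in \<open>auto simp: indicator_def\<close>)
  ultimately have int: "integrable lborel (\<lambda>s. indicator I s * u s)"
    by simp
  have fin: "emeasure lborel I < \<infinity>"
  proof -
    have "emeasure lborel I \<le> emeasure lborel {a..b}"
      using assms by (intro emeasure_mono) auto
    also have "\<dots> < \<infinity>"
      by (simp add: emeasure_lborel_Icc_eq)
    finally show ?thesis .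
  qed
  have intI: "integrable lborel (\<lambda>s. indicator I s * k)" for k :: real
    using fin assms(4) by (intro integrable_mult_left integrable_real_indicator) auto
  have "(\<integral>s. indicator I s * u s \<partial>lborel) - c * (b - a) = (\<integral>s. indicator I s * u s - indicator I s * c \<partial>lborel)"
    using int intI I assms(4) by (simp add: mult.commute)
  also have "\<bar>\<dots>\<bar> \<le> (\<integral>s. \<bar>indicator I s * u s - indicator I s * c\<bar> \<partial>lborel)"
    by (rule integral_abs_bound)
  also have "\<dots> \<le> (\<integral>s. indicator I s * \<epsilon> \<partial>lborel)"
    using int intI close assms(5) by (intro integral_mono) (auto simp: indicator_def)
  also have "\<dots> = \<epsilon> * (b - a)"
    using I assms(4) by (simp add: mult.commute)
  finally have "\<bar>(\<integral>s. indicator I s * u s \<partial>lborel) - c * (b - a)\<bar> \<le> \<epsilon> * (b - a)" .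
  moreover have "(\<integral>s. indicator I s * u s \<partial>lborel) / (b - a) - c
      = ((\<integral>s. indicator I s * u s \<partial>lborel) - c * (b - a)) / (b - a)"
    using assms(3) by (simp add: diff_divide_distrib)
  ultimately show ?thesis
    using assms(3) by (simp add: abs_divide divide_le_eq)
qed

lemma time_average_measurable:
  assumes f: "f \<in> L2 \<mu>" and "0 < a"
  shows "time_average f a b \<in> borel_measurable \<mu>"
proof -
  interpret pair_sigma_finite lborel \<mu> ..
  have "continuous_on ({a..b} \<times> gasket) (\<lambda>(t, x). heat_flow f t x)"
    by (rule continuous_on_subset[OF heat_flow_continuous[OF f]]) (use assms in auto)
  from integrable_box[OF this]
  have "integrable (lborel \<Otimes>\<^sub>M \<mu>) (\<lambda>(s, y). indicator {a..b} s * heat_flow f s y)"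
    by (simp add: case_prod_unfold)
  then have "integrable \<mu> (\<lambda>y. \<integral>s. indicator {a..b} s * heat_flow f s y \<partial>lborel)"
    by (rule integrable_snd)
  then have "(\<lambda>y. (\<integral>s. indicator {a..b} s * heat_flow f s y \<partial>lborel) / (b - a)) \<in> borel_measurable \<mu>"
    by (intro borel_measurable_divide borel_measurable_integrable) auto
  then show ?thesis
    by (simp add: time_average_def[abs_def])
qed

lemma heat_flow_uniform:
  assumes f: "f \<in> L2 \<mu>" and a: "0 < a" and e: "0 < \<epsilon>"
  shows "\<exists>d>0. \<forall>s x. a \<le> s \<and> s \<le> a + d \<and> x \<in> gasket \<longrightarrow>
    \<bar>heat_flow f s x - heat_flow f a x\<bar> \<le> \<epsilon>"
proof -
  have "uniformly_continuous_on ({a..a + 1} \<times> gasket) (\<lambda>(t, x). heat_flow f t x)"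
    by (intro compact_uniformly_continuous compact_Times compact_gasket
      continuous_on_subset[OF heat_flow_continuous[OF f]]) (use a in auto)
  then obtain d where d: "0 < d" "\<And>z z'. z \<in> {a..a + 1} \<times> gasket \<Longrightarrow> z' \<in> {a..a + 1} \<times> gasket \<Longrightarrow>
    dist z' z < d \<Longrightarrow> dist (case z' of (t, x) \<Rightarrow> heat_flow f t x) (case z of (t, x) \<Rightarrow> heat_flow f t x) < \<epsilon>"
    using e unfolding uniformly_continuous_on_def by metis
  show ?thesis
  proof (intro exI[of _ "min (d / 2) 1"] conjI allI impI)
    fix s x assume s: "a \<le> s \<and> s \<le> a + min (d / 2) 1 \<and> x \<in> gasket"
    have "s \<le> a + d / 2" and s1: "s \<le> a + 1"
      using s min.cobounded1[of "d / 2" 1] min.cobounded2[of "d / 2" 1] by linarith+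
    then have "dist (s, x) (a, x) < d"
      using s d(1) by (simp add: dist_Pair_Pair dist_real_def)
    then have "dist (heat_flow f s x) (heat_flow f a x) < \<epsilon>"
      using d(2)[of "(a, x)" "(s, x)"] s s1 by simp
    then show "\<bar>heat_flow f s x - heat_flow f a x\<bar> \<le> \<epsilon>"
      by (simp add: dist_real_def)
  qed (use d in simp)
qed

lemma time_average_L2:
  assumes f: "f \<in> L2 \<mu>" and a: "0 < a" "a < b"
  shows "time_average f a b \<in> L2 \<mu>"
proof -
  have "continuous_on ({a..b} \<times> gasket) (\<lambda>(t, x). heat_flow f t x)"
    by (rule continuous_on_subset[OF heat_flow_continuous[OF f]]) (use assms in auto)
  then have "bounded ((\<lambda>(t, x). heat_flow f t x) ` ({a..b} \<times> gasket))"
    by (intro compact_imp_bounded compact_continuous_image compact_Times compact_gasket) auto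
  then obtain B where B: "\<And>z. z \<in> (\<lambda>(t, x). heat_flow f t x) ` ({a..b} \<times> gasket) \<Longrightarrow> norm z \<le> B"
    unfolding bounded_iff by blast
  have "\<bar>time_average f a b x - 0\<bar> \<le> B" if x: "x \<in> gasket" for x
    unfolding time_average_def
  proof (rule average_close)
    show "continuous_on {0<..} (\<lambda>s. heat_flow f s x)"
      by (rule heat_flow_continuous_left[OF f x])
    show "\<bar>heat_flow f s x - 0\<bar> \<le> B" if "s \<in> {a..b}" for s
    proof -
      have "heat_flow f s x \<in> (\<lambda>(t, x). heat_flow f t x) ` ({a..b} \<times> gasket)"
        using that x by (intro image_eqI[where x = "(s, x)"]) auto
      from B[OF this] show ?thesis
        by simp
    qed
  qed (use a in auto)
  then have "\<bar>time_average f a b x\<bar> \<le> \<bar>B\<bar>" if "x \<in> gasket" for x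
    using that by fastforce
  then have "AE x in \<mu>. norm ((time_average f a b x)\<^sup>2) \<le> B\<^sup>2"
    by (intro AE_I2) (simp add: abs_le_square_iff)
  then show ?thesis
    using time_average_measurable[OF f a(1)] by (auto simp: L2_def intro!: integrable_const_bound)
qed

text \<open>Applying \<open>P t\<close> shifts the window of the average from \<open>{a..b}\<close> to \<open>{a + t..b + t}\<close>.\<close>

lemma heat_flow_time_average:
  assumes f: "f \<in> L2 \<mu>" and a: "0 < a" "a < b" and t: "0 < t" and x: "x \<in> gasket"
  shows "heat_flow (time_average f a b) t x = (\<integral>s. indicator {a + t..b + t} s * heat_flow f s x \<partial>lborel) / (b - a)"
proof -
  interpret pair_sigma_finite lborel \<mu> ..
  have "continuous_on ({a..b} \<times> gasket) (\<lambda>z. p t x (snd z) * (case z of (s, y) \<Rightarrow> heat_flow f s y))"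
    by (intro continuous_on_mult continuous_on_compose2[OF kernel_continuous_right[OF t x]]
      continuous_on_snd continuous_on_id continuous_on_subset[OF heat_flow_continuous[OF f]])
      (use a in auto)
  from integrable_box[OF this]
  have int: "integrable (lborel \<Otimes>\<^sub>M \<mu>) (\<lambda>(s, y). indicator {a..b} s * (p t x y * heat_flow f s y))"
    by (simp add: case_prod_unfold)
  have "heat_flow (time_average f a b) t x
      = (\<integral>y. (\<integral>s. indicator {a..b} s * (p t x y * heat_flow f s y) \<partial>lborel) / (b - a) \<partial>\<mu>)"
    unfolding heat_flow_def[of "time_average f a b"] time_average_def
    by (intro Bochner_Integration.integral_cong refl) (simp add: mult.left_commute flip: integral_mult_right_zero)
  also have "\<dots> = (\<integral>y. (\<integral>s. indicator {a..b} s * (p t x y * heat_flow f s y) \<partial>lborel) \<partial>\<mu>) / (b - a)"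
    by simp
  also have "(\<integral>y. (\<integral>s. indicator {a..b} s * (p t x y * heat_flow f s y) \<partial>lborel) \<partial>\<mu>)
      = (\<integral>s. (\<integral>y. indicator {a..b} s * (p t x y * heat_flow f s y) \<partial>\<mu>) \<partial>lborel)"
    by (rule Fubini_integral[OF int])
  also have "\<dots> = (\<integral>s. indicator {a..b} s * heat_flow f (t + 1 * s) x \<partial>lborel)"
  proof (intro Bochner_Integration.integral_cong refl)
    fix s :: real
    show "(\<integral>y. indicator {a..b} s * (p t x y * heat_flow f s y) \<partial>\<mu>) = indicator {a..b} s * heat_flow f (t + 1 * s) x"
    proof (cases "s \<in> {a..b}")
      case True
      then have "heat_flow (heat_flow f s) t x = heat_flow f (s + t) x"
        using a by (intro heat_flow_add f t x) auto
      then show ?thesis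
        by (simp add: heat_flow_def[of "heat_flow f s"] add.commute)
    qed simp
  qed
  also have "\<dots> = (\<integral>s. (\<lambda>s. indicator {a + t..b + t} s * heat_flow f s x) (t + 1 * s) \<partial>lborel)"
    by (intro Bochner_Integration.integral_cong refl) (auto simp: indicator_def)
  also have "\<dots> = (\<integral>s. indicator {a + t..b + t} s * heat_flow f s x \<partial>lborel)"
    using lborel_integral_real_affine[of 1 "\<lambda>s. indicator {a + t..b + t} s * heat_flow f s x" t] by simp
  finally show ?thesis .
qed

text \<open>Subtracting the average over \<open>{a..b}\<close> from the one over \<open>{a + t..b + t}\<close> leaves the contributions of
  two windows of length \<open>t\<close> at the end points. Divided by \<open>t\<close> they converge, uniformly in space, to
  the values of the flow at times \<open>b\<close> and \<open>a\<close>.\<close>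

lemma time_average_domain:
  assumes f: "f \<in> L2 \<mu>" and a: "0 < a" "a < b"
  shows "is_laplacian \<mu> (time_average f a b) (\<lambda>x. (heat_flow f b x - heat_flow f a x) / (b - a))"
proof -
  let ?F = "time_average f a b" and ?h = "\<lambda>x. (heat_flow f b x - heat_flow f a x) / (b - a)"
  have F: "?F \<in> L2 \<mu>"
    by (rule time_average_L2[OF assms])
  have h: "?h \<in> L2 \<mu>"
    using L2_scale[OF L2_diff[OF heat_flow_L2[OF f, of b] heat_flow_L2[OF f, of a]], of "1 / (b - a)"] a
    by simp
  have "((\<lambda>t. \<integral>x. ((P t ?F x - ?F x) / t - ?h x)\<^sup>2 \<partial>\<mu>) \<longlongrightarrow> 0) (at_right 0)"
  proof (rule tendstoI)
    fix e :: real assume e: "0 < e"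
    \<comment> \<open>an error \<open>\<epsilon>\<close> at both ends of the window, divided by \<open>b - a\<close>, amounts to \<open>sqrt e / 2\<close>\<close>
    define \<epsilon> where "\<epsilon> = (b - a) * sqrt e / 4"
    have eps: "0 < \<epsilon>"
      using e a by (simp add: \<epsilon>_def)
    obtain d1 where d1: "0 < d1"
      "\<forall>s x. a \<le> s \<and> s \<le> a + d1 \<and> x \<in> gasket \<longrightarrow> \<bar>heat_flow f s x - heat_flow f a x\<bar> \<le> \<epsilon>"
      using heat_flow_uniform[OF f a(1) eps] by blast
    obtain d2 where d2: "0 < d2"
      "\<forall>s x. b \<le> s \<and> s \<le> b + d2 \<and> x \<in> gasket \<longrightarrow> \<bar>heat_flow f s x - heat_flow f b x\<bar> \<le> \<epsilon>"
      using heat_flow_uniform[OF f less_trans[OF a] eps] by blast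
    have "dist (\<integral>x. ((P t ?F x - ?F x) / t - ?h x)\<^sup>2 \<partial>\<mu>) 0 < e"
      if t: "0 < t" "t < Min {d1, d2, b - a}" for t
    proof -
      have pt: "((heat_flow ?F t x - ?F x) / t - ?h x)\<^sup>2 \<le> e / 4" if x: "x \<in> gasket" for x
      proof -
        define u where "u s = heat_flow f s x" for s
        have u: "continuous_on {0<..} u"
          unfolding u_def by (rule heat_flow_continuous_left[OF f x])
        have ints: "integrable lborel (\<lambda>s. indicator {r..r'} s * u s)" if "0 < r" for r r'
          by (rule integrable_interval[OF u that])
        define A B where "A = (\<integral>s. indicator {a..<a + t} s * u s \<partial>lborel)"
          and "B = (\<integral>s. indicator {b<..b + t} s * u s \<partial>lborel)"
        have "integrable lborel (\<lambda>s. indicator {a..<a + t} s *\<^sub>R (indicator {a..a + t} s * u s))"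
          "integrable lborel (\<lambda>s. indicator {b<..b + t} s *\<^sub>R (indicator {b..b + t} s * u s))"
          using a by (intro integrable_mult_indicator ints; simp)+
        moreover have "(\<lambda>s. indicator {a..<a + t} s *\<^sub>R (indicator {a..a + t} s * u s)) = (\<lambda>s. indicator {a..<a + t} s * u s)"
          "(\<lambda>s. indicator {b<..b + t} s *\<^sub>R (indicator {b..b + t} s * u s)) = (\<lambda>s. indicator {b<..b + t} s * u s)"
          by (auto simp: indicator_def)
        ultimately have iAB: "integrable lborel (\<lambda>s. indicator {a..<a + t} s * u s)"
          "integrable lborel (\<lambda>s. indicator {b<..b + t} s * u s)"
          by simp_all
        have "(\<integral>s. indicator {a + t..b + t} s * u s \<partial>lborel) - (\<integral>s. indicator {a..b} s * u s \<partial>lborel)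
            = (\<integral>s. indicator {a + t..b + t} s * u s - indicator {a..b} s * u s \<partial>lborel)"
          using a t by (intro Bochner_Integration.integral_diff[symmetric] ints) auto
        also have "\<dots> = (\<integral>s. indicator {b<..b + t} s * u s - indicator {a..<a + t} s * u s \<partial>lborel)"
          using t by (intro Bochner_Integration.integral_cong refl) (auto simp: indicator_def)
        also have "\<dots> = B - A"
          unfolding A_def B_def by (intro Bochner_Integration.integral_diff iAB)
        finally have diff: "heat_flow ?F t x - ?F x = (B - A) / (b - a)"
          unfolding heat_flow_time_average[OF f a t(1) x] time_average_def u_def
            diff_divide_distrib[symmetric] by (simp only:)
        have "\<bar>A / ((a + t) - a) - u a\<bar> \<le> \<epsilon>"
          unfolding A_def by (rule average_close[OF u]) (use a t d1 x in \<open>auto simp: u_def measure_def\<close>)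
        moreover have "\<bar>B / ((b + t) - b) - u b\<bar> \<le> \<epsilon>"
          unfolding B_def by (rule average_close[OF u]) (use a t d2 x in \<open>auto simp: u_def\<close>)
        ultimately have AB: "\<bar>(B / t - u b) - (A / t - u a)\<bar> \<le> 2 * \<epsilon>"
          by simp
        have "(heat_flow ?F t x - ?F x) / t - ?h x = ((B / t - u b) - (A / t - u a)) / (b - a)"
        proof -
          have "(B - A) / (b - a) / t = (B / t - A / t) / (b - a)"
            by (simp add: diff_divide_distrib mult.commute)
          then show ?thesis
            unfolding diff u_def[symmetric] by (simp add: diff_divide_distrib)
        qed
        then have "\<bar>(heat_flow ?F t x - ?F x) / t - ?h x\<bar> \<le> 2 * \<epsilon> / (b - a)"
          using AB a by (simp add: abs_divide divide_right_mono)
        also have "\<dots> = sqrt e / 2"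
          using a by (simp add: \<epsilon>_def field_simps)
        finally have "\<bar>(heat_flow ?F t x - ?F x) / t - ?h x\<bar>\<^sup>2 \<le> (sqrt e / 2)\<^sup>2"
          by (intro power_mono) auto
        then show ?thesis
          using e by (simp add: power_divide)
      qed
      have meas: "(\<lambda>x. ((P t ?F x - ?F x) / t - ?h x)\<^sup>2) \<in> borel_measurable \<mu>"
        using t F h by (intro borel_measurable_power L2_measurable quotient_L2) auto
      have "AE x in \<mu>. ((P t ?F x - ?F x) / t - ?h x)\<^sup>2 \<le> e / 4"
        using P_eq_heat_flow[OF t(1) F] AE_space by eventually_elim (use pt in simp)
      moreover from this have "integrable \<mu> (\<lambda>x. ((P t ?F x - ?F x) / t - ?h x)\<^sup>2)"
        using meas by (intro integrable_const_bound[of _ "e / 4"]) auto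
      ultimately have "(\<integral>x. ((P t ?F x - ?F x) / t - ?h x)\<^sup>2 \<partial>\<mu>) \<le> (\<integral>x. e / 4 \<partial>\<mu>)"
        by (intro integral_mono_AE) auto
      then have "(\<integral>x. ((P t ?F x - ?F x) / t - ?h x)\<^sup>2 \<partial>\<mu>) < e"
        using e by (simp add: prob_space)
      then show ?thesis
        by simp
    qed
    then show "\<forall>\<^sub>F t in at_right 0. dist (\<integral>x. ((P t ?F x - ?F x) / t - ?h x)\<^sup>2 \<partial>\<mu>) 0 < e"
      using d1 d2 a by (intro eventually_at_rightI[of 0 "Min {d1, d2, b - a}"]) auto
  qed
  then show ?thesis
    using P_generator[OF F h] by simp
qed

text \<open>For small \<open>a\<close> the function \<open>P a f\<close> is close to \<open>f\<close> in \<open>L2\<close>, and averages over short windows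
  starting at \<open>a\<close> are uniformly close to \<open>P a f\<close>.\<close>

lemma domain_dense:
  assumes f: "f \<in> L2 \<mu>" and e: "0 < e"
  shows "\<exists>F h. is_laplacian \<mu> F h \<and> norm2 \<mu> (\<lambda>x. f x - F x) < e"
proof -
  have "\<forall>\<^sub>F t in at_right 0. (\<integral>x. (P t f x - f x)\<^sup>2 \<partial>\<mu>) < e\<^sup>2 / 4"
    using order_tendstoD(2)[OF P_continuous[OF f], of "e\<^sup>2 / 4"] e by simp
  then obtain b where b: "0 < b" "\<And>t. 0 < t \<Longrightarrow> t < b \<Longrightarrow> (\<integral>x. (P t f x - f x)\<^sup>2 \<partial>\<mu>) < e\<^sup>2 / 4"
    unfolding eventually_at_right_field by auto
  define a where "a = b / 2"
  have a: "0 < a" "(\<integral>x. (P a f x - f x)\<^sup>2 \<partial>\<mu>) < e\<^sup>2 / 4"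
    using b by (auto simp: a_def)
  obtain d where d: "0 < d"
    "\<forall>s x. a \<le> s \<and> s \<le> a + d \<and> x \<in> gasket \<longrightarrow> \<bar>heat_flow f s x - heat_flow f a x\<bar> \<le> e / 3"
    using heat_flow_uniform[OF f a(1) divide_pos_pos[OF e zero_less_numeral]] by blast
  define F where "F = time_average f a (a + d)"
  have F: "F \<in> L2 \<mu>"
    unfolding F_def using d a by (intro time_average_L2[OF f]) auto
  have close: "\<bar>F x - heat_flow f a x\<bar> \<le> e / 3" if x: "x \<in> gasket" for x
    unfolding F_def time_average_def
    by (rule average_close[OF heat_flow_continuous_left[OF f x]]) (use a d x in auto)
  have mem: "(\<lambda>x. P a f x - f x) \<in> L2 \<mu>" "(\<lambda>x. f x - F x) \<in> L2 \<mu>"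
    using a f F by (auto intro!: L2_diff P_L2)
  have "AE x in \<mu>. (f x - F x)\<^sup>2 \<le> 2 * (P a f x - f x)\<^sup>2 + 2 * (e / 3)\<^sup>2"
    using P_eq_heat_flow[OF a(1) f] AE_space
  proof eventually_elim
    case (elim x)
    have "\<bar>F x - P a f x\<bar> \<le> \<bar>e / 3\<bar>"
      using close[of x] elim by simp
    then have "(F x - P a f x)\<^sup>2 \<le> (e / 3)\<^sup>2"
      by (simp only: abs_le_square_iff)
    \<comment> \<open>parallelogram identity for the two parts of \<open>f x - F x\<close>\<close>
    moreover have "(f x - F x)\<^sup>2 + ((F x - P a f x) - (P a f x - f x))\<^sup>2
        = 2 * (P a f x - f x)\<^sup>2 + 2 * (F x - P a f x)\<^sup>2"
      by (simp add: power2_eq_square algebra_simps)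
    ultimately show ?case
      using zero_le_power2[of "(F x - P a f x) - (P a f x - f x)"] by linarith
  qed
  then have "(\<integral>x. (f x - F x)\<^sup>2 \<partial>\<mu>) \<le> (\<integral>x. 2 * (P a f x - f x)\<^sup>2 + 2 * (e / 3)\<^sup>2 \<partial>\<mu>)"
    using mem[THEN L2_integrable_square] by (intro integral_mono_AE) auto
  also have "\<dots> = 2 * (\<integral>x. (P a f x - f x)\<^sup>2 \<partial>\<mu>) + 2 * (e / 3)\<^sup>2"
    using mem[THEN L2_integrable_square] by (simp add: prob_space)
  also have "\<dots> < 2 * (e\<^sup>2 / 4) + 2 * (e / 3)\<^sup>2"
    using a(2) by simp
  also have "\<dots> \<le> e\<^sup>2"
    by (simp add: power_divide)
  finally have "sqrt (\<integral>x. (f x - F x)\<^sup>2 \<partial>\<mu>) < sqrt (e\<^sup>2)"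
    by (rule real_sqrt_less_mono)
  then have "norm2 \<mu> (\<lambda>x. f x - F x) < e"
    using e by simp
  moreover have "is_laplacian \<mu> F (\<lambda>x. (heat_flow f (a + d) x - heat_flow f a x) / (a + d - a))"
    unfolding F_def using d(1) by (intro time_average_domain[OF f a(1)]) simp
  ultimately show ?thesis
    by blast
qed

end

section \<open>Uniqueness of the heat kernel\<close>

lemma eq_zero_if_abs_le_mult:
  fixes x c :: real
  assumes "\<And>e. 0 < e \<Longrightarrow> \<bar>x\<bar> \<le> e * c"
  shows "x = 0"
proof -
  have "((\<lambda>e. e * c) \<longlongrightarrow> 0 * c) (at_right 0)"
    by (intro tendsto_intros)
  moreover have "\<forall>\<^sub>F e in at_right 0. \<bar>x\<bar> \<le> e * c"
    using assms by (intro eventually_at_right_less[THEN eventually_mono]) auto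
  ultimately have "\<bar>x\<bar> \<le> 0 * c"
    by (intro tendsto_lowerbound[where F = "at_right (0::real)"]) auto
  then show ?thesis
    by simp
qed

text \<open>The difference \<open>D\<close> of the two sides is a bounded bilinear form that vanishes on the domain of the
  Laplacian; density extends this to all of \<open>L2\<close>, one argument at a time.\<close>

lemma semigroups_agree_weakly:
  assumes "gasket_kernel \<mu> P p" "gasket_semigroup \<mu> Q"
    and f: "f \<in> L2 \<mu>" and g: "g \<in> L2 \<mu>" and t: "0 \<le> t"
  shows "(\<integral>x. Q t f x * g x \<partial>\<mu>) = (\<integral>x. f x * P t g x \<partial>\<mu>)"
proof -
  interpret P: gasket_kernel \<mu> P p by fact
  interpret Q: gasket_semigroup \<mu> Q by fact
  define D where "D f g = (\<integral>x. Q t f x * g x \<partial>\<mu>) - (\<integral>x. f x * P t g x \<partial>\<mu>)" for f g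
  have bound: "\<bar>D f g\<bar> \<le> 2 * (norm2 \<mu> f * norm2 \<mu> g)" if "f \<in> L2 \<mu>" "g \<in> L2 \<mu>" for f g
  proof -
    have "\<bar>\<integral>x. Q t f x * g x \<partial>\<mu>\<bar> \<le> norm2 \<mu> (Q t f) * norm2 \<mu> g"
      by (intro Cauchy_Schwarz_L2 Q.P_L2 that t)
    also have "\<dots> \<le> norm2 \<mu> f * norm2 \<mu> g"
      by (intro mult_right_mono real_sqrt_le_mono Q.P_contraction that t) auto
    finally have 1: "\<bar>\<integral>x. Q t f x * g x \<partial>\<mu>\<bar> \<le> norm2 \<mu> f * norm2 \<mu> g" .
    have "\<bar>\<integral>x. f x * P t g x \<partial>\<mu>\<bar> \<le> norm2 \<mu> f * norm2 \<mu> (P t g)"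
      by (intro Cauchy_Schwarz_L2 P.P_L2 that t)
    also have "\<dots> \<le> norm2 \<mu> f * norm2 \<mu> g"
      by (intro mult_left_mono real_sqrt_le_mono P.P_contraction that t) auto
    finally show ?thesis
      using 1 unfolding D_def by linarith
  qed
  have D_left: "D f g = D (\<lambda>x. f x - F x) g + D F g" if m: "f \<in> L2 \<mu>" "F \<in> L2 \<mu>" "g \<in> L2 \<mu>" for f F g
  proof -
    note i = L2_integrable_mult[OF Q.P_L2[OF t m(1)] m(3)] L2_integrable_mult[OF Q.P_L2[OF t m(2)] m(3)]
      L2_integrable_mult[OF m(1) P.P_L2[OF t m(3)]] L2_integrable_mult[OF m(2) P.P_L2[OF t m(3)]]
    have "AE x in \<mu>. Q t (\<lambda>x. f x - F x) x = Q t f x - Q t F x"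
      using Q.P_linear[OF t m(1,2), of 1 "- 1"] by simp
    then have "(\<integral>x. Q t (\<lambda>x. f x - F x) x * g x \<partial>\<mu>) = (\<integral>x. Q t f x * g x - Q t F x * g x \<partial>\<mu>)"
      using t m by (intro integral_cong_AE borel_measurable_times borel_measurable_diff
        Q.P_measurable L2_measurable L2_diff) (auto simp: left_diff_distrib)
    then show ?thesis
      unfolding D_def using i by (simp add: left_diff_distrib)
  qed
  have D_right: "D f g = D f (\<lambda>x. g x - G x) + D f G" if m: "f \<in> L2 \<mu>" "g \<in> L2 \<mu>" "G \<in> L2 \<mu>" for f g G
  proof -
    note i = L2_integrable_mult[OF Q.P_L2[OF t m(1)] m(2)] L2_integrable_mult[OF Q.P_L2[OF t m(1)] m(3)]
      L2_integrable_mult[OF m(1) P.P_L2[OF t m(2)]] L2_integrable_mult[OF m(1) P.P_L2[OF t m(3)]]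
    have "AE x in \<mu>. P t (\<lambda>x. g x - G x) x = P t g x - P t G x"
      using P.P_linear[OF t m(2,3), of 1 "- 1"] by simp
    then have "(\<integral>x. f x * P t (\<lambda>x. g x - G x) x \<partial>\<mu>) = (\<integral>x. f x * P t g x - f x * P t G x \<partial>\<mu>)"
      using t m by (intro integral_cong_AE borel_measurable_times borel_measurable_diff
        P.P_measurable L2_measurable L2_diff) (auto simp: right_diff_distrib)
    then show ?thesis
      unfolding D_def using i by (simp add: right_diff_distrib)
  qed
  have D_dom: "D F G = 0" if "is_laplacian \<mu> F h" "is_laplacian \<mu> G k" for F G h k
    unfolding D_def
    using semigroups_agree_weakly_on_domain[OF P.gasket_semigroup_axioms Q.gasket_semigroup_axioms that t]
    by simp
  have dom_L2: "F \<in> L2 \<mu>" if "is_laplacian \<mu> F h" for F h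
    using that by (simp add: is_laplacian_def)
  have D_half: "D f G = 0" if G: "is_laplacian \<mu> G k" for G k
  proof (rule eq_zero_if_abs_le_mult)
    fix e :: real assume "0 < e"
    then obtain F h where F: "is_laplacian \<mu> F h" "norm2 \<mu> (\<lambda>x. f x - F x) < e"
      using P.domain_dense[OF f] by metis
    have "\<bar>D f G\<bar> = \<bar>D (\<lambda>x. f x - F x) G\<bar>"
      using D_left[OF f dom_L2[OF F(1)] dom_L2[OF G]] D_dom[OF F(1) G] by simp
    also have "\<dots> \<le> 2 * (norm2 \<mu> (\<lambda>x. f x - F x) * norm2 \<mu> G)"
      by (intro bound L2_diff f dom_L2[OF F(1)] dom_L2[OF G])
    also have "\<dots> \<le> 2 * (e * norm2 \<mu> G)"
      using F(2) by (intro mult_left_mono mult_right_mono) auto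
    finally show "\<bar>D f G\<bar> \<le> e * (2 * norm2 \<mu> G)"
      by simp
  qed
  have "D f g = 0"
  proof (rule eq_zero_if_abs_le_mult)
    fix e :: real assume "0 < e"
    then obtain G k where G: "is_laplacian \<mu> G k" "norm2 \<mu> (\<lambda>x. g x - G x) < e"
      using P.domain_dense[OF g] by metis
    have "\<bar>D f g\<bar> = \<bar>D f (\<lambda>x. g x - G x)\<bar>"
      using D_right[OF f g dom_L2[OF G(1)]] D_half[OF G(1)] by simp
    also have "\<dots> \<le> 2 * (norm2 \<mu> f * norm2 \<mu> (\<lambda>x. g x - G x))"
      by (intro bound L2_diff f g dom_L2[OF G(1)])
    also have "\<dots> \<le> 2 * (norm2 \<mu> f * e)"
      using G(2) by (intro mult_left_mono) auto
    finally show "\<bar>D f g\<bar> \<le> e * (2 * norm2 \<mu> f)"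
      by (simp add: mult_ac)
  qed
  then show ?thesis
    by (simp add: D_def)
qed

text \<open>Two test functions suffice: the difference of the flows of \<open>f\<close> for the two kernels shows that
  these flows agree almost everywhere, hence everywhere by continuity; and taking for \<open>f\<close> the
  difference of the kernels in the second variable shows that this difference has norm zero.\<close>

theorem heat_kernel_unique:
  assumes "gasket_kernel \<mu> P p" "gasket_kernel \<mu> Q q" and t: "0 < t"
    and x: "x \<in> gasket" and y: "y \<in> gasket"
  shows "p t x y = q t x y"
proof -
  interpret P: gasket_kernel \<mu> P p by fact
  interpret Q: gasket_kernel \<mu> Q q by fact
  have flow: "P.heat_flow f t z = Q.heat_flow f t z" if f: "f \<in> L2 \<mu>" and z: "z \<in> gasket" for f z
  proof -
    define d where "d z = P.heat_flow f t z - Q.heat_flow f t z" for z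
    have d: "continuous_on gasket d"
      unfolding d_def by (intro continuous_on_diff P.heat_flow_continuous_right
        Q.heat_flow_continuous_right f t)
    have dL2: "d \<in> L2 \<mu>"
      by (rule P.continuous_L2[OF d])
    have eqs: "(\<integral>z. Q t f z * d z \<partial>\<mu>) = (\<integral>z. P t f z * d z \<partial>\<mu>)"
      using semigroups_agree_weakly[OF assms(1) Q.gasket_semigroup_axioms f dL2, of t]
        P.P_symmetric[of t f d] f dL2 t by simp
    have "(\<integral>z. (d z)\<^sup>2 \<partial>\<mu>) = (\<integral>z. P t f z * d z - Q t f z * d z \<partial>\<mu>)"
    proof (rule integral_cong_AE)
      show "AE z in \<mu>. (d z)\<^sup>2 = P t f z * d z - Q t f z * d z"
        using P.P_eq_heat_flow[OF t f] Q.P_eq_heat_flow[OF t f]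
        by eventually_elim (simp add: d_def power2_eq_square algebra_simps)
    qed (use L2_measurable[OF dL2] P.P_measurable[of t f] Q.P_measurable[of t f] f t in auto)
    also have "\<dots> = 0"
      using eqs L2_integrable_mult[OF P.P_L2[of t f] dL2] L2_integrable_mult[OF Q.P_L2[of t f] dL2] f t
      by simp
    finally have "AE z in \<mu>. (d z)\<^sup>2 = 0"
      using L2_integrable_square[OF dL2] by (subst (asm) integral_nonneg_eq_0_iff_AE) auto
    then have "d z = 0"
      using d z by (intro P.continuous_AE_zero[of d]) auto
    then show ?thesis
      by (simp add: d_def)
  qed
  define f where "f y = p t x y - q t x y" for y
  have f: "continuous_on gasket f"
    unfolding f_def by (intro continuous_on_diff P.kernel_continuous_right Q.kernel_continuous_right t x)
  have fL2: "f \<in> L2 \<mu>"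
    by (rule P.continuous_L2[OF f])
  have "(\<integral>y. (f y)\<^sup>2 \<partial>\<mu>) = (\<integral>y. p t x y * f y - q t x y * f y \<partial>\<mu>)"
    by (intro Bochner_Integration.integral_cong refl) (simp add: f_def power2_eq_square algebra_simps)
  also have "\<dots> = P.heat_flow f t x - Q.heat_flow f t x"
    unfolding P.heat_flow_def Q.heat_flow_def
    by (intro Bochner_Integration.integral_diff L2_integrable_mult fL2 P.kernel_L2 Q.kernel_L2 t x)
  also have "\<dots> = 0"
    using flow[OF fL2 x] by simp
  finally have "AE y in \<mu>. (f y)\<^sup>2 = 0"
    using L2_integrable_square[OF fL2] by (subst (asm) integral_nonneg_eq_0_iff_AE) auto
  then have "f y = 0"
    using f y by (intro P.continuous_AE_zero[of f]) auto
  then show ?thesis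
    by (simp add: f_def)
qed

section \<open>Reflections preserve the heat kernel\<close>

text \<open>The reflection permutes the words of length \<open>n\<close> and the corners, so it only rearranges the sum.\<close>

lemma energy_level_reflection:
  assumes "i \<in> {1, 2, 3}"
  shows "energy_level n (\<lambda>x. f (gasket_reflection i x)) (\<lambda>x. g (gasket_reflection i x)) = energy_level n f g"
proof -
  let ?\<sigma> = "gasket_reflection i"
  define T where "T w x y = (f (word_map w x) - f (word_map w y)) * (g (word_map w x) - g (word_map w y))" for w x y
  have "(\<Sum>w\<in>words n. \<Sum>x\<in>corners. \<Sum>y\<in>corners.
      (f (?\<sigma> (word_map w x)) - f (?\<sigma> (word_map w y))) * (g (?\<sigma> (word_map w x)) - g (?\<sigma> (word_map w y))))
    = (\<Sum>w\<in>words n. \<Sum>x\<in>corners. \<Sum>y\<in>corners. T (map (swap_index i) w) (?\<sigma> x) (?\<sigma> y))"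
    unfolding T_def by (intro sum.cong refl) (simp only: gasket_reflection_word_map[OF assms])
  also have "\<dots> = (\<Sum>w\<in>words n. \<Sum>x\<in>corners. \<Sum>y\<in>corners. T (map (swap_index i) w) x y)"
    by (simp only: sum.reindex_bij_betw[OF bij_betw_reflection_corners[OF assms],
      of "\<lambda>y. T _ _ y"] sum.reindex_bij_betw[OF bij_betw_reflection_corners[OF assms],
      of "\<lambda>x. \<Sum>y\<in>corners. T _ x y"])
  also have "\<dots> = (\<Sum>w\<in>words n. \<Sum>x\<in>corners. \<Sum>y\<in>corners. T w x y)"
    by (rule sum.reindex_bij_betw[OF bij_betw_swap_words[OF assms]])
  finally show ?thesis
    by (simp only: energy_level_def T_def)
qed

lemma energy_reflection:
  assumes "i \<in> {1, 2, 3}"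
  shows "energy (\<lambda>x. f (gasket_reflection i x)) (\<lambda>x. g (gasket_reflection i x)) = energy f g"
  by (simp only: energy_def energy_level_reflection[OF assms])

lemma energy_domain_reflection:
  assumes "i \<in> {1, 2, 3}" "u \<in> energy_domain"
  shows "(\<lambda>x. u (gasket_reflection i x)) \<in> energy_domain"
proof -
  have "continuous_on gasket (\<lambda>x. u (gasket_reflection i x))"
    by (rule continuous_on_compose2[OF energy_domain_continuous[OF assms(2)]
      continuous_on_gasket_reflection[OF assms(1)]]) (simp add: gasket_reflection_image[OF assms(1)])
  then show ?thesis
    using assms(2) by (simp add: energy_domain_def energy_level_reflection[OF assms(1)])
qed

context gasket_measure_space
begin

lemma L2_reflection:
  assumes "i \<in> {1, 2, 3}" "f \<in> L2 \<mu>"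
  shows "(\<lambda>x. f (gasket_reflection i x)) \<in> L2 \<mu>"
  using integrable_reflection[OF assms(1) L2_integrable_square[OF assms(2)]]
    measurable_compose[OF measurable_reflection[OF assms(1)] L2_measurable[OF assms(2)]]
  by (simp add: L2_def)

lemma laplacian_reflection:
  assumes i: "i \<in> {1, 2, 3}" and f: "is_laplacian \<mu> f h"
  shows "is_laplacian \<mu> (\<lambda>x. f (gasket_reflection i x)) (\<lambda>x. h (gasket_reflection i x))"
proof -
  let ?\<sigma> = "gasket_reflection i"
  have L2: "f \<in> L2 \<mu>" "h \<in> L2 \<mu>"
    using f by (auto simp: is_laplacian_def)
  obtain u where u: "u \<in> energy_domain" "AE x in \<mu>. f x = u x"
    "\<And>g. g \<in> energy_domain \<Longrightarrow> energy u g = - (\<integral>x. h x * g x \<partial>\<mu>)"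
    using f by (auto simp: is_laplacian_def)
  have energy_u: "energy (\<lambda>x. u (?\<sigma> x)) g = - (\<integral>x. h (?\<sigma> x) * g x \<partial>\<mu>)" if g: "g \<in> energy_domain" for g
  proof -
    have g': "(\<lambda>x. g (?\<sigma> x)) \<in> energy_domain"
      by (rule energy_domain_reflection[OF i g])
    have [measurable]: "h \<in> borel_measurable \<mu>" "(\<lambda>x. g (?\<sigma> x)) \<in> borel_measurable \<mu>"
      by (intro L2_measurable[OF L2(2)] continuous_measurable energy_domain_continuous g')+
    have "energy (\<lambda>x. u (?\<sigma> x)) g = energy (\<lambda>x. u (?\<sigma> x)) (\<lambda>x. g (?\<sigma> (?\<sigma> x)))"
      by (simp only: gasket_reflection_involution[OF i])
    also have "\<dots> = energy u (\<lambda>x. g (?\<sigma> x))"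
      by (rule energy_reflection[OF i])
    also have "\<dots> = - (\<integral>x. h x * g (?\<sigma> x) \<partial>\<mu>)"
      by (rule u(3)[OF g'])
    also have "(\<integral>x. h x * g (?\<sigma> x) \<partial>\<mu>) = (\<integral>x. h (?\<sigma> x) * g (?\<sigma> (?\<sigma> x)) \<partial>\<mu>)"
      by (rule integral_reflection[OF i, of "\<lambda>x. h x * g (?\<sigma> x)", symmetric]) measurable
    finally show ?thesis
      by (simp only: gasket_reflection_involution[OF i])
  qed
  show ?thesis
    unfolding is_laplacian_def
    by (intro conjI bexI[OF _ energy_domain_reflection[OF i u(1)]] ballI
      L2_reflection[OF i L2(1)] L2_reflection[OF i L2(2)] AE_reflection[OF i u(2)] energy_u)
qed

lemma laplacian_reflection_iff:
  assumes i: "i \<in> {1, 2, 3}"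
  shows "is_laplacian \<mu> (\<lambda>x. f (gasket_reflection i x)) (\<lambda>x. h (gasket_reflection i x))
    \<longleftrightarrow> is_laplacian \<mu> f h"
  using laplacian_reflection[OF i, of f h]
    laplacian_reflection[OF i, of "\<lambda>x. f (gasket_reflection i x)" "\<lambda>x. h (gasket_reflection i x)"]
  by (simp only: gasket_reflection_involution[OF i]) blast

end

text \<open>The reflection acts as a unitary involution on \<open>L2\<close>, under which all clauses but the last one are
  invariant; in the last one the Laplacian commutes with the reflection.\<close>

lemma heat_semigroup_reflection:
  assumes "gasket_semigroup \<mu> P" and i: "i \<in> {1, 2, 3}"
  shows "heat_semigroup \<mu> (\<lambda>t f x. P t (\<lambda>z. f (gasket_reflection i z)) (gasket_reflection i x))"
proof -
  interpret gasket_semigroup \<mu> P by fact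
  let ?\<sigma> = "gasket_reflection i"
  note inv = gasket_reflection_involution[OF i]
  note L2r = L2_reflection[OF i]
  have meas: "(\<lambda>x. P t f x * g x) \<in> borel_measurable \<mu>" "(\<lambda>x. f x * P t g x) \<in> borel_measurable \<mu>"
    if "0 \<le> t" "f \<in> L2 \<mu>" "g \<in> L2 \<mu>" for t f g
    using that L2_measurable[of f] L2_measurable[of g] P_measurable[of t f] P_measurable[of t g]
    by auto
  show ?thesis
    unfolding heat_semigroup_def
  proof (intro conjI allI ballI impI)
    fix t :: real and f assume t: "0 \<le> t" and f: "f \<in> L2 \<mu>"
    note f' = L2r[OF f]
    show "(\<lambda>x. P t (\<lambda>z. f (?\<sigma> z)) (?\<sigma> x)) \<in> L2 \<mu>"
      by (rule L2r[OF P_L2[OF t f']])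
    have "(\<integral>x. (P t (\<lambda>z. f (?\<sigma> z)) (?\<sigma> x))\<^sup>2 \<partial>\<mu>) = (\<integral>x. (P t (\<lambda>z. f (?\<sigma> z)) x)\<^sup>2 \<partial>\<mu>)"
      using t f' by (intro integral_reflection[OF i, of "\<lambda>x. (P t (\<lambda>z. f (?\<sigma> z)) x)\<^sup>2"]
        borel_measurable_power P_measurable)
    also have "\<dots> \<le> (\<integral>x. (f (?\<sigma> x))\<^sup>2 \<partial>\<mu>)"
      by (rule P_contraction[OF t f'])
    also have "\<dots> = (\<integral>x. (f x)\<^sup>2 \<partial>\<mu>)"
      using f by (intro integral_reflection[OF i, of "\<lambda>x. (f x)\<^sup>2"] borel_measurable_power L2_measurable)
    finally show "(\<integral>x. (P t (\<lambda>z. f (?\<sigma> z)) (?\<sigma> x))\<^sup>2 \<partial>\<mu>) \<le> (\<integral>x. (f x)\<^sup>2 \<partial>\<mu>)" .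
    fix g assume g: "g \<in> L2 \<mu>"
    note g' = L2r[OF g]
    show "AE x in \<mu>. P t (\<lambda>z. a * f (?\<sigma> z) + b * g (?\<sigma> z)) (?\<sigma> x)
        = a * P t (\<lambda>z. f (?\<sigma> z)) (?\<sigma> x) + b * P t (\<lambda>z. g (?\<sigma> z)) (?\<sigma> x)" for a b
      by (rule AE_reflection[OF i P_linear[OF t f' g', of a b]])
    have "(\<integral>x. P t (\<lambda>z. f (?\<sigma> z)) (?\<sigma> x) * g x \<partial>\<mu>)
        = (\<integral>x. P t (\<lambda>z. f (?\<sigma> z)) (?\<sigma> x) * g (?\<sigma> (?\<sigma> x)) \<partial>\<mu>)"
      by (simp only: inv)
    also have "\<dots> = (\<integral>x. P t (\<lambda>z. f (?\<sigma> z)) x * g (?\<sigma> x) \<partial>\<mu>)"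
      by (rule integral_reflection[OF i, of "\<lambda>x. P t (\<lambda>z. f (?\<sigma> z)) x * g (?\<sigma> x)"]) (rule meas(1)[OF t f' g'])
    also have "\<dots> = (\<integral>x. f (?\<sigma> x) * P t (\<lambda>z. g (?\<sigma> z)) x \<partial>\<mu>)"
      by (rule P_symmetric[OF t f' g'])
    also have "\<dots> = (\<integral>x. f (?\<sigma> (?\<sigma> x)) * P t (\<lambda>z. g (?\<sigma> z)) (?\<sigma> x) \<partial>\<mu>)"
      by (rule integral_reflection[OF i, of "\<lambda>x. f (?\<sigma> x) * P t (\<lambda>z. g (?\<sigma> z)) x", symmetric])
        (rule meas(2)[OF t f' g'])
    finally show "(\<integral>x. P t (\<lambda>z. f (?\<sigma> z)) (?\<sigma> x) * g x \<partial>\<mu>) = (\<integral>x. f x * P t (\<lambda>z. g (?\<sigma> z)) (?\<sigma> x) \<partial>\<mu>)"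
      by (simp only: inv)
  next
    fix f assume f: "f \<in> L2 \<mu>"
    show "AE x in \<mu>. P 0 (\<lambda>z. f (?\<sigma> z)) (?\<sigma> x) = f x"
      using AE_reflection[OF i P_zero[OF L2r[OF f]]] by (simp only: inv)
  next
    fix s t :: real and f assume st: "0 \<le> s" "0 \<le> t" and f: "f \<in> L2 \<mu>"
    show "AE x in \<mu>. P (s + t) (\<lambda>z. f (?\<sigma> z)) (?\<sigma> x)
        = P s (\<lambda>z. P t (\<lambda>z. f (?\<sigma> z)) (?\<sigma> (?\<sigma> z))) (?\<sigma> x)"
      using AE_reflection[OF i P_add[OF st L2r[OF f]]] by (simp only: inv)
  next
    fix f assume f: "f \<in> L2 \<mu>"
    note f' = L2r[OF f]
    have "(\<integral>x. (P t (\<lambda>z. f (?\<sigma> z)) (?\<sigma> x) - f (?\<sigma> (?\<sigma> x)))\<^sup>2 \<partial>\<mu>) = (\<integral>x. (P t (\<lambda>z. f (?\<sigma> z)) x - f (?\<sigma> x))\<^sup>2 \<partial>\<mu>)"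
      if "0 < t" for t
      using that f' by (intro integral_reflection[OF i, of "\<lambda>x. (P t (\<lambda>z. f (?\<sigma> z)) x - f (?\<sigma> x))\<^sup>2"]
        borel_measurable_power borel_measurable_diff P_measurable L2_measurable[OF f']) auto
    then have "\<forall>\<^sub>F t in at_right 0. (\<integral>x. (P t (\<lambda>z. f (?\<sigma> z)) (?\<sigma> x) - f x)\<^sup>2 \<partial>\<mu>)
        = (\<integral>x. (P t (\<lambda>z. f (?\<sigma> z)) x - f (?\<sigma> x))\<^sup>2 \<partial>\<mu>)"
      unfolding inv by (intro eventually_at_right_less[THEN eventually_mono]) auto
    then show "((\<lambda>t. \<integral>x. (P t (\<lambda>z. f (?\<sigma> z)) (?\<sigma> x) - f x)\<^sup>2 \<partial>\<mu>) \<longlongrightarrow> 0) (at_right 0)"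
      using P_continuous[OF f'] by (simp only: tendsto_cong)
    fix h assume h: "h \<in> L2 \<mu>"
    note h' = L2r[OF h]
    have "(\<integral>x. ((P t (\<lambda>z. f (?\<sigma> z)) (?\<sigma> x) - f (?\<sigma> (?\<sigma> x))) / t - h (?\<sigma> (?\<sigma> x)))\<^sup>2 \<partial>\<mu>)
        = (\<integral>x. ((P t (\<lambda>z. f (?\<sigma> z)) x - f (?\<sigma> x)) / t - h (?\<sigma> x))\<^sup>2 \<partial>\<mu>)"
      if "0 < t" for t
      using that L2_measurable[OF quotient_L2[OF less_imp_le[OF that] f' h']]
      by (intro integral_reflection[OF i, of "\<lambda>x. ((P t (\<lambda>z. f (?\<sigma> z)) x - f (?\<sigma> x)) / t - h (?\<sigma> x))\<^sup>2"]
        borel_measurable_power)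
    then have ev: "\<forall>\<^sub>F t in at_right 0. (\<integral>x. ((P t (\<lambda>z. f (?\<sigma> z)) (?\<sigma> x) - f x) / t - h x)\<^sup>2 \<partial>\<mu>)
        = (\<integral>x. ((P t (\<lambda>z. f (?\<sigma> z)) x - f (?\<sigma> x)) / t - h (?\<sigma> x))\<^sup>2 \<partial>\<mu>)"
      unfolding inv by (intro eventually_at_right_less[THEN eventually_mono]) auto
    show "((\<lambda>t. \<integral>x. ((P t (\<lambda>z. f (?\<sigma> z)) (?\<sigma> x) - f x) / t - h x)\<^sup>2 \<partial>\<mu>) \<longlongrightarrow> 0) (at_right 0)
        \<longleftrightarrow> is_laplacian \<mu> f h"
      unfolding tendsto_cong[OF ev] P_generator[OF f' h'] by (rule laplacian_reflection_iff[OF i])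
  qed
qed

text \<open>The reflected kernel is a continuous kernel of the reflected semigroup, which has the generator of
  \<open>P\<close>; uniqueness identifies it with \<open>p\<close>.\<close>

lemma heat_kernel_reflection:
  assumes "gasket_kernel \<mu> P p" and i: "i \<in> {1, 2, 3}" and t: "0 < t"
    and x: "x \<in> gasket" and y: "y \<in> gasket"
  shows "p t (gasket_reflection i x) (gasket_reflection i y) = p t x y"
proof -
  interpret gasket_kernel \<mu> P p by fact
  let ?\<sigma> = "gasket_reflection i"
  let ?Q = "\<lambda>t f x. P t (\<lambda>z. f (?\<sigma> z)) (?\<sigma> x)" and ?q = "\<lambda>t x y. p t (?\<sigma> x) (?\<sigma> y)"
  note inv = gasket_reflection_involution[OF i] and mem = gasket_reflection_mem[OF i]
  have "heat_kernel \<mu> ?Q ?q"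
    unfolding heat_kernel_def
  proof (intro conjI allI ballI impI)
    have \<sigma>: "continuous_on A (\<lambda>z. ?\<sigma> (k z))" if "continuous_on A k" for A :: "(real \<times> complex \<times> complex) set" and k
      by (rule continuous_on_compose2[OF continuous_on_gasket_reflection[OF i, of UNIV] that]) auto
    show "continuous_on ({0<..} \<times> gasket \<times> gasket) (\<lambda>(t, x, y). ?q t x y)"
      unfolding case_prod_unfold
      by (intro kernel_continuous_compose \<sigma> continuous_intros) (auto intro: mem)
    fix t :: real and f assume t: "0 < t" and f: "f \<in> L2 \<mu>"
    note f' = L2_reflection[OF i f]
    have "AE x in \<mu>. P t (\<lambda>z. f (?\<sigma> z)) (?\<sigma> x) = heat_flow (\<lambda>z. f (?\<sigma> z)) t (?\<sigma> x)"
      by (rule AE_reflection[OF i P_eq_heat_flow[OF t f']])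
    then show "AE x in \<mu>. ?Q t f x = (\<integral>y. ?q t x y * f y \<partial>\<mu>)"
      using AE_space
    proof eventually_elim
      case (elim x)
      then have \<sigma>x: "?\<sigma> x \<in> gasket"
        by (simp add: mem)
      have "(\<integral>y. ?q t x y * f y \<partial>\<mu>) = (\<integral>y. p t (?\<sigma> x) (?\<sigma> y) * f (?\<sigma> (?\<sigma> y)) \<partial>\<mu>)"
        by (simp only: inv)
      also have "\<dots> = (\<integral>y. p t (?\<sigma> x) y * f (?\<sigma> y) \<partial>\<mu>)"
        by (rule integral_reflection[OF i, of "\<lambda>y. p t (?\<sigma> x) y * f (?\<sigma> y)"])
          (intro borel_measurable_times L2_measurable kernel_L2 t \<sigma>x f')
      finally show ?case
        using elim by (simp add: heat_flow_def)
    qed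
  qed
  then have "gasket_kernel \<mu> ?Q ?q"
    using heat_semigroup_reflection[OF gasket_semigroup_axioms i]
    by unfold_locales
  from heat_kernel_unique[OF this assms(1) t x y] show ?thesis .
qed

section \<open>Joint laws are determined by linear combinations\<close>

text \<open>Up to normalisation, \<open>w\<close> is a density with respect to \<open>M\<close>, and the law of \<open>v\<close> under it is
  determined by its characteristic function. The phases \<open>0\<close> and \<open>- pi / 2\<close> of \<open>\<psi>\<close> give its real and
  imaginary part.\<close>

lemma weighted_law_eqI:
  fixes v :: "'a \<Rightarrow> real" and v' :: "'b \<Rightarrow> real"
  assumes "prob_space M" "prob_space M'"
    and [measurable]: "v \<in> borel_measurable M" "w \<in> borel_measurable M"
      "v' \<in> borel_measurable M'" "w' \<in> borel_measurable M'"
    and w: "\<And>x. 0 \<le> w x \<and> w x \<le> C" and w': "\<And>x. 0 \<le> w' x \<and> w' x \<le> C"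
    and eq: "\<And>s \<psi>. (\<integral>x. w x * cos (s * v x + \<psi>) \<partial>M) = (\<integral>x. w' x * cos (s * v' x + \<psi>) \<partial>M')"
    and [measurable]: "B \<in> sets borel"
  shows "(\<integral>x. w x * indicator B (v x) \<partial>M) = (\<integral>x. w' x * indicator B (v' x) \<partial>M')"
proof -
  interpret M: prob_space M by fact
  interpret M': prob_space M' by fact
  have C: "0 \<le> C"
    using w[of undefined] by linarith
  have int: "integrable M (\<lambda>x. w x * k (v x))" if [measurable]: "k \<in> borel_measurable borel"
    and "\<And>y. \<bar>k y\<bar> \<le> 1" for k :: "real \<Rightarrow> real"
  proof (rule M.integrable_const_bound[of _ C])
    show "AE x in M. norm (w x * k (v x)) \<le> C"
    proof (rule AE_I2)
      fix x
      have "\<bar>w x\<bar> * \<bar>k (v x)\<bar> \<le> C * 1"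
        using w that(2) C by (intro mult_mono) auto
      then show "norm (w x * k (v x)) \<le> C"
        by (simp add: abs_mult)
    qed
  qed measurable
  have int': "integrable M' (\<lambda>x. w' x * k (v' x))" if [measurable]: "k \<in> borel_measurable borel"
    and "\<And>y. \<bar>k y\<bar> \<le> 1" for k :: "real \<Rightarrow> real"
  proof (rule M'.integrable_const_bound[of _ C])
    show "AE x in M'. norm (w' x * k (v' x)) \<le> C"
    proof (rule AE_I2)
      fix x
      have "\<bar>w' x\<bar> * \<bar>k (v' x)\<bar> \<le> C * 1"
        using w' that(2) C by (intro mult_mono) auto
      then show "norm (w' x * k (v' x)) \<le> C"
        by (simp add: abs_mult)
    qed
  qed measurable
  define m where "m = (\<integral>x. w x \<partial>M)"
  have m': "m = (\<integral>x. w' x \<partial>M')"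
    using eq[of 0 0] by (simp add: m_def)
  have iw: "integrable M w" "integrable M' w'"
    using int[of "\<lambda>_. 1"] int'[of "\<lambda>_. 1"] by simp_all
  show ?thesis
  proof (cases "m = 0")
    case True
    have "AE x in M. w x = 0" "AE x in M'. w' x = 0"
      using integral_nonneg_eq_0_iff_AE[OF iw(1)] integral_nonneg_eq_0_iff_AE[OF iw(2)] w w'
        True m'[symmetric] by (simp_all add: m_def)
    then have "AE x in M. w x * indicator B (v x) = 0" "AE x in M'. w' x * indicator B (v' x) = 0"
      by auto
    then have "(\<integral>x. w x * indicator B (v x) \<partial>M) = 0" "(\<integral>x. w' x * indicator B (v' x) \<partial>M') = 0"
      by (auto intro: integral_eq_zero_AE)
    then show ?thesis by simp
  next
    case False
    then have m: "0 < m"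
      using w unfolding m_def by (simp add: order_less_le integral_nonneg)
    define R where "R = distr (density M (\<lambda>x. ennreal (w x / m))) borel v"
    define R' where "R' = distr (density M' (\<lambda>x. ennreal (w' x / m))) borel v'"
    have meas: "measure R B = (\<integral>x. w x * indicator B (v x) \<partial>M) / m" if [measurable]: "B \<in> sets borel" for B
    proof -
      have "measure R B = (\<integral>y. indicator B y \<partial>R)"
        by (simp add: R_def)
      also have "\<dots> = (\<integral>x. indicator B (v x) \<partial>density M (\<lambda>x. ennreal (w x / m)))"
        unfolding R_def by (rule integral_distr) auto
      also have "\<dots> = (\<integral>x. (w x / m) *\<^sub>R indicator B (v x) \<partial>M)"
        using w m by (intro integral_density) auto
      finally show ?thesis by simp
    qed
    have meas': "measure R' B = (\<integral>x. w' x * indicator B (v' x) \<partial>M') / m" if [measurable]: "B \<in> sets borel" for B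
    proof -
      have "measure R' B = (\<integral>y. indicator B y \<partial>R')"
        by (simp add: R'_def)
      also have "\<dots> = (\<integral>x. indicator B (v' x) \<partial>density M' (\<lambda>x. ennreal (w' x / m)))"
        unfolding R'_def by (rule integral_distr) auto
      also have "\<dots> = (\<integral>x. (w' x / m) *\<^sub>R indicator B (v' x) \<partial>M')"
        using w' m by (intro integral_density) auto
      finally show ?thesis by simp
    qed
    have emeas: "emeasure R (space R) = 1"
    proof -
      have "emeasure R (space R) = (\<integral>\<^sup>+x. ennreal (w x / m) \<partial>M)"
        unfolding R_def by (simp add: emeasure_distr emeasure_density cong: nn_integral_cong)
      also have "\<dots> = ennreal (\<integral>x. w x / m \<partial>M)"
        using iw w m by (intro nn_integral_eq_integral) auto
      also have "\<dots> = 1"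
        using m by (simp add: m_def)
      finally show ?thesis .
    qed
    have emeas': "emeasure R' (space R') = 1"
    proof -
      have "emeasure R' (space R') = (\<integral>\<^sup>+x. ennreal (w' x / m) \<partial>M')"
        unfolding R'_def by (simp add: emeasure_distr emeasure_density cong: nn_integral_cong)
      also have "\<dots> = ennreal (\<integral>x. w' x / m \<partial>M')"
        using iw w' m by (intro nn_integral_eq_integral) auto
      also have "\<dots> = 1"
        using m by (simp add: m')
      finally show ?thesis .
    qed
    interpret R: prob_space R by standard (rule emeas)
    interpret R': prob_space R' by standard (rule emeas')
    have rd: "real_distribution R" "real_distribution R'"
      by (auto simp: real_distribution_def real_distribution_axioms_def R.prob_space_axioms
        R'.prob_space_axioms) (simp_all add: R_def R'_def)
    interpret R: real_distribution R by (rule rd)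
    interpret R': real_distribution R' by (rule rd)
    have cosR: "(\<integral>y. cos (s * y + \<psi>) \<partial>R) = (\<integral>x. w x * cos (s * v x + \<psi>) \<partial>M) / m" for s \<psi>
    proof -
      have "(\<integral>y. cos (s * y + \<psi>) \<partial>R) = (\<integral>x. cos (s * v x + \<psi>) \<partial>density M (\<lambda>x. ennreal (w x / m)))"
        unfolding R_def by (rule integral_distr) auto
      also have "\<dots> = (\<integral>x. (w x / m) *\<^sub>R cos (s * v x + \<psi>) \<partial>M)"
        using w m by (intro integral_density) auto
      finally show ?thesis by simp
    qed
    have cosR': "(\<integral>y. cos (s * y + \<psi>) \<partial>R') = (\<integral>x. w' x * cos (s * v' x + \<psi>) \<partial>M') / m" for s \<psi>
    proof -
      have "(\<integral>y. cos (s * y + \<psi>) \<partial>R') = (\<integral>x. cos (s * v' x + \<psi>) \<partial>density M' (\<lambda>x. ennreal (w' x / m)))"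
        unfolding R'_def by (rule integral_distr) auto
      also have "\<dots> = (\<integral>x. (w' x / m) *\<^sub>R cos (s * v' x + \<psi>) \<partial>M')"
        using w' m by (intro integral_density) auto
      finally show ?thesis by simp
    qed
    have cos_eq: "(\<integral>y. cos (s * y + \<psi>) \<partial>R) = (\<integral>y. cos (s * y + \<psi>) \<partial>R')" for s \<psi>
      unfolding cosR cosR' eq ..
    have "char R s = char R' s" for s
    proof (rule complex_eqI)
      have i: "integrable R (\<lambda>y. iexp (s * y))" "integrable R' (\<lambda>y. iexp (s * y))"
        by (auto intro!: R.integrable_iexp R'.integrable_iexp)
      have re: "Re (iexp (s * y)) = cos (s * y + 0)" and im: "Im (iexp (s * y)) = cos (s * y + - (pi / 2))" for y
        by (simp_all add: Re_exp Im_exp cos_diff)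
      show "Re (char R s) = Re (char R' s)"
        unfolding char_def integral_Re[OF i(1), symmetric] integral_Re[OF i(2), symmetric] re by (rule cos_eq)
      show "Im (char R s) = Im (char R' s)"
        unfolding char_def integral_Im[OF i(1), symmetric] integral_Im[OF i(2), symmetric] im by (rule cos_eq)
    qed
    then have "R = R'"
      by (intro Levy_uniqueness rd) auto
    then have "measure R B = measure R' B"
      by simp
    then show ?thesis
      using m by (simp add: meas meas')
  qed
qed

text \<open>In the claim \<open>main\<close> the coordinates in \<open>F\<close> have already been converted from the Fourier side to
  indicators of the sets \<open>A j\<close>, while the remaining ones enter through a cosine with arbitrary
  frequencies and phase. A further coordinate \<open>k\<close> is converted by the one-dimensional uniqueness
  theorem. Since that theorem concerns nonnegative weights, the cosine of the coordinates other than
  \<open>k\<close> is replaced by \<open>1 + cos\<close>; the product formula for cosines brings the transforms of this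
  weight back to the induction hypothesis, and frequency zero separates the summand \<open>1\<close> from the
  cosine afterwards.\<close>

lemma joint_law_eqI:
  fixes X :: "'i \<Rightarrow> 'a \<Rightarrow> real" and Y :: "'i \<Rightarrow> 'b \<Rightarrow> real"
  assumes "prob_space M" "prob_space M'" "finite J"
    and X [measurable]: "\<And>j. j \<in> J \<Longrightarrow> X j \<in> borel_measurable M"
    and Y [measurable]: "\<And>j. j \<in> J \<Longrightarrow> Y j \<in> borel_measurable M'"
    and eq: "\<And>c. distr M borel (\<lambda>\<omega>. \<Sum>j\<in>J. c j * X j \<omega>) = distr M' borel (\<lambda>\<omega>. \<Sum>j\<in>J. c j * Y j \<omega>)"
    and A [measurable]: "\<And>j. j \<in> J \<Longrightarrow> A j \<in> sets borel"
  shows "measure M {\<omega> \<in> space M. \<forall>j\<in>J. X j \<omega> \<in> A j} = measure M' {\<omega> \<in> space M'. \<forall>j\<in>J. Y j \<omega> \<in> A j}"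
proof -
  interpret M: prob_space M by fact
  interpret M': prob_space M' by fact
  \<comment> \<open>indicators of the coordinates in \<open>F\<close>, and the linear combination of the other ones\<close>
  define Z where "Z F \<omega> = (\<Prod>j\<in>F. indicator (A j) (X j \<omega>) :: real)" for F \<omega>
  define Z' where "Z' F \<omega> = (\<Prod>j\<in>F. indicator (A j) (Y j \<omega>) :: real)" for F \<omega>
  define T where "T F c \<omega> = (\<Sum>j\<in>J - F. c j * X j \<omega>)" for F c \<omega>
  define T' where "T' F c \<omega> = (\<Sum>j\<in>J - F. c j * Y j \<omega>)" for F c \<omega>
  have Z_meas: "Z F \<in> borel_measurable M" "Z' F \<in> borel_measurable M'" if "F \<subseteq> J" for F
  proof -
    have "(\<lambda>\<omega>. indicator (A j) (X j \<omega>) :: real) \<in> borel_measurable M"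
      "(\<lambda>\<omega>. indicator (A j) (Y j \<omega>) :: real) \<in> borel_measurable M'" if "j \<in> F" for j
      using X[of j] Y[of j] A[of j] that \<open>F \<subseteq> J\<close>
      by (auto intro: measurable_compose[OF _ borel_measurable_indicator])
    then show "Z F \<in> borel_measurable M" "Z' F \<in> borel_measurable M'"
      unfolding Z_def[abs_def] Z'_def[abs_def] by (auto intro!: borel_measurable_prod)
  qed
  have T_meas: "T F c \<in> borel_measurable M" "T' F c \<in> borel_measurable M'" for F c
    unfolding T_def[abs_def] T'_def[abs_def]
    by (intro borel_measurable_sum borel_measurable_times borel_measurable_const X Y; simp)+
  have Z_bounds: "0 \<le> Z F \<omega> \<and> Z F \<omega> \<le> 1" "0 \<le> Z' F \<omega>' \<and> Z' F \<omega>' \<le> 1" for F \<omega> \<omega>'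
    unfolding Z_def Z'_def by (auto intro!: prod_nonneg prod_le_1 simp: indicator_def)
  have int: "integrable M (\<lambda>\<omega>. Z F \<omega> * cos (k \<omega>))" if "F \<subseteq> J" "k \<in> borel_measurable M" for F k
  proof (rule M.integrable_const_bound[of _ 1])
    show "AE \<omega> in M. norm (Z F \<omega> * cos (k \<omega>)) \<le> 1"
      using Z_bounds(1)[of F] by (intro AE_I2) (auto simp: abs_mult intro!: mult_le_one)
    show "(\<lambda>\<omega>. Z F \<omega> * cos (k \<omega>)) \<in> borel_measurable M"
      using that Z_meas(1)[OF that(1)] by measurable
  qed
  have int': "integrable M' (\<lambda>\<omega>. Z' F \<omega> * cos (k \<omega>))" if "F \<subseteq> J" "k \<in> borel_measurable M'" for F k
  proof (rule M'.integrable_const_bound[of _ 1])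
    show "AE \<omega> in M'. norm (Z' F \<omega> * cos (k \<omega>)) \<le> 1"
      using Z_bounds(2)[of F] by (intro AE_I2) (auto simp: abs_mult intro!: mult_le_one)
    show "(\<lambda>\<omega>. Z' F \<omega> * cos (k \<omega>)) \<in> borel_measurable M'"
      using that Z_meas(2)[OF that(1)] by measurable
  qed
  have main: "(\<integral>\<omega>. Z F \<omega> * cos (T F c \<omega> + \<phi>) \<partial>M) = (\<integral>\<omega>. Z' F \<omega> * cos (T' F c \<omega> + \<phi>) \<partial>M')"
    if "finite F" "F \<subseteq> J" for F c \<phi>
    using that
  proof (induction F arbitrary: c \<phi> rule: finite_induct)
    case empty
    have X': "(\<lambda>\<omega>. \<Sum>j\<in>J. c j * X j \<omega>) \<in> borel_measurable M"
      and Y': "(\<lambda>\<omega>. \<Sum>j\<in>J. c j * Y j \<omega>) \<in> borel_measurable M'"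
      using T_meas[of "{}" c] by (simp_all add: T_def[abs_def] T'_def[abs_def])
    have "(\<integral>\<omega>. cos ((\<Sum>j\<in>J. c j * X j \<omega>) + \<phi>) \<partial>M)
        = (\<integral>y. cos (y + \<phi>) \<partial>distr M borel (\<lambda>\<omega>. \<Sum>j\<in>J. c j * X j \<omega>))"
      by (subst integral_distr[OF X']) auto
    also have "\<dots> = (\<integral>y. cos (y + \<phi>) \<partial>distr M' borel (\<lambda>\<omega>. \<Sum>j\<in>J. c j * Y j \<omega>))"
      by (simp only: eq)
    also have "\<dots> = (\<integral>\<omega>. cos ((\<Sum>j\<in>J. c j * Y j \<omega>) + \<phi>) \<partial>M')"
      by (subst integral_distr[OF Y']) auto
    finally show ?case
      by (simp add: Z_def Z'_def T_def T'_def)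
  next
    case (insert k F)
    then have F: "F \<subseteq> J" "k \<in> J" "k \<notin> F" "J - F = insert k (J - insert k F)" "finite (J - insert k F)"
      using assms(3) by auto
    note IH = insert.IH[OF F(1)]
    have Xk: "X k \<in> borel_measurable M" and Yk: "Y k \<in> borel_measurable M'"
      using F(2) by (auto intro: X Y)
    have T_upd: "T F (c(k := s)) \<omega> = s * X k \<omega> + T (insert k F) c \<omega>"
      "T' F (c(k := s)) \<omega>' = s * Y k \<omega>' + T' (insert k F) c \<omega>'" for c s \<omega> \<omega>'
      unfolding T_def T'_def F(4) using F(5) by (auto intro!: sum.cong)
    have T_uminus: "T G (\<lambda>j. - c j) \<omega> = - T G c \<omega>" "T' G (\<lambda>j. - c j) \<omega>' = - T' G c \<omega>'"
      for G c \<omega> \<omega>'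
      by (simp_all add: T_def T'_def sum_negf)
    have T_zero: "T G (\<lambda>j. 0) \<omega> = 0" "T' G (\<lambda>j. 0) \<omega>' = 0" for G \<omega> \<omega>'
      by (simp_all add: T_def T'_def)
    define w where "w c \<phi> \<omega> = Z F \<omega> * (1 + cos (T (insert k F) c \<omega> + \<phi>))" for c \<phi> \<omega>
    define w' where "w' c \<phi> \<omega> = Z' F \<omega> * (1 + cos (T' (insert k F) c \<omega> + \<phi>))" for c \<phi> \<omega>
    have w_bound: "0 \<le> w c \<phi> \<omega> \<and> w c \<phi> \<omega> \<le> 2" "0 \<le> w' c \<phi> \<omega>' \<and> w' c \<phi> \<omega>' \<le> 2"
      for c \<phi> \<omega> \<omega>'
    proof -
      have c: "0 \<le> 1 + cos x" "1 + cos x \<le> 2" for x :: real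
        using cos_ge_minus_one[of x] cos_le_one[of x] by linarith+
      have "z * (1 + cos x) \<le> 1 * 2" if "0 \<le> z" "z \<le> 1" for x z :: real
        using that c by (intro mult_mono) auto
      then show "0 \<le> w c \<phi> \<omega> \<and> w c \<phi> \<omega> \<le> 2" "0 \<le> w' c \<phi> \<omega>' \<and> w' c \<phi> \<omega>' \<le> 2"
        unfolding w_def w'_def using Z_bounds(1)[of F \<omega>] Z_bounds(2)[of F \<omega>'] c by auto
    qed
    have w_meas: "w c \<phi> \<in> borel_measurable M" "w' c \<phi> \<in> borel_measurable M'" for c \<phi>
      unfolding w_def[abs_def] w'_def[abs_def]
      using Z_meas[OF F(1)] T_meas[of "insert k F" c] by measurable
    have prod: "(1 + cos (t + \<phi>)) * cos (a + \<psi>)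
        = cos (a + 0 + \<psi>) + cos (a + t + (\<phi> + \<psi>)) / 2 + cos (a + - t + (\<psi> - \<phi>)) / 2" for a t \<phi> \<psi> :: real
    proof -
      have "cos (t + \<phi>) * cos (a + \<psi>) = (cos ((t + \<phi>) - (a + \<psi>)) + cos ((t + \<phi>) + (a + \<psi>))) / 2"
        by (rule cos_times_cos)
      also have "cos ((t + \<phi>) - (a + \<psi>)) = cos (a + - t + (\<psi> - \<phi>))"
        by (subst cos_minus[symmetric]) (simp add: algebra_simps)
      finally show ?thesis
        by (simp add: algebra_simps add_divide_distrib)
    qed
    have "(\<integral>\<omega>. w c \<phi> \<omega> * cos (s * X k \<omega> + \<psi>) \<partial>M) = (\<integral>\<omega>. w' c \<phi> \<omega> * cos (s * Y k \<omega> + \<psi>) \<partial>M')"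
      for c \<phi> s \<psi>
    proof -
      \<comment> \<open>the frequency vectors of the three summands in the product formula\<close>
      define c1 c2 c3 where "c1 = (\<lambda>j. 0 :: real)(k := s)" and "c2 = c(k := s)"
        and "c3 = (\<lambda>j. - c j)(k := s)"
      have a: "w c \<phi> \<omega> * cos (s * X k \<omega> + \<psi>) = Z F \<omega> * cos (T F c1 \<omega> + \<psi>)
          + Z F \<omega> * cos (T F c2 \<omega> + (\<phi> + \<psi>)) / 2 + Z F \<omega> * cos (T F c3 \<omega> + (\<psi> - \<phi>)) / 2" for \<omega>
        unfolding w_def mult.assoc prod c1_def c2_def c3_def T_upd T_uminus T_zero
        by (simp add: algebra_simps)
      have b: "w' c \<phi> \<omega> * cos (s * Y k \<omega> + \<psi>) = Z' F \<omega> * cos (T' F c1 \<omega> + \<psi>)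
          + Z' F \<omega> * cos (T' F c2 \<omega> + (\<phi> + \<psi>)) / 2 + Z' F \<omega> * cos (T' F c3 \<omega> + (\<psi> - \<phi>)) / 2" for \<omega>
        unfolding w'_def mult.assoc prod c1_def c2_def c3_def T_upd T_uminus T_zero
        by (simp add: algebra_simps)
      have i: "integrable M (\<lambda>\<omega>. Z F \<omega> * cos (T F d \<omega> + \<theta>))" for d \<theta>
        using T_meas(1)[of F d] by (intro int F) simp
      have i': "integrable M' (\<lambda>\<omega>. Z' F \<omega> * cos (T' F d \<omega> + \<theta>))" for d \<theta>
        using T_meas(2)[of F d] by (intro int' F) simp
      show ?thesis
        unfolding a b using i i' by (simp add: IH)
    qed
    then have key: "(\<integral>\<omega>. w c \<phi> \<omega> * indicator (A k) (X k \<omega>) \<partial>M) = (\<integral>\<omega>. w' c \<phi> \<omega> * indicator (A k) (Y k \<omega>) \<partial>M')"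
      for c \<phi>
      by (intro weighted_law_eqI[OF assms(1,2) Xk w_meas(1) Yk w_meas(2) w_bound]) (auto intro: A F)
    have insert_Z: "Z (insert k F) \<omega> = Z F \<omega> * indicator (A k) (X k \<omega>)"
      "Z' (insert k F) \<omega>' = Z' F \<omega>' * indicator (A k) (Y k \<omega>')" for \<omega> \<omega>'
      using F(3) insert.hyps by (simp_all add: Z_def Z'_def mult.commute)
    have split: "w c \<phi> \<omega> * indicator (A k) (X k \<omega>)
        = Z (insert k F) \<omega> + Z (insert k F) \<omega> * cos (T (insert k F) c \<omega> + \<phi>)"
      "w' c \<phi> \<omega>' * indicator (A k) (Y k \<omega>')
        = Z' (insert k F) \<omega>' + Z' (insert k F) \<omega>' * cos (T' (insert k F) c \<omega>' + \<phi>)" for c \<phi> \<omega> \<omega>'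
      by (simp_all add: w_def w'_def insert_Z algebra_simps)
    have i: "integrable M (Z (insert k F))" "integrable M' (Z' (insert k F))"
      "integrable M (\<lambda>\<omega>. Z (insert k F) \<omega> * cos (T (insert k F) c \<omega> + \<phi>))"
      "integrable M' (\<lambda>\<omega>. Z' (insert k F) \<omega> * cos (T' (insert k F) c \<omega> + \<phi>))" for c \<phi>
      using int[OF insert.prems, of "\<lambda>_. 0"] int'[OF insert.prems, of "\<lambda>_. 0"]
        int[OF insert.prems, of "\<lambda>\<omega>. T (insert k F) c \<omega> + \<phi>"]
        int'[OF insert.prems, of "\<lambda>\<omega>. T' (insert k F) c \<omega> + \<phi>"] T_meas[of "insert k F" c]
      by simp_all
    have sum_eq: "(\<integral>\<omega>. Z (insert k F) \<omega> \<partial>M) + (\<integral>\<omega>. Z (insert k F) \<omega> * cos (T (insert k F) c \<omega> + \<phi>) \<partial>M)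
        = (\<integral>\<omega>. Z' (insert k F) \<omega> \<partial>M') + (\<integral>\<omega>. Z' (insert k F) \<omega> * cos (T' (insert k F) c \<omega> + \<phi>) \<partial>M')"
      for c \<phi>
      using key[of c \<phi>] i unfolding split by simp
    have "(\<integral>\<omega>. Z (insert k F) \<omega> \<partial>M) = (\<integral>\<omega>. Z' (insert k F) \<omega> \<partial>M')"
      using sum_eq[of "\<lambda>_. 0" 0] by (simp add: T_zero)
    then show ?case
      using sum_eq[of c \<phi>] by simp
  qed
  have "(\<integral>\<omega>. Z J \<omega> \<partial>M) = (\<integral>\<omega>. Z' J \<omega> \<partial>M')"
    using main[OF assms(3) subset_refl, of "\<lambda>_. 0" 0] by (simp add: T_def T'_def)
  moreover have "(\<integral>\<omega>. Z J \<omega> \<partial>M) = measure M {\<omega> \<in> space M. \<forall>j\<in>J. X j \<omega> \<in> A j}"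
  proof -
    have "Z J \<omega> = indicator {\<omega> \<in> space M. \<forall>j\<in>J. X j \<omega> \<in> A j} \<omega>" if "\<omega> \<in> space M" for \<omega>
      using that assms(3) by (auto simp: Z_def indicator_def intro!: prod.neutral prod_zero)
    then have "(\<integral>\<omega>. Z J \<omega> \<partial>M) = (\<integral>\<omega>. indicator {\<omega> \<in> space M. \<forall>j\<in>J. X j \<omega> \<in> A j} \<omega> \<partial>M)"
      by (intro Bochner_Integration.integral_cong refl)
    also have "\<dots> = measure M ({\<omega> \<in> space M. \<forall>j\<in>J. X j \<omega> \<in> A j} \<inter> space M)"
      by simp
    also have "{\<omega> \<in> space M. \<forall>j\<in>J. X j \<omega> \<in> A j} \<inter> space M = {\<omega> \<in> space M. \<forall>j\<in>J. X j \<omega> \<in> A j}"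
      by blast
    finally show ?thesis .
  qed
  moreover have "(\<integral>\<omega>. Z' J \<omega> \<partial>M') = measure M' {\<omega> \<in> space M'. \<forall>j\<in>J. Y j \<omega> \<in> A j}"
  proof -
    have "Z' J \<omega> = indicator {\<omega> \<in> space M'. \<forall>j\<in>J. Y j \<omega> \<in> A j} \<omega>" if "\<omega> \<in> space M'" for \<omega>
      using that assms(3) by (auto simp: Z'_def indicator_def intro!: prod.neutral prod_zero)
    then have "(\<integral>\<omega>. Z' J \<omega> \<partial>M') = (\<integral>\<omega>. indicator {\<omega> \<in> space M'. \<forall>j\<in>J. Y j \<omega> \<in> A j} \<omega> \<partial>M')"
      by (intro Bochner_Integration.integral_cong refl)
    also have "\<dots> = measure M' ({\<omega> \<in> space M'. \<forall>j\<in>J. Y j \<omega> \<in> A j} \<inter> space M')"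
      by simp
    also have "{\<omega> \<in> space M'. \<forall>j\<in>J. Y j \<omega> \<in> A j} \<inter> space M' = {\<omega> \<in> space M'. \<forall>j\<in>J. Y j \<omega> \<in> A j}"
      by blast
    finally show ?thesis .
  qed
  ultimately show ?thesis
    by simp
qed

text \<open>Cylinder sets over finite sets of indices generate the product \<open>\<sigma>\<close>-algebra.\<close>

lemma field_law_eqI:
  assumes "prob_space N"
    and X: "\<And>i. i \<in> I \<Longrightarrow> X i \<in> borel_measurable N"
    and Y: "\<And>i. i \<in> I \<Longrightarrow> Y i \<in> borel_measurable N"
    and eq: "\<And>J c. finite J \<Longrightarrow> J \<subseteq> I \<Longrightarrow>
      distr N borel (\<lambda>\<omega>. \<Sum>i\<in>J. c i * X i \<omega>) = distr N borel (\<lambda>\<omega>. \<Sum>i\<in>J. c i * Y i \<omega>)"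
  shows "field_law N I X = field_law N I Y"
  unfolding field_law_def
proof (rule measure_eqI_PiM_infinite)
  interpret N: prob_space N by fact
  have Xm: "(\<lambda>\<omega>. \<lambda>i\<in>I. X i \<omega>) \<in> measurable N (\<Pi>\<^sub>M i\<in>I. borel)"
    and Ym: "(\<lambda>\<omega>. \<lambda>i\<in>I. Y i \<omega>) \<in> measurable N (\<Pi>\<^sub>M i\<in>I. borel)"
    by (auto intro!: measurable_restrict X Y)
  show "finite_measure (distr N (\<Pi>\<^sub>M i\<in>I. borel) (\<lambda>\<omega>. \<lambda>i\<in>I. X i \<omega>))"
    by (rule N.finite_measure_distr[OF Xm])
  fix J and A :: "'b \<Rightarrow> real set"
  assume J: "finite J" "J \<subseteq> I" and A: "\<And>i. i \<in> J \<Longrightarrow> A i \<in> sets borel"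
  have meas: "prod_emb I (\<lambda>_. borel) J (Pi\<^sub>E J A) \<in> sets (\<Pi>\<^sub>M i\<in>I. (borel :: real measure))"
    using J A by (intro sets_PiM_I) auto
  have vim: "(\<lambda>\<omega>. \<lambda>i\<in>I. V i \<omega>) -` prod_emb I (\<lambda>_. borel) J (Pi\<^sub>E J A) \<inter> space N
      = {\<omega> \<in> space N. \<forall>j\<in>J. V j \<omega> \<in> A j}" for V :: "'b \<Rightarrow> 'a \<Rightarrow> real"
    using J(2) by (auto simp: prod_emb_def PiE_iff subset_iff)
  show "emeasure (distr N (\<Pi>\<^sub>M i\<in>I. borel) (\<lambda>\<omega>. \<lambda>i\<in>I. X i \<omega>)) (prod_emb I (\<lambda>_. borel) J (Pi\<^sub>E J A))
      = emeasure (distr N (\<Pi>\<^sub>M i\<in>I. borel) (\<lambda>\<omega>. \<lambda>i\<in>I. Y i \<omega>)) (prod_emb I (\<lambda>_. borel) J (Pi\<^sub>E J A))"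
    unfolding emeasure_distr[OF Xm meas] emeasure_distr[OF Ym meas] vim N.emeasure_eq_measure
    using J X Y A by (subst joint_law_eqI[OF assms(1) assms(1) J(1), where Y = Y]) (auto intro: eq)
qed simp_all

section \<open>White noise and the fractional Brownian field\<close>

lemma second_moment_centered_normal:
  assumes "0 \<le> \<sigma>"
  shows "(\<integral>x. x\<^sup>2 \<partial>centered_normal \<sigma>) = \<sigma>\<^sup>2"
proof (cases "\<sigma> = 0")
  case True
  then show ?thesis
    by (simp add: centered_normal_def integral_return)
next
  case False
  then have "(\<integral>x. x\<^sup>2 \<partial>centered_normal \<sigma>) = (\<integral>x. normal_density 0 \<sigma> x *\<^sub>R x\<^sup>2 \<partial>lborel)"
    unfolding centered_normal_def by (simp add: integral_density)
  also have "\<dots> = (\<integral>x. normal_density 0 \<sigma> x * (x - 0) ^ (2 * 1) \<partial>lborel)"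
    by simp
  also have "\<dots> = \<sigma>\<^sup>2"
    using assms False by (subst integral_normal_moment_even) (auto simp: fact_numeral)
  finally show ?thesis .
qed

locale white_noise_space = gasket_measure_space +
  fixes N :: "'w measure" and W :: "(complex \<Rightarrow> real) \<Rightarrow> 'w \<Rightarrow> real"
  assumes white_noise: "white_noise \<mu> N W"
begin

lemma prob_space_N: "prob_space N"
  and W_linear: "f \<in> L2_0 \<mu> \<Longrightarrow> g \<in> L2_0 \<mu> \<Longrightarrow>
    AE \<omega> in N. W (\<lambda>z. a * f z + b * g z) \<omega> = a * W f \<omega> + b * W g \<omega>"
  and W_isometry: "f \<in> L2_0 \<mu> \<Longrightarrow> g \<in> L2_0 \<mu> \<Longrightarrow>
    (\<integral>\<omega>. W f \<omega> * W g \<omega> \<partial>N) = (\<integral>x. f x * g x \<partial>\<mu>)"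
  and W_measurable: "f \<in> L2_0 \<mu> \<Longrightarrow> W f \<in> borel_measurable N"
  using white_noise by (simp_all add: white_noise_def centered_jointly_gaussian_def)

text \<open>A centred normal law is determined by its second moment, which the isometry identifies.\<close>

lemma W_normal:
  assumes "f \<in> L2_0 \<mu>"
  shows "distr N borel (W f) = centered_normal (norm2 \<mu> f)"
proof -
  have "centered_jointly_gaussian N (L2_0 \<mu>) W"
    using white_noise by (simp add: white_noise_def)
  then have "\<forall>J c. finite J \<and> J \<subseteq> L2_0 \<mu> \<longrightarrow>
      (\<exists>\<sigma>\<ge>0. distr N borel (\<lambda>\<omega>. \<Sum>g\<in>J. c g * W g \<omega>) = centered_normal \<sigma>)"
    unfolding centered_jointly_gaussian_def by (rule conjunct2)
  from spec[OF spec[OF this, of "{f}"], of "\<lambda>_. 1"]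
  obtain \<sigma> where \<sigma>: "0 \<le> \<sigma>" "distr N borel (W f) = centered_normal \<sigma>"
    using assms by auto
  have "(\<integral>x. (f x)\<^sup>2 \<partial>\<mu>) = (\<integral>\<omega>. (W f \<omega>)\<^sup>2 \<partial>N)"
    using W_isometry[OF assms assms] by (simp add: power2_eq_square)
  also have "\<dots> = (\<integral>x. x\<^sup>2 \<partial>distr N borel (W f))"
    by (rule integral_distr[symmetric]) (use W_measurable[OF assms] in auto)
  also have "\<dots> = \<sigma>\<^sup>2"
    using \<sigma> second_moment_centered_normal by simp
  finally show ?thesis
    using \<sigma> by simp
qed

lemma L2_0_lincomb:
  assumes "f \<in> L2_0 \<mu>" "g \<in> L2_0 \<mu>"
  shows "(\<lambda>z. a * f z + b * g z) \<in> L2_0 \<mu>"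
proof -
  have m: "f \<in> L2 \<mu>" "g \<in> L2 \<mu>" "(\<integral>x. f x \<partial>\<mu>) = 0" "(\<integral>x. g x \<partial>\<mu>) = 0"
    using assms by (auto simp: L2_0_def)
  then show ?thesis
    using L2_integrable[OF m(1)] L2_integrable[OF m(2)] by (simp add: L2_0_def L2_lincomb)
qed

lemma L2_0_zero: "(\<lambda>z. 0) \<in> L2_0 \<mu>"
  by (simp add: L2_0_def L2_def)

lemma L2_0_sum:
  assumes "finite J" "\<And>j. j \<in> J \<Longrightarrow> g j \<in> L2_0 \<mu>"
  shows "(\<lambda>z. \<Sum>j\<in>J. c j * g j z) \<in> L2_0 \<mu>"
  using assms
proof (induction J rule: finite_induct)
  case (insert k J)
  then show ?case
    using L2_0_lincomb[of "g k" "\<lambda>z. \<Sum>j\<in>J. c j * g j z" "c k" 1] by simp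
qed (simp add: L2_0_zero)

lemma W_sum:
  assumes "finite J" "\<And>j. j \<in> J \<Longrightarrow> g j \<in> L2_0 \<mu>"
  shows "AE \<omega> in N. W (\<lambda>z. \<Sum>j\<in>J. c j * g j z) \<omega> = (\<Sum>j\<in>J. c j * W (g j) \<omega>)"
  using assms
proof (induction J rule: finite_induct)
  case empty
  show ?case
    using W_linear[OF L2_0_zero L2_0_zero, of 0 0] by simp
next
  case (insert k J)
  have "AE \<omega> in N. W (\<lambda>z. c k * g k z + 1 * (\<Sum>j\<in>J. c j * g j z)) \<omega>
      = c k * W (g k) \<omega> + 1 * W (\<lambda>z. \<Sum>j\<in>J. c j * g j z) \<omega>"
    using insert by (intro W_linear L2_0_sum) auto
  moreover have "AE \<omega> in N. W (\<lambda>z. \<Sum>j\<in>J. c j * g j z) \<omega> = (\<Sum>j\<in>J. c j * W (g j) \<omega>)"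
    using insert by auto
  ultimately show ?case
    by eventually_elim (simp add: insert.hyps)
qed

text \<open>The combination of the integrals is almost surely the integral of the combination of the
  integrands. Integrands outside \<open>L2_0 \<mu>\<close> have integral \<open>0\<close> by convention and drop out.\<close>

lemma white_noise_integral_sum_law:
  assumes J: "finite J"
  shows "distr N borel (\<lambda>\<omega>. \<Sum>j\<in>J. c j * white_noise_integral \<mu> W (g j) \<omega>)
    = centered_normal (norm2 \<mu> (\<lambda>z. \<Sum>j\<in>{j\<in>J. g j \<in> L2_0 \<mu>}. c j * g j z))"
proof -
  let ?J = "{j\<in>J. g j \<in> L2_0 \<mu>}"
  have "(\<Sum>j\<in>J. c j * white_noise_integral \<mu> W (g j) \<omega>) = (\<Sum>j\<in>?J. c j * W (g j) \<omega>)" for \<omega>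
    using J by (intro sum.mono_neutral_cong_right) (auto simp: white_noise_integral_def)
  then have "distr N borel (\<lambda>\<omega>. \<Sum>j\<in>J. c j * white_noise_integral \<mu> W (g j) \<omega>)
      = distr N borel (\<lambda>\<omega>. \<Sum>j\<in>?J. c j * W (g j) \<omega>)"
    by simp
  also have "\<dots> = distr N borel (W (\<lambda>z. \<Sum>j\<in>?J. c j * g j z))"
  proof (rule distr_cong_AE)
    show "AE \<omega> in N. (\<Sum>j\<in>?J. c j * W (g j) \<omega>) = W (\<lambda>z. \<Sum>j\<in>?J. c j * g j z) \<omega>"
    proof -
      have "AE \<omega> in N. W (\<lambda>z. \<Sum>j\<in>?J. c j * g j z) \<omega> = (\<Sum>j\<in>?J. c j * W (g j) \<omega>)"
        using J by (intro W_sum) simp_all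
      then show ?thesis
        by eventually_elim (rule sym)
    qed
    show "(\<lambda>\<omega>. \<Sum>j\<in>?J. c j * W (g j) \<omega>) \<in> borel_measurable N"
      by (intro borel_measurable_sum borel_measurable_times borel_measurable_const W_measurable) auto
    show "W (\<lambda>z. \<Sum>j\<in>?J. c j * g j z) \<in> borel_measurable N"
      using J by (intro W_measurable L2_0_sum) auto
  qed simp_all
  also have "\<dots> = centered_normal (norm2 \<mu> (\<lambda>z. \<Sum>j\<in>?J. c j * g j z))"
    using J by (intro W_normal L2_0_sum) auto
  finally show ?thesis .
qed

lemma white_noise_integral_measurable: "white_noise_integral \<mu> W f \<in> borel_measurable N"
  using W_measurable[of f] by (cases "f \<in> L2_0 \<mu>") (simp_all add: white_noise_integral_def[abs_def])

text \<open>The functions live on the whole plane, but only their values on the gasket matter.\<close>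

lemma L2_0_reflection:
  assumes i: "i \<in> {1, 2, 3}" and g: "\<And>z. z \<in> gasket \<Longrightarrow> g' z = g (gasket_reflection i z)"
    and "g \<in> L2_0 \<mu>"
  shows "g' \<in> L2_0 \<mu>"
proof -
  have gL2: "g \<in> L2 \<mu>" "(\<integral>x. g x \<partial>\<mu>) = 0"
    using assms(3) by (auto simp: L2_0_def)
  have m: "(\<lambda>z. g (gasket_reflection i z)) \<in> L2 \<mu>" "(\<integral>z. g (gasket_reflection i z) \<partial>\<mu>) = 0"
    using L2_reflection[OF i gL2(1)] integral_reflection[OF i L2_measurable[OF gL2(1)]] gL2(2) by simp_all
  have "g' \<in> borel_measurable \<mu>"
    using L2_measurable[OF m(1)] by (rule measurable_cong[THEN iffD2, rotated]) (simp add: g)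
  moreover have "integrable \<mu> (\<lambda>z. (g' z)\<^sup>2)"
    using L2_integrable_square[OF m(1)]
    by (rule Bochner_Integration.integrable_cong[THEN iffD2, OF refl, rotated]) (simp add: g)
  moreover have "(\<integral>z. g' z \<partial>\<mu>) = (\<integral>z. g (gasket_reflection i z) \<partial>\<mu>)"
    by (rule Bochner_Integration.integral_cong) (simp_all add: g)
  ultimately show ?thesis
    using m(2) by (simp add: L2_0_def L2_def)
qed

end

theorem proposition3p10:
  fixes \<mu> :: "complex measure"
    and P :: "real \<Rightarrow> (complex \<Rightarrow> real) \<Rightarrow> (complex \<Rightarrow> real)"
    and p :: "real \<Rightarrow> complex \<Rightarrow> complex \<Rightarrow> real"
    and N :: "'w measure"
    and W :: "(complex \<Rightarrow> real) \<Rightarrow> 'w \<Rightarrow> real"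
    and H :: real
    and i :: nat
  assumes "gasket_measure \<mu>"
    and "heat_semigroup \<mu> P"
    and "heat_kernel \<mu> P p"
    and "white_noise \<mu> N W"
    and "0 < H" and "H < dim_w - dim_h"
    and "i \<in> {1, 2, 3}"
  shows "field_law N gasket (\<lambda>x. fractional_brownian_field \<mu> p W H (gasket_reflection i x)) =
         field_law N gasket (fractional_brownian_field \<mu> p W H)"
proof -
  interpret gasket_kernel \<mu> P p
    by unfold_locales fact+
  interpret white_noise_space \<mu> N W
    by unfold_locales fact
  let ?\<sigma> = "gasket_reflection i"
  note i = \<open>i \<in> {1, 2, 3}\<close>
  define g where "g = riesz_kernel p ((dim_h + 2 * H) / (2 * dim_w))"
  have riesz: "g (?\<sigma> x) z = g x (?\<sigma> z)" if x: "x \<in> gasket" and z: "z \<in> gasket" for x z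
  proof -
    have "p t (?\<sigma> x) z = p t x (?\<sigma> z)" if "0 < t" for t
      using heat_kernel_reflection[OF gasket_kernel_axioms i that x gasket_reflection_mem[OF i z]]
      by (simp only: gasket_reflection_involution[OF i])
    then show ?thesis
      unfolding g_def riesz_kernel_def
      by (intro arg_cong2[where f = "(*)"] refl set_lebesgue_integral_cong) auto
  qed
  have L2_0_iff: "g (?\<sigma> x) \<in> L2_0 \<mu> \<longleftrightarrow> g x \<in> L2_0 \<mu>" if x: "x \<in> gasket" for x
  proof
    show "g (?\<sigma> x) \<in> L2_0 \<mu>" if "g x \<in> L2_0 \<mu>"
      using riesz[OF x] that by (rule L2_0_reflection[OF i])
    show "g x \<in> L2_0 \<mu>" if "g (?\<sigma> x) \<in> L2_0 \<mu>"
      by (rule L2_0_reflection[OF i _ that])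
        (use riesz[OF gasket_reflection_mem[OF i x]] in \<open>simp only: gasket_reflection_involution[OF i]\<close>)
  qed
  show ?thesis
    unfolding fractional_brownian_field_def g_def[symmetric]
  proof (rule field_law_eqI[OF prob_space_N white_noise_integral_measurable white_noise_integral_measurable])
    fix J :: "complex set" and c :: "complex \<Rightarrow> real"
    assume J: "finite J" "J \<subseteq> gasket"
    \<comment> \<open>the same points carry a proper integrand before and after the reflection\<close>
    define S where "S = {x\<in>J. g x \<in> L2_0 \<mu>}"
    have S: "finite S" "S \<subseteq> gasket" "{x\<in>J. g (?\<sigma> x) \<in> L2_0 \<mu>} = S"
      using J L2_0_iff by (auto simp: S_def)
    have "(\<lambda>z. \<Sum>x\<in>S. c x * g x z) \<in> L2_0 \<mu>"
      using S by (intro L2_0_sum) (auto simp: S_def)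
    then have meas: "(\<lambda>z. \<Sum>x\<in>S. c x * g x z) \<in> borel_measurable \<mu>"
      by (simp add: L2_0_def L2_measurable)
    have "(\<integral>z. (\<Sum>x\<in>S. c x * g (?\<sigma> x) z)\<^sup>2 \<partial>\<mu>) = (\<integral>z. (\<Sum>x\<in>S. c x * g x (?\<sigma> z))\<^sup>2 \<partial>\<mu>)"
      using S(2) by (intro Bochner_Integration.integral_cong refl arg_cong[where f = "\<lambda>a. a\<^sup>2"] sum.cong)
        (auto simp: riesz)
    also have "\<dots> = (\<integral>z. (\<Sum>x\<in>S. c x * g x z)\<^sup>2 \<partial>\<mu>)"
      by (rule integral_reflection[OF i, of "\<lambda>z. (\<Sum>x\<in>S. c x * g x z)\<^sup>2"]) (use meas in simp)
    finally have "norm2 \<mu> (\<lambda>z. \<Sum>x\<in>S. c x * g (?\<sigma> x) z) = norm2 \<mu> (\<lambda>z. \<Sum>x\<in>S. c x * g x z)"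
      by simp
    then show "distr N borel (\<lambda>\<omega>. \<Sum>x\<in>J. c x * white_noise_integral \<mu> W (g (?\<sigma> x)) \<omega>)
        = distr N borel (\<lambda>\<omega>. \<Sum>x\<in>J. c x * white_noise_integral \<mu> W (g x) \<omega>)"
      using white_noise_integral_sum_law[OF J(1), of c "\<lambda>x. g (?\<sigma> x)"]
        white_noise_integral_sum_law[OF J(1), of c g]
      by (simp only: S(3) S_def[symmetric])
  qed
qed

end
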